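(* Let $\mathbb{K}$ be a field and let $C$ be the path coalgebra over $\mathbb{K}$ of the quiver with exactly two vertices $a,b$ and countably infinitely many arrows $x_n$ ($n\ge 1$), each starting at $a$ and ending at $b$. Let $S=\mathbb{K}a$ and $T=\mathbb{K}b$, regarded as simple right $C$-comodules, and let $E$ be the injective hull of $S$ in the category of right $C$-comodules (so $E$ has $\mathbb{K}$-basis $\{a\}\cup\{x_n\mid n\ge 1\}$). Then, computing $\mathrm{Ext}^1_{C^*}$ in the category of all left $C^*$-modules, $$\dim_{\mathbb{K}}\mathrm{Ext}^1_{C^*}(T,S)=\dim_{\mathbb{K}}\mathrm{Ext}^1_{C^*}(T,E)=|\mathbb{K}|^{\,|\mathbb{K}|^{\aleph_0}}.$$ In particular $\mathrm{Ext}^1_{C^*}(T,E)\neq 0$.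
   Context: The path coalgebra of a quiver over $\mathbb{K}$ has as basis the set of oriented paths (vertices being paths of length $0$), comultiplication $\Delta(r)=\sum_{r=pq}p\otimes q$ (sum over all factorizations of $r$ as the path $p$ followed by the path $q$) and counit $\varepsilon(p)=\delta_{0,|p|}$, where $|p|$ is the length of $p$. Here $C$ has basis $\{a,b\}\cup\{x_n\mid n\ge1\}$, with $\Delta(a)=a\otimes a$, $\Delta(b)=b\otimes b$, $\Delta(x_n)=a\otimes x_n+x_n\otimes b$. The dual $C^*$ is an algebra under the convolution product, and every right $C$-comodule $M$ with coaction $m\mapsto\sum m_0\otimes m_1$ is a left $C^*$-module via $c^*\cdot m=\sum c^*(m_1)m_0$. $|\mathbb{K}|$ denotes the cardinality of $\mathbb{K}$. *)

theory Defs
  imports "HOL-Algebra.AbelCoset" "Jordan_Normal_Form.Missing_VectorSpace" "Graph_Theory.Arc_Walk"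
begin

unbundle cardinal_syntax

hide_const (open) Modules.module_hom

section \<open>Modules\<close>

text \<open>
  The records and \<^const>\<open>module_hom\<close> are used for left modules over arbitrary (noncommutative)
  rings as well, where the locale \<open>module\<close> (which presupposes a commutative ring) does not apply.
\<close>

definition regular_module :: "('r, 'x) ring_scheme \<Rightarrow> ('r, 'r) module" where
  "regular_module R = \<lparr>carrier = carrier R, mult = mult R, one = one R,
     zero = zero R, add = add R, smult = mult R\<rparr>"

definition supp :: "('a, 'x) ring_scheme \<Rightarrow> ('p \<Rightarrow> 'a) \<Rightarrow> 'p set" where
  "supp M f = {p. f p \<noteq> \<zero>\<^bsub>M\<^esub>}"

text \<open>The direct sum of copies of \<open>M\<close> indexed by \<open>P\<close>: finitely supported functions,
  by convention zero outside \<open>P\<close>.\<close>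

definition copower :: "('r, 'm, 'x) module_scheme \<Rightarrow> 'p set \<Rightarrow> ('r, 'p \<Rightarrow> 'm) module" where
  "copower M P = \<lparr>
     carrier = {f. (\<forall>p\<in>P. f p \<in> carrier M) \<and> (\<forall>p. p \<notin> P \<longrightarrow> f p = \<zero>\<^bsub>M\<^esub>) \<and> finite (supp M f)},
     mult = undefined, one = undefined,
     zero = (\<lambda>_. \<zero>\<^bsub>M\<^esub>),
     add = (\<lambda>f g p. f p \<oplus>\<^bsub>M\<^esub> g p),
     smult = (\<lambda>r f p. r \<odot>\<^bsub>M\<^esub> f p)\<rparr>"

definition free_module :: "('r, 'x) ring_scheme \<Rightarrow> 'p set \<Rightarrow> ('r, 'p \<Rightarrow> 'r) module" where
  "free_module R P = copower (regular_module R) P"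

definition unit_vec :: "('r, 'x) ring_scheme \<Rightarrow> 'p \<Rightarrow> 'p \<Rightarrow> 'r" where
  "unit_vec R p = (\<lambda>q. if q = p then \<one>\<^bsub>R\<^esub> else \<zero>\<^bsub>R\<^esub>)"

definition quotient_module ::
    "('r, 'm, 'x) module_scheme \<Rightarrow> 'm set \<Rightarrow> ('r, 'm set) module" where
  "quotient_module V W = \<lparr>
     carrier = a_rcosets\<^bsub>V\<^esub> W,
     mult = undefined, one = undefined,
     zero = W,
     add = (\<lambda>X Y. X <+>\<^bsub>V\<^esub> Y),
     smult = (\<lambda>k X. \<Union>x\<in>X. W +>\<^bsub>V\<^esub> (k \<odot>\<^bsub>V\<^esub> x))\<rparr>"

definition has_dimension ::
    "('k, 'x) ring_scheme \<Rightarrow> ('k, 'v, 'y) module_scheme \<Rightarrow> 'c rel \<Rightarrow> bool" where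
  "has_dimension K V \<kappa> \<longleftrightarrow> vectorspace K V \<and> (\<exists>B. vectorspace.basis K V B \<and> |B| =o \<kappa>)"

section \<open>\<open>Ext\<close> over a \<open>K\<close>-algebra\<close>

text \<open>\<open>R\<close> is a \<open>K\<close>-algebra with structure map \<open>\<eta> : K \<rightarrow> Z(R)\<close>, and \<open>Hom\<^sub>R(M, N)\<close> is a
  \<open>K\<close>-vector space through \<open>\<eta>\<close>. Homomorphisms are extensional, so that equality of
  functions is equality of maps on \<open>M\<close>.\<close>

definition hom_space :: "('k \<Rightarrow> 'r) \<Rightarrow> ('r, 'x) ring_scheme \<Rightarrow>
    ('r, 'm, 'y) module_scheme \<Rightarrow> ('r, 'n, 'z) module_scheme \<Rightarrow> ('k, 'm \<Rightarrow> 'n) module" where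
  "hom_space \<eta> R M N = \<lparr>
     carrier = module_hom R M N \<inter> extensional (carrier M),
     mult = undefined, one = undefined,
     zero = (\<lambda>x\<in>carrier M. \<zero>\<^bsub>N\<^esub>),
     add = (\<lambda>f g. \<lambda>x\<in>carrier M. f x \<oplus>\<^bsub>N\<^esub> g x),
     smult = (\<lambda>k f. \<lambda>x\<in>carrier M. \<eta> k \<odot>\<^bsub>N\<^esub> f x)\<rparr>"

text \<open>For a submodule \<open>X\<close> of \<open>A\<close>, the canonical map from the free module on the set \<open>X\<close> to \<open>A\<close>;
  its image is \<open>X\<close>.\<close>

definition free_cover :: "('r, 'x) ring_scheme \<Rightarrow> ('r, 'm, 'y) module_scheme \<Rightarrow> 'm set \<Rightarrow>
    ('m \<Rightarrow> 'r) \<Rightarrow> 'm" where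
  "free_cover R A X = (\<lambda>f\<in>carrier (free_module R X). \<Oplus>\<^bsub>A\<^esub>x\<in>supp R f. f x \<odot>\<^bsub>A\<^esub> x)"

text \<open>
  \<open>Ext\<^sup>1\<^sub>R(M, N)\<close> is the first cohomology of \<open>Hom\<^sub>R(F\<^sub>\<bullet>, N)\<close> for a projective resolution of \<open>M\<close>.
  We use the canonical free resolution
  \<open>\<dots> \<rightarrow> F\<^sub>2 \<rightarrow> F\<^sub>1 \<rightarrow> F\<^sub>0 \<rightarrow> M\<close> with \<open>F\<^sub>0 = R\<^sup>(\<^sup>M\<^sup>)\<close> and \<open>F\<^sub>i\<^sub>+\<^sub>1\<close> free on the underlying set of
  the kernel of the preceding map.
\<close>

definition Ext1 :: "('k \<Rightarrow> 'r) \<Rightarrow> ('r, 'x) ring_scheme \<Rightarrow>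
    ('r, 'm, 'y) module_scheme \<Rightarrow> ('r, 'n, 'z) module_scheme \<Rightarrow>
    ('k, ((('m \<Rightarrow> 'r) \<Rightarrow> 'r) \<Rightarrow> 'n) set) module" where
  "Ext1 \<eta> R M N =
    (let F0 = free_module R (carrier M);
         d0 = free_cover R M (carrier M);
         Z0 = a_kernel F0 M d0;
         F1 = free_module R Z0;
         d1 = free_cover R F0 Z0;
         Z1 = a_kernel F1 F0 d1;
         F2 = free_module R Z1;
         d2 = free_cover R F1 Z1;
         cocycles = {h \<in> carrier (hom_space \<eta> R F1 N). \<forall>x\<in>carrier F2. h (d2 x) = \<zero>\<^bsub>N\<^esub>};
         coboundaries = (\<lambda>g. compose (carrier F1) g d1) ` carrier (hom_space \<eta> R F0 N)
     in quotient_module ((hom_space \<eta> R F1 N)\<lparr>carrier := cocycles\<rparr>) coboundaries)"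

section \<open>The path coalgebra of a quiver\<close>

text \<open>A path is given by its source, its list of arrows and its target.\<close>

type_synonym ('v, 'e) qpath = "'v \<times> 'e list \<times> 'v"

definition paths :: "('v, 'e) pre_digraph \<Rightarrow> ('v, 'e) qpath set" where
  "paths Q = {(u, p, v). pre_digraph.awalk Q u p v}"

definition path_source :: "('v, 'e) qpath \<Rightarrow> 'v" where
  "path_source r = fst r"

definition path_target :: "('v, 'e) qpath \<Rightarrow> 'v" where
  "path_target r = snd (snd r)"

definition path_length :: "('v, 'e) qpath \<Rightarrow> nat" where
  "path_length r = length (fst (snd r))"

definition path_concat :: "('v, 'e) qpath \<Rightarrow> ('v, 'e) qpath \<Rightarrow> ('v, 'e) qpath" where
  "path_concat p q = (path_source p, fst (snd p) @ fst (snd q), path_target q)"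

definition factorizations ::
    "('v, 'e) pre_digraph \<Rightarrow> ('v, 'e) qpath \<Rightarrow> (('v, 'e) qpath \<times> ('v, 'e) qpath) set" where
  "factorizations Q r = {(p, q). p \<in> paths Q \<and> q \<in> paths Q \<and>
     path_target p = path_source q \<and> path_concat p q = r}"

definition path_space ::
    "('k, 'x) ring_scheme \<Rightarrow> ('v, 'e) pre_digraph \<Rightarrow> ('k, ('v, 'e) qpath \<Rightarrow> 'k) module" where
  "path_space K Q = free_module K (paths Q)"

text \<open>
  Since the path coalgebra \<open>C\<close> has the paths as a basis, \<open>M \<otimes> C\<close> is modelled as the direct sum
  of copies of \<open>M\<close> indexed by the paths: the function \<open>t\<close> stands for \<open>\<Sum>\<^sub>q t q \<otimes> q\<close>.
  In particular \<open>t q p\<close> is the coefficient of \<open>p \<otimes> q\<close> in an element \<open>t\<close> of \<open>C \<otimes> C\<close>.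
\<close>

definition tensor_space :: "('k, 'm, 'x) module_scheme \<Rightarrow> ('v, 'e) pre_digraph \<Rightarrow>
    ('k, ('v, 'e) qpath \<Rightarrow> 'm) module" where
  "tensor_space M Q = copower M (paths Q)"

definition tensor ::
    "('k, 'm, 'x) module_scheme \<Rightarrow> 'm \<Rightarrow> ('p \<Rightarrow> 'k) \<Rightarrow> 'p \<Rightarrow> 'm" where
  "tensor M m c = (\<lambda>q. c q \<odot>\<^bsub>M\<^esub> m)"

definition comult :: "('k, 'x) ring_scheme \<Rightarrow> ('v, 'e) pre_digraph \<Rightarrow>
    (('v, 'e) qpath \<Rightarrow> 'k) \<Rightarrow> ('v, 'e) qpath \<Rightarrow> ('v, 'e) qpath \<Rightarrow> 'k" where
  "comult K Q c =
    (let C = path_space K Q; CC = tensor_space C Q in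
     \<Oplus>\<^bsub>CC\<^esub>r\<in>supp K c. c r \<odot>\<^bsub>CC\<^esub>
       (\<Oplus>\<^bsub>CC\<^esub>f\<in>factorizations Q r. tensor C (unit_vec K (fst f)) (unit_vec K (snd f))))"

definition counit :: "('k, 'x) ring_scheme \<Rightarrow> (('v, 'e) qpath \<Rightarrow> 'k) \<Rightarrow> 'k" where
  "counit K c =
    (\<Oplus>\<^bsub>K\<^esub>r\<in>supp K c. c r \<otimes>\<^bsub>K\<^esub> (if path_length r = 0 then \<one>\<^bsub>K\<^esub> else \<zero>\<^bsub>K\<^esub>))"

section \<open>Right comodules\<close>

record ('k, 'm, 'p) comodule = "('k, 'm) module" +
  coact :: "'m \<Rightarrow> 'p \<Rightarrow> 'm"

text \<open>The last two conditions are \<open>(\<rho> \<otimes> id) \<circ> \<rho> = (id \<otimes> \<Delta>) \<circ> \<rho>\<close>, with the coefficients of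
  \<open>p \<otimes> r\<close> in \<open>M \<otimes> C \<otimes> C\<close> compared, and \<open>(id \<otimes> \<epsilon>) \<circ> \<rho> = id\<close>.\<close>

definition right_comodule :: "('k, 'x) ring_scheme \<Rightarrow> ('v, 'e) pre_digraph \<Rightarrow>
    ('k, 'm, ('v, 'e) qpath) comodule \<Rightarrow> bool" where
  "right_comodule K Q M \<longleftrightarrow>
     vectorspace K M \<and>
     coact M \<in> module_hom K M (tensor_space M Q) \<and>
     (\<forall>m\<in>carrier M. \<forall>r p. coact M (coact M m r) p =
        (\<Oplus>\<^bsub>M\<^esub>q\<in>supp M (coact M m). comult K Q (unit_vec K q) r p \<odot>\<^bsub>M\<^esub> coact M m q)) \<and>
     (\<forall>m\<in>carrier M.
        (\<Oplus>\<^bsub>M\<^esub>q\<in>supp M (coact M m). counit K (unit_vec K q) \<odot>\<^bsub>M\<^esub> coact M m q) = m)"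

definition comodule_hom :: "('k, 'x) ring_scheme \<Rightarrow> ('k, 'm, 'p) comodule \<Rightarrow>
    ('k, 'n, 'p) comodule \<Rightarrow> ('m \<Rightarrow> 'n) set" where
  "comodule_hom K M N =
     {f \<in> module_hom K M N. \<forall>m\<in>carrier M. coact N (f m) = (\<lambda>q. f (coact M m q))}"

definition subcomodule :: "('k, 'x) ring_scheme \<Rightarrow> ('v, 'e) pre_digraph \<Rightarrow> 'm set \<Rightarrow>
    ('k, 'm, ('v, 'e) qpath) comodule \<Rightarrow> bool" where
  "subcomodule K Q N M \<longleftrightarrow> N \<subseteq> carrier M \<and> right_comodule K Q (M\<lparr>carrier := N\<rparr>)"

definition simple_comodule :: "('k, 'x) ring_scheme \<Rightarrow> ('v, 'e) pre_digraph \<Rightarrow>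
    ('k, 'm, ('v, 'e) qpath) comodule \<Rightarrow> bool" where
  "simple_comodule K Q M \<longleftrightarrow> right_comodule K Q M \<and> carrier M \<noteq> {\<zero>\<^bsub>M\<^esub>} \<and>
     (\<forall>N. subcomodule K Q N M \<longrightarrow> N = {\<zero>\<^bsub>M\<^esub>} \<or> N = carrier M)"

text \<open>The type arguments are the types carrying the test comodules; a theorem
  that leaves them as type variables asserts injectivity against all comodules.\<close>

definition injective_comodule :: "'y itself \<Rightarrow> 'z itself \<Rightarrow> ('k, 'x) ring_scheme \<Rightarrow>
    ('v, 'e) pre_digraph \<Rightarrow> ('k, 'm, ('v, 'e) qpath) comodule \<Rightarrow> bool" where
  "injective_comodule TY TZ K Q E \<longleftrightarrow> right_comodule K Q E \<and>
     (\<forall>(M :: ('k, 'y, ('v, 'e) qpath) comodule) (N :: ('k, 'z, ('v, 'e) qpath) comodule) j f.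
        right_comodule K Q M \<and> right_comodule K Q N \<and>
        j \<in> comodule_hom K M N \<and> inj_on j (carrier M) \<and> f \<in> comodule_hom K M E \<longrightarrow>
        (\<exists>g\<in>comodule_hom K N E. \<forall>x\<in>carrier M. g (j x) = f x))"

definition injective_hull :: "'y itself \<Rightarrow> 'z itself \<Rightarrow> ('k, 'x) ring_scheme \<Rightarrow>
    ('v, 'e) pre_digraph \<Rightarrow> ('k, 's, ('v, 'e) qpath) comodule \<Rightarrow>
    ('k, 'm, ('v, 'e) qpath) comodule \<Rightarrow> ('s \<Rightarrow> 'm) \<Rightarrow> bool" where
  "injective_hull TY TZ K Q S E i \<longleftrightarrow>
     right_comodule K Q S \<and> injective_comodule TY TZ K Q E \<and>
     i \<in> comodule_hom K S E \<and> inj_on i (carrier S) \<and>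
     (\<forall>N. subcomodule K Q N E \<and> N \<noteq> {\<zero>\<^bsub>E\<^esub>} \<longrightarrow> N \<inter> i ` carrier S \<noteq> {\<zero>\<^bsub>E\<^esub>})"

definition regular_comodule :: "('k, 'x) ring_scheme \<Rightarrow> ('v, 'e) pre_digraph \<Rightarrow>
    ('k, ('v, 'e) qpath \<Rightarrow> 'k, ('v, 'e) qpath) comodule" where
  "regular_comodule K Q = (let C = path_space K Q in
     \<lparr>carrier = carrier C, mult = mult C, one = one C, zero = zero C, add = add C,
      smult = smult C, coact = comult K Q\<rparr>)"

section \<open>The dual algebra\<close>

text \<open>The product is \<open>(f * g)(c) = \<Sum> f(c\<^sub>1) g(c\<^sub>2)\<close>, using \<open>\<Delta>(c) = \<Sum>\<^sub>q (\<Delta>(c))\<^sub>q \<otimes> q\<close>.\<close>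

definition dual_algebra :: "('k, 'x) ring_scheme \<Rightarrow> ('v, 'e) pre_digraph \<Rightarrow>
    ((('v, 'e) qpath \<Rightarrow> 'k) \<Rightarrow> 'k) ring" where
  "dual_algebra K Q = (let C = path_space K Q in
     \<lparr>carrier = module_hom K C (regular_module K) \<inter> extensional (carrier C),
      mult = (\<lambda>f g. \<lambda>c\<in>carrier C. \<Oplus>\<^bsub>K\<^esub>q\<in>supp C (comult K Q c).
                f (comult K Q c q) \<otimes>\<^bsub>K\<^esub> g (unit_vec K q)),
      one = (\<lambda>c\<in>carrier C. counit K c),
      zero = (\<lambda>c\<in>carrier C. \<zero>\<^bsub>K\<^esub>),
      add = (\<lambda>f g. \<lambda>c\<in>carrier C. f c \<oplus>\<^bsub>K\<^esub> g c)\<rparr>)"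

definition dual_scalar :: "('k, 'x) ring_scheme \<Rightarrow> ('v, 'e) pre_digraph \<Rightarrow>
    'k \<Rightarrow> (('v, 'e) qpath \<Rightarrow> 'k) \<Rightarrow> 'k" where
  "dual_scalar K Q k = (\<lambda>c\<in>carrier (path_space K Q). k \<otimes>\<^bsub>K\<^esub> counit K c)"

definition dual_module :: "('k, 'x) ring_scheme \<Rightarrow> ('k, 'm, ('v, 'e) qpath) comodule \<Rightarrow>
    ((('v, 'e) qpath \<Rightarrow> 'k) \<Rightarrow> 'k, 'm) module" where
  "dual_module K M =
     \<lparr>carrier = carrier M, mult = mult M, one = one M, zero = zero M, add = add M,
      smult = (\<lambda>f m. \<Oplus>\<^bsub>M\<^esub>q\<in>supp M (coact M m). f (unit_vec K q) \<odot>\<^bsub>M\<^esub> coact M m q)\<rparr>"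

definition Ext1_dual :: "('k, 'x) ring_scheme \<Rightarrow> ('v, 'e) pre_digraph \<Rightarrow>
    ('k, 'm, ('v, 'e) qpath) comodule \<Rightarrow> ('k, 'n, ('v, 'e) qpath) comodule \<Rightarrow>
    ('k, ((('m \<Rightarrow> ((('v, 'e) qpath \<Rightarrow> 'k) \<Rightarrow> 'k)) \<Rightarrow> ((('v, 'e) qpath \<Rightarrow> 'k) \<Rightarrow> 'k)) \<Rightarrow> 'n) set)
      module" where
  "Ext1_dual K Q M N =
     Ext1 (dual_scalar K Q) (dual_algebra K Q) (dual_module K M) (dual_module K N)"

section \<open>The quiver with infinitely many arrows from \<open>a\<close> to \<open>b\<close>\<close>

datatype two_vertices = vertex_a | vertex_b

definition quiver_ab :: "(two_vertices, nat) pre_digraph" where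
  "quiver_ab = \<lparr>verts = {vertex_a, vertex_b}, arcs = {n. n \<ge> 1},
     tail = (\<lambda>_. vertex_a), head = (\<lambda>_. vertex_b)\<rparr>"

definition elem_a :: "('k, 'x) ring_scheme \<Rightarrow> (two_vertices, nat) qpath \<Rightarrow> 'k" where
  "elem_a K = unit_vec K (vertex_a, [], vertex_a)"

definition elem_b :: "('k, 'x) ring_scheme \<Rightarrow> (two_vertices, nat) qpath \<Rightarrow> 'k" where
  "elem_b K = unit_vec K (vertex_b, [], vertex_b)"

definition elem_x :: "('k, 'x) ring_scheme \<Rightarrow> nat \<Rightarrow> (two_vertices, nat) qpath \<Rightarrow> 'k" where
  "elem_x K n = unit_vec K (vertex_a, [n], vertex_b)"

definition span_comodule :: "('k, 'x) ring_scheme \<Rightarrow>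
    ((two_vertices, nat) qpath \<Rightarrow> 'k) set \<Rightarrow>
    ('k, (two_vertices, nat) qpath \<Rightarrow> 'k, (two_vertices, nat) qpath) comodule" where
  "span_comodule K A = (regular_comodule K quiver_ab)
     \<lparr>carrier := LinearCombinations.module.span K (path_space K quiver_ab) A\<rparr>"

definition comod_S :: "('k, 'x) ring_scheme \<Rightarrow>
    ('k, (two_vertices, nat) qpath \<Rightarrow> 'k, (two_vertices, nat) qpath) comodule" where
  "comod_S K = span_comodule K {elem_a K}"

definition comod_T :: "('k, 'x) ring_scheme \<Rightarrow>
    ('k, (two_vertices, nat) qpath \<Rightarrow> 'k, (two_vertices, nat) qpath) comodule" where
  "comod_T K = span_comodule K {elem_b K}"

definition comod_E :: "('k, 'x) ring_scheme \<Rightarrow>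
    ('k, (two_vertices, nat) qpath \<Rightarrow> 'k, (two_vertices, nat) qpath) comodule" where
  "comod_E K = span_comodule K ({elem_a K} \<union> {elem_x K n | n. n \<ge> 1})"

end

theory Submission
  imports Defs
begin

text \<open>
  A left module over \<open>C\<^sup>*\<close> is a pair of vector spaces \<open>M\<^sub>a\<close>, \<open>M\<^sub>b\<close> with a linear map
  \<open>V \<otimes> M\<^sub>b \<rightarrow> M\<^sub>a\<close>, where \<open>V\<close>, the space of functionals supported on the arrows, consists of all
  sequences \<open>v\<close> in \<open>K\<close>. Hence an extension of \<open>T\<close> by \<open>S\<close> is an arbitrary linear functional on \<open>V\<close>,
  and for extensions by \<open>E\<close> two functionals are identified when they differ by
  \<open>v \<mapsto> \<Sum>\<^sub>n c\<^sub>n v\<^sub>n\<close> with \<open>c\<close> finitely supported. Such a difference is determined by its values on the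
  unit sequences, so functionals that vanish on all unit sequences give distinct classes in both
  cases.

  The unit sequences together with the geometric sequences \<open>(t\<^sup>n)\<^sub>n\<close>, \<open>t \<noteq> 0\<close>, are linearly
  independent; a basis of \<open>V\<close> that extends them has \<open>|V|\<close> elements that are not unit sequences,
  which yields \<open>|K|\<close> to the power \<open>|V|\<close> classes. Conversely, a cocycle is determined by its values
  on the basis of \<open>F\<^sub>1\<close>, which has at most \<open>|V|\<close> elements. Since an infinite vector space with more
  elements than \<open>K\<close> has as many elements as a basis, this count is the dimension.

  \<open>E\<close> is injective because a comodule map \<open>N \<rightarrow> E\<close> has the form \<open>n \<mapsto> \<Sum>\<^sub>q L(n\<^sub>q) q\<close> for a linear
  functional \<open>L\<close> on \<open>N\<close>, with \<open>q\<close> ranging over the paths that start at \<open>a\<close>, and functionals extend.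
\<close>

section \<open>Cardinalities\<close>

text \<open>Behind the canonical resolution stands 0 -> V -> C^* e_b -> T -> 0: C^* is the algebra
  of triangular matrices with diagonal f(a), f(b) and the sequence of the f(x_n) in the corner, e_b
  is the idempotent at b, and C^* e_b consists of the functionals that vanish at a. The bridge
  between the two is a map from the kernel \<open>Z0\<close> of F_0 -> T to V. As C^* acts through
  f(a) alone both on V and on the line of a, every K-linear functional on V gives a class, with no
  finiteness condition. Elements of E have only finitely many arrow coefficients, so E cannot absorb
  these classes although it is injective as a comodule. The count needs dim V = |K|^aleph_0. When
  K^N has no more elements than K, as for the complex numbers, the number of elements of V says
  nothing about a basis; the geometric sequences then supply |K| independent vectors. For Ext itself
  the strict inequality of Cantor, |K| \<le> |K^N| < |K^(K^N)|, makes cardinality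
  sufficient.\<close>

lemma card_of_Func_cong_le:
  assumes "|A| \<le>o |A'|" and "|B| \<le>o |B'|" and "A \<noteq> {}"
  shows "|Func A B| \<le>o |Func A' B'|"
proof -
  \<comment> \<open>Exponentiation is monotone in the exponent only away from exponent zero:
    \<open>Func {} B\<close> is a singleton, whereas \<open>Func A' {}\<close> is empty for nonempty
    \<open>A'\<close>.\<close>
  have "|B| ^c |A| \<le>o |B'| ^c |A'|"
    using assms by (intro cexp_mono) (auto simp: card_of_ordIso_czero_iff_empty card_of_Card_order)
  then show ?thesis by (simp add: cexp_def Field_card_of)
qed

lemma card_of_finite_le:
  assumes "finite X" and "infinite A"
  shows "|X| \<le>o |A|"
  using assms card_of_ordLeq_finite ordLeq_total[OF card_of_Well_order card_of_Well_order] by blast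

lemma card_of_Un_le:
  assumes "|X| \<le>o |A|" and "|Y| \<le>o |A|" and "infinite A"
  shows "|X \<union> Y| \<le>o |A|"
  by (rule card_of_Un_ordLeq_infinite_Field[OF _ assms(1,2)])
    (use assms(3) in \<open>simp_all add: Field_card_of card_of_card_order_on\<close>)

lemma card_of_Func_ordIso:
  assumes "|A| =o |A'|"
  shows "|Func A B| =o |Func A' B|"
proof -
  have "|B| ^c |A| =o |B| ^c |A'|"
    by (rule cexp_cong2) (auto simp: assms card_of_Card_order)
  then show ?thesis by (simp add: cexp_def Field_card_of)
qed

lemma card_of_length_lists_infinite:
  assumes "infinite A"
  shows "|{xs \<in> lists A. length xs = n}| \<le>o |A|"
proof (induction n)
  case 0
  have "{xs \<in> lists A. length xs = 0} = {[]}" by auto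
  then show ?case using assms card_of_singl_ordLeq[of A "[]"] by auto
next
  case (Suc n)
  have "{xs \<in> lists A. length xs = Suc n} \<subseteq>
      (\<lambda>(x, xs). x # xs) ` (A \<times> {xs \<in> lists A. length xs = n})"
    by (auto simp: length_Suc_conv image_iff)
  then have "|{xs \<in> lists A. length xs = Suc n}| \<le>o |A \<times> {xs \<in> lists A. length xs = n}|"
    by (rule ordLeq_transitive[OF card_of_mono1 card_of_image])
  also have "|A \<times> {xs \<in> lists A. length xs = n}| \<le>o |A \<times> A|"
    using Suc.IH by (rule card_of_Times_mono2)
  also have "|A \<times> A| \<le>o |A|"
    by (rule ordIso_imp_ordLeq[OF card_of_Times_same_infinite[OF assms]])
  finally show ?case .
qed

text \<open>Every finite subset is the set of some list, and the lists split by length into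
  countably many pieces of size at most |A|.\<close>

lemma card_of_Fpow_infinite_le:
  assumes "infinite A"
  shows "|Fpow A| \<le>o |A|"
proof -
  have "Fpow A \<subseteq> set ` lists A"
  proof
    fix X assume "X \<in> Fpow A"
    then obtain xs where "set xs = X" "X \<subseteq> A" unfolding Fpow_def by (auto dest: finite_list)
    then show "X \<in> set ` lists A" by (auto simp: lists_eq_set)
  qed
  then have "|Fpow A| \<le>o |lists A|"
    by (rule ordLeq_transitive[OF card_of_mono1 card_of_image])
  also have "lists A = (\<Union>n. {xs \<in> lists A. length xs = n})" by auto
  also have "|\<Union>n. {xs \<in> lists A. length xs = n}| \<le>o |A|"
    using assms card_of_length_lists_infinite[OF assms] infinite_iff_card_of_nat[of A]
    by (intro card_of_UNION_ordLeq_infinite) blast+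
  finally show ?thesis .
qed

section \<open>Left modules over arbitrary rings\<close>

locale left_module = R?: ring R + M?: abelian_group M
  for R :: "('r, 'x) ring_scheme" (structure) and M :: "('r, 'm, 'y) module_scheme" (structure) +
  assumes smult_closed [simp, intro]:
      "\<lbrakk>r \<in> carrier R; x \<in> carrier M\<rbrakk> \<Longrightarrow> r \<odot>\<^bsub>M\<^esub> x \<in> carrier M"
    and smult_l_distr:
      "\<lbrakk>r \<in> carrier R; s \<in> carrier R; x \<in> carrier M\<rbrakk> \<Longrightarrow>
        (r \<oplus>\<^bsub>R\<^esub> s) \<odot>\<^bsub>M\<^esub> x = r \<odot>\<^bsub>M\<^esub> x \<oplus>\<^bsub>M\<^esub> s \<odot>\<^bsub>M\<^esub> x"
    and smult_r_distr:
      "\<lbrakk>r \<in> carrier R; x \<in> carrier M; y \<in> carrier M\<rbrakk> \<Longrightarrow>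
        r \<odot>\<^bsub>M\<^esub> (x \<oplus>\<^bsub>M\<^esub> y) = r \<odot>\<^bsub>M\<^esub> x \<oplus>\<^bsub>M\<^esub> r \<odot>\<^bsub>M\<^esub> y"
    and smult_assoc:
      "\<lbrakk>r \<in> carrier R; s \<in> carrier R; x \<in> carrier M\<rbrakk> \<Longrightarrow>
        (r \<otimes>\<^bsub>R\<^esub> s) \<odot>\<^bsub>M\<^esub> x = r \<odot>\<^bsub>M\<^esub> (s \<odot>\<^bsub>M\<^esub> x)"
    and smult_one [simp]: "x \<in> carrier M \<Longrightarrow> \<one>\<^bsub>R\<^esub> \<odot>\<^bsub>M\<^esub> x = x"
begin

lemma smult_l_null [simp]: "x \<in> carrier M \<Longrightarrow> \<zero>\<^bsub>R\<^esub> \<odot>\<^bsub>M\<^esub> x = \<zero>\<^bsub>M\<^esub>"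
  by (metis M.add.r_cancel_one R.l_zero R.zero_closed smult_closed smult_l_distr)

lemma smult_r_null [simp]: "r \<in> carrier R \<Longrightarrow> r \<odot>\<^bsub>M\<^esub> \<zero>\<^bsub>M\<^esub> = \<zero>\<^bsub>M\<^esub>"
  by (metis M.add.r_cancel_one M.l_zero M.zero_closed smult_closed smult_r_distr)

lemma finsum_smult_distrib:
  assumes "r \<in> carrier R" and "f \<in> A \<rightarrow> carrier M"
  shows "r \<odot>\<^bsub>M\<^esub> (\<Oplus>\<^bsub>M\<^esub>i\<in>A. f i) = (\<Oplus>\<^bsub>M\<^esub>i\<in>A. r \<odot>\<^bsub>M\<^esub> f i)"
  using assms(2)
proof (induction A rule: infinite_finite_induct)
  case (insert i A)
  then have "f i \<in> carrier M" "f \<in> A \<rightarrow> carrier M" by auto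
  with insert assms(1) show ?case
    by (subst (1 2) M.finsum_insert) (auto simp: smult_r_distr)
qed (use assms(1) in auto)

end

lemma (in vectorspace) is_left_module: "left_module K V"
  by unfold_locales (auto simp: smult_l_distr smult_r_distr smult_assoc1)

lemma left_module_regular: 
  assumes "ring R"
  shows "left_module R (regular_module R)"
proof -
  interpret ring R by fact
  have "abelian_group (regular_module R)"
    by (rule abelian_groupI)
      (auto simp: regular_module_def a_ac intro: bexI[OF _ a_inv_closed] l_neg)
  then show ?thesis
    by (intro left_module.intro left_module_axioms.intro assms)
      (auto simp: regular_module_def l_distr r_distr m_assoc)
qed

text \<open>The index \<open>i\<close> may lie outside \<open>A\<close>, provided its term vanishes;
  this suits sums over a support, where the relevant index need not belong to the support.\<close>

lemma finsum_single:
  assumes "abelian_monoid M" and "finite A" and "f i \<in> carrier M"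
    and "\<And>j. j \<in> A \<Longrightarrow> j \<noteq> i \<Longrightarrow> f j = \<zero>\<^bsub>M\<^esub>" and "i \<notin> A \<Longrightarrow> f i = \<zero>\<^bsub>M\<^esub>"
  shows "(\<Oplus>\<^bsub>M\<^esub>j\<in>A. f j) = f i"
proof -
  interpret abelian_monoid M by fact
  show ?thesis
  proof (cases "i \<in> A")
    case True
    have "(\<Oplus>\<^bsub>M\<^esub>j\<in>A. f j) = (\<Oplus>\<^bsub>M\<^esub>j\<in>A. if i = j then f j else \<zero>\<^bsub>M\<^esub>)"
      using assms by (intro finsum_cong') auto
    also have "\<dots> = f i"
      using True assms(2-4) by (intro finsum_singleton) (auto simp: Pi_def, metis assms(4) zero_closed)
    finally show ?thesis .
  next
    case False
    then have "(\<Oplus>\<^bsub>M\<^esub>j\<in>A. f j) = (\<Oplus>\<^bsub>M\<^esub>j\<in>A. \<zero>\<^bsub>M\<^esub>)"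
      using assms by (intro finsum_cong') auto
    with False assms show ?thesis by simp
  qed
qed

lemma finsum_mono_neutral:
  assumes "abelian_monoid M" and "finite B" and "A \<subseteq> B" and "f \<in> B \<rightarrow> carrier M"
    and "\<And>j. j \<in> B - A \<Longrightarrow> f j = \<zero>\<^bsub>M\<^esub>"
  shows "(\<Oplus>\<^bsub>M\<^esub>j\<in>A. f j) = (\<Oplus>\<^bsub>M\<^esub>j\<in>B. f j)"
proof -
  interpret abelian_monoid M by fact
  show ?thesis using assms by (intro add.finprod_mono_neutral_cong_left) auto
qed

lemma finsum_hom:
  assumes "abelian_monoid M" and "abelian_monoid N" and "f \<in> A \<rightarrow> carrier M"
    and "\<And>x. x \<in> carrier M \<Longrightarrow> h x \<in> carrier N"
    and "\<And>x y. \<lbrakk>x \<in> carrier M; y \<in> carrier M\<rbrakk> \<Longrightarrow> h (x \<oplus>\<^bsub>M\<^esub> y) = h x \<oplus>\<^bsub>N\<^esub> h y"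
    and "h \<zero>\<^bsub>M\<^esub> = \<zero>\<^bsub>N\<^esub>"
  shows "h (\<Oplus>\<^bsub>M\<^esub>i\<in>A. f i) = (\<Oplus>\<^bsub>N\<^esub>i\<in>A. h (f i))"
proof -
  interpret M: abelian_monoid M by fact
  interpret N: abelian_monoid N by fact
  show ?thesis using assms(3)
  proof (induction A rule: infinite_finite_induct)
    case (insert i A)
    then have "f i \<in> carrier M" "f \<in> A \<rightarrow> carrier M" by auto
    with insert assms show ?case
      by (subst M.finsum_insert N.finsum_insert) (auto simp: N.finsum_insert Pi_def)
  qed (use assms in auto)
qed

subsection \<open>Homomorphisms\<close>

lemma module_hom_mem:
  "h \<in> module_hom R M N \<Longrightarrow> x \<in> carrier M \<Longrightarrow> h x \<in> carrier N"
  by (auto simp: LinearCombinations.module_hom_def)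

lemma module_hom_comp:
  assumes "f \<in> module_hom R L M" and "g \<in> module_hom R M N"
  shows "(\<lambda>x. g (f x)) \<in> module_hom R L N"
  using assms by (auto simp: LinearCombinations.module_hom_def Pi_def)

lemma module_hom_zero:
  assumes "abelian_group M" and "abelian_group N" and "h \<in> module_hom R M N"
  shows "h \<zero>\<^bsub>M\<^esub> = \<zero>\<^bsub>N\<^esub>"
proof -
  interpret M: abelian_group M by fact
  interpret N: abelian_group N by fact
  have "h (\<zero>\<^bsub>M\<^esub> \<oplus>\<^bsub>M\<^esub> \<zero>\<^bsub>M\<^esub>) = h \<zero>\<^bsub>M\<^esub> \<oplus>\<^bsub>N\<^esub> h \<zero>\<^bsub>M\<^esub>" "h \<zero>\<^bsub>M\<^esub> \<in> carrier N"
    using assms(3) by (auto simp: LinearCombinations.module_hom_def simp del: M.l_zero M.r_zero)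
  then show ?thesis by (metis M.l_zero M.zero_closed N.add.r_cancel_one)
qed

lemma module_hom_finsum:
  assumes "abelian_group M" and "abelian_group N" and "h \<in> module_hom R M N"
    and "f \<in> A \<rightarrow> carrier M"
  shows "h (\<Oplus>\<^bsub>M\<^esub>i\<in>A. f i) = (\<Oplus>\<^bsub>N\<^esub>i\<in>A. h (f i))"
  using assms
  by (intro finsum_hom module_hom_zero[OF assms(1,2,3)] abelian_group.axioms(1))
    (auto simp: LinearCombinations.module_hom_def)

subsection \<open>Direct sums and free modules\<close>

lemma copower_simps [simp]:
  "\<zero>\<^bsub>copower M P\<^esub> = (\<lambda>_. \<zero>\<^bsub>M\<^esub>)"
  "f \<oplus>\<^bsub>copower M P\<^esub> g = (\<lambda>p. f p \<oplus>\<^bsub>M\<^esub> g p)"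
  "r \<odot>\<^bsub>copower M P\<^esub> f = (\<lambda>p. r \<odot>\<^bsub>M\<^esub> f p)"
  by (simp_all add: copower_def)

lemma copower_carrier:
  "f \<in> carrier (copower M P) \<longleftrightarrow>
    (\<forall>p\<in>P. f p \<in> carrier M) \<and> (\<forall>p. p \<notin> P \<longrightarrow> f p = \<zero>\<^bsub>M\<^esub>) \<and> finite (supp M f)"
  by (simp add: copower_def)

context left_module
begin

lemma copower_mem [simp]: "f \<in> carrier (copower M P) \<Longrightarrow> f p \<in> carrier M"
  by (cases "p \<in> P") (auto simp: copower_carrier)

lemma copower_supp: "f \<in> carrier (copower M P) \<Longrightarrow> finite (supp M f) \<and> supp M f \<subseteq> P"
  by (auto simp: copower_carrier supp_def)

lemma copower_closed:
  assumes "f \<in> carrier (copower M P)" and "g \<in> carrier (copower M P)"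
  shows "(\<lambda>p. f p \<oplus>\<^bsub>M\<^esub> g p) \<in> carrier (copower M P)"
proof -
  have "supp M (\<lambda>p. f p \<oplus>\<^bsub>M\<^esub> g p) \<subseteq> supp M f \<union> supp M g" by (auto simp: supp_def)
  with assms show ?thesis by (auto simp: copower_carrier intro: finite_subset)
qed

lemma copower_map_closed:
  assumes "f \<in> carrier (copower M P)" and "\<And>x. x \<in> carrier M \<Longrightarrow> h x \<in> carrier M"
    and "h \<zero>\<^bsub>M\<^esub> = \<zero>\<^bsub>M\<^esub>"
  shows "(\<lambda>p. h (f p)) \<in> carrier (copower M P)"
proof -
  have "supp M (\<lambda>p. h (f p)) \<subseteq> supp M f" using assms(3) by (auto simp: supp_def)
  with assms show ?thesis by (auto simp: copower_carrier intro: finite_subset)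
qed

lemma left_module_copower: "left_module R (copower M P)"
proof -
  have "abelian_group (copower M P)"
  proof (rule abelian_groupI)
    fix f assume f: "f \<in> carrier (copower M P)"
    then show "\<exists>g\<in>carrier (copower M P). g \<oplus>\<^bsub>copower M P\<^esub> f = \<zero>\<^bsub>copower M P\<^esub>"
      using copower_map_closed[OF f, of "\<lambda>x. \<ominus>\<^bsub>M\<^esub> x"]
      by (intro bexI[of _ "\<lambda>p. \<ominus>\<^bsub>M\<^esub> f p"]) (auto simp: M.l_neg)
  next
    show "\<zero>\<^bsub>copower M P\<^esub> \<in> carrier (copower M P)" by (simp add: copower_carrier supp_def)
  qed (auto simp: copower_closed M.a_ac)
  then show ?thesis
  proof (intro left_module.intro left_module_axioms.intro)
    show "ring R" by (rule R.ring_axioms)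
    fix r f assume "r \<in> carrier R" "f \<in> carrier (copower M P)"
    then show "r \<odot>\<^bsub>copower M P\<^esub> f \<in> carrier (copower M P)"
      using copower_map_closed[of f P "\<lambda>x. r \<odot>\<^bsub>M\<^esub> x"] by simp
  qed (auto simp: smult_l_distr smult_r_distr smult_assoc)
qed

lemma finsum_copower:
  assumes "f \<in> A \<rightarrow> carrier (copower M P)"
  shows "(\<Oplus>\<^bsub>copower M P\<^esub>i\<in>A. f i) p = (\<Oplus>\<^bsub>M\<^esub>i\<in>A. f i p)"
proof -
  interpret C: left_module R "copower M P" by (rule left_module_copower)
  show ?thesis 
    by (rule finsum_hom[where h = "\<lambda>f. f p", OF C.abelian_monoid_axioms M.abelian_monoid_axioms assms])
      auto
qed

end

lemma regular_module_simps [simp]: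
  "carrier (regular_module R) = carrier R"
  "\<zero>\<^bsub>regular_module R\<^esub> = \<zero>\<^bsub>R\<^esub>"
  "x \<oplus>\<^bsub>regular_module R\<^esub> y = x \<oplus>\<^bsub>R\<^esub> y"
  "x \<odot>\<^bsub>regular_module R\<^esub> y = x \<otimes>\<^bsub>R\<^esub> y"
  by (simp_all add: regular_module_def)

lemma supp_regular_module [simp]: "supp (regular_module R) f = supp R f"
  by (simp add: supp_def)

lemma finsum_regular_module [simp]: "finsum (regular_module R) f A = finsum R f A"
  by (simp add: finsum_def finprod_def regular_module_def)

lemma free_module_simps [simp]:
  "\<zero>\<^bsub>free_module R P\<^esub> = (\<lambda>_. \<zero>\<^bsub>R\<^esub>)"
  "f \<oplus>\<^bsub>free_module R P\<^esub> g = (\<lambda>p. f p \<oplus>\<^bsub>R\<^esub> g p)"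
  "r \<odot>\<^bsub>free_module R P\<^esub> f = (\<lambda>p. r \<otimes>\<^bsub>R\<^esub> f p)"
  by (simp_all add: free_module_def)

lemma free_module_carrier:
  "f \<in> carrier (free_module R P) \<longleftrightarrow>
    (\<forall>p\<in>P. f p \<in> carrier R) \<and> (\<forall>p. p \<notin> P \<longrightarrow> f p = \<zero>\<^bsub>R\<^esub>) \<and> finite (supp R f)"
  by (simp add: free_module_def copower_carrier)

lemma supp_unit_vec_subset: "supp R (unit_vec R p) \<subseteq> {p}"
  by (auto simp: supp_def unit_vec_def)

lemma (in ring) left_module_free: "left_module R (free_module R P)"
  unfolding free_module_def
  by (intro left_module.left_module_copower left_module_regular ring_axioms)

lemma (in ring) free_module_mem [simp]: "f \<in> carrier (free_module R P) \<Longrightarrow> f p \<in> carrier R"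
  by (cases "p \<in> P") (auto simp: free_module_carrier)

lemma (in ring) free_module_supp:
  "f \<in> carrier (free_module R P) \<Longrightarrow> finite (supp R f)"
  "f \<in> carrier (free_module R P) \<Longrightarrow> supp R f \<subseteq> P"
  by (auto simp: free_module_carrier supp_def)

lemma (in ring) finsum_free_module:
  assumes "f \<in> A \<rightarrow> carrier (free_module R P)"
  shows "(\<Oplus>\<^bsub>free_module R P\<^esub>i\<in>A. f i) p = (\<Oplus>i\<in>A. f i p)"
  using left_module.finsum_copower[OF left_module_regular[OF ring_axioms]] assms
  unfolding free_module_def by simp

lemma (in ring) unit_vec_free: "p \<in> P \<Longrightarrow> unit_vec R p \<in> carrier (free_module R P)"
  using finite_subset[OF supp_unit_vec_subset[where R = R and p = p]]
  by (auto simp: free_module_carrier unit_vec_def[abs_def])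

lemma (in ring) free_module_expand:
  assumes "f \<in> carrier (free_module R P)"
  shows "f = (\<Oplus>\<^bsub>free_module R P\<^esub>p\<in>supp R f. f p \<odot>\<^bsub>free_module R P\<^esub> unit_vec R p)"
proof
  interpret F: left_module R "free_module R P" by (rule left_module_free)
  fix q
  have mem: "(\<lambda>p. f p \<odot>\<^bsub>free_module R P\<^esub> unit_vec R p) \<in> supp R f \<rightarrow> carrier (free_module R P)"
    using free_module_supp(2)[OF assms] free_module_mem[OF assms]
    by (auto simp del: free_module_simps intro!: F.smult_closed unit_vec_free)
  have "(\<Oplus>p\<in>supp R f. f p \<otimes> unit_vec R p q) = f q \<otimes> unit_vec R q q"
    using assms free_module_supp
    by (intro finsum_single[OF abelian_monoid_axioms]) (auto simp: unit_vec_def supp_def)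
  then show "f q = (\<Oplus>\<^bsub>free_module R P\<^esub>p\<in>supp R f. f p \<odot>\<^bsub>free_module R P\<^esub> unit_vec R p) q"
    using assms by (subst finsum_free_module[OF mem]) (simp add: unit_vec_def)
qed

section \<open>Universal property of free modules and free covers\<close>

definition free_lift :: "('r, 'x) ring_scheme \<Rightarrow> ('r, 'm, 'y) module_scheme \<Rightarrow> ('p \<Rightarrow> 'm) \<Rightarrow>
    ('p \<Rightarrow> 'r) \<Rightarrow> 'm" where
  "free_lift R A \<phi> f = (\<Oplus>\<^bsub>A\<^esub>p\<in>supp R f. f p \<odot>\<^bsub>A\<^esub> \<phi> p)"

context left_module
begin

text \<open>The supports of two elements and of their sum differ, so additivity is proved after
  moving all sums to one common finite index set \<open>D\<close>.\<close>

lemma free_lift_eq: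
  assumes "f \<in> carrier (free_module R P)" and "\<phi> \<in> P \<rightarrow> carrier M"
    and "finite D" and "supp R f \<subseteq> D" and "D \<subseteq> P"
  shows "free_lift R M \<phi> f = (\<Oplus>\<^bsub>M\<^esub>p\<in>D. f p \<odot>\<^bsub>M\<^esub> \<phi> p)"
  unfolding free_lift_def using assms
  by (intro finsum_mono_neutral[OF M.abelian_monoid_axioms]) (auto simp: supp_def Pi_def subset_iff)

lemma free_lift_hom:
  assumes \<phi>: "\<phi> \<in> P \<rightarrow> carrier M"
  shows "free_lift R M \<phi> \<in> module_hom R (free_module R P) M"
proof -
  let ?F = "free_module R P"
  interpret F: left_module R ?F by (rule left_module_free)
  have mem: "(\<lambda>p. f p \<odot>\<^bsub>M\<^esub> \<phi> p) \<in> D \<rightarrow> carrier M"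
    if "f \<in> carrier ?F" "D \<subseteq> P" for f D
    using that \<phi> by (auto simp: Pi_def subset_iff)
  have closed: "free_lift R M \<phi> f \<in> carrier M" if "f \<in> carrier ?F" for f
    unfolding free_lift_def using mem[OF that] free_module_supp[OF that] by (intro M.finsum_closed)
  have add: "free_lift R M \<phi> (f \<oplus>\<^bsub>?F\<^esub> g) = free_lift R M \<phi> f \<oplus>\<^bsub>M\<^esub> free_lift R M \<phi> g"
    if f: "f \<in> carrier ?F" and g: "g \<in> carrier ?F" for f g
  proof -
    let ?D = "supp R f \<union> supp R g"
    have D: "finite ?D" "?D \<subseteq> P" using free_module_supp(1,2)[OF f] free_module_supp(1,2)[OF g] by auto
    have "free_lift R M \<phi> (f \<oplus>\<^bsub>?F\<^esub> g) = (\<Oplus>\<^bsub>M\<^esub>p\<in>?D. (f \<oplus>\<^bsub>?F\<^esub> g) p \<odot>\<^bsub>M\<^esub> \<phi> p)"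
      using D f g \<phi> F.a_closed[OF f g] by (intro free_lift_eq) (auto simp: supp_def)
    also have "\<dots> = (\<Oplus>\<^bsub>M\<^esub>p\<in>?D. f p \<odot>\<^bsub>M\<^esub> \<phi> p \<oplus>\<^bsub>M\<^esub> g p \<odot>\<^bsub>M\<^esub> \<phi> p)"
      using D f g \<phi> mem[OF f, of ?D] mem[OF g, of ?D]
      by (intro M.finsum_cong') (auto simp: smult_l_distr Pi_def subset_iff)
    also have "\<dots> = (\<Oplus>\<^bsub>M\<^esub>p\<in>?D. f p \<odot>\<^bsub>M\<^esub> \<phi> p) \<oplus>\<^bsub>M\<^esub> (\<Oplus>\<^bsub>M\<^esub>p\<in>?D. g p \<odot>\<^bsub>M\<^esub> \<phi> p)"
      using mem[OF f, of ?D] mem[OF g, of ?D] D by (intro M.finsum_addf) auto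
    also have "\<dots> = free_lift R M \<phi> f \<oplus>\<^bsub>M\<^esub> free_lift R M \<phi> g"
      using free_lift_eq[OF f \<phi> D(1) _ D(2)] free_lift_eq[OF g \<phi> D(1) _ D(2)] by simp
    finally show ?thesis .
  qed
  have smult: "free_lift R M \<phi> (r \<odot>\<^bsub>?F\<^esub> f) = r \<odot>\<^bsub>M\<^esub> free_lift R M \<phi> f"
    if r: "r \<in> carrier R" and f: "f \<in> carrier ?F" for r f
  proof -
    let ?D = "supp R f"
    have D: "finite ?D" "?D \<subseteq> P" by (simp_all add: free_module_supp[OF f])
    have "free_lift R M \<phi> (r \<odot>\<^bsub>?F\<^esub> f) = (\<Oplus>\<^bsub>M\<^esub>p\<in>?D. (r \<odot>\<^bsub>?F\<^esub> f) p \<odot>\<^bsub>M\<^esub> \<phi> p)"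
      using D r f \<phi> F.smult_closed[OF r f] by (intro free_lift_eq) (auto simp: supp_def)
    also have "\<dots> = (\<Oplus>\<^bsub>M\<^esub>p\<in>?D. r \<odot>\<^bsub>M\<^esub> (f p \<odot>\<^bsub>M\<^esub> \<phi> p))"
      using D f r \<phi> by (intro M.finsum_cong') (auto simp: smult_assoc Pi_def subset_iff)
    also have "\<dots> = r \<odot>\<^bsub>M\<^esub> free_lift R M \<phi> f"
      unfolding free_lift_def using finsum_smult_distrib[OF r mem[OF f D(2)]] by simp
    finally show ?thesis .
  qed
  show ?thesis using closed add smult by (auto simp: LinearCombinations.module_hom_def simp del: free_module_simps)
qed

lemma free_lift_unit_vec:
  assumes "\<phi> p \<in> carrier M"
  shows "free_lift R M \<phi> (unit_vec R p) = \<phi> p"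
proof -
  have "free_lift R M \<phi> (unit_vec R p) = unit_vec R p p \<odot>\<^bsub>M\<^esub> \<phi> p"
    unfolding free_lift_def
    using assms finite_subset[OF supp_unit_vec_subset[where R = R and p = p]] supp_unit_vec_subset[where R = R and p = p]
    by (intro finsum_single[OF M.abelian_monoid_axioms])
      (auto simp: supp_def unit_vec_def)
  with assms show ?thesis by (simp add: unit_vec_def)
qed

text \<open>The uniqueness half of the universal property. Most identities between homomorphisms
  below are reduced by it to unit vectors.\<close>

lemma free_hom_eqI:
  assumes "g \<in> module_hom R (free_module R P) M" and "h \<in> module_hom R (free_module R P) M"
    and "\<And>p. p \<in> P \<Longrightarrow> g (unit_vec R p) = h (unit_vec R p)"
    and f: "f \<in> carrier (free_module R P)"
  shows "g f = h f"
proof -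
  let ?F = "free_module R P"
  interpret F: left_module R ?F by (rule left_module_free)
  have supp: "\<And>p. p \<in> supp R f \<Longrightarrow> p \<in> P" using free_module_supp[OF f] by auto
  have mem: "(\<lambda>p. f p \<odot>\<^bsub>?F\<^esub> unit_vec R p) \<in> supp R f \<rightarrow> carrier ?F"
    using supp free_module_mem[OF f]
    by (auto simp del: free_module_simps intro!: F.smult_closed unit_vec_free)
  have *: "k f = (\<Oplus>\<^bsub>M\<^esub>p\<in>supp R f. f p \<odot>\<^bsub>M\<^esub> k (unit_vec R p))"
    if k: "k \<in> module_hom R ?F M" for k
  proof -
    have "k f = (\<Oplus>\<^bsub>M\<^esub>p\<in>supp R f. k (f p \<odot>\<^bsub>?F\<^esub> unit_vec R p))"
      by (subst free_module_expand[OF f])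
        (rule module_hom_finsum[OF F.abelian_group_axioms M.abelian_group_axioms k mem])
    also have "\<dots> = (\<Oplus>\<^bsub>M\<^esub>p\<in>supp R f. f p \<odot>\<^bsub>M\<^esub> k (unit_vec R p))"
      using supp free_module_mem[OF f] k
      by (intro M.finsum_cong')
        (auto simp del: free_module_simps simp: LinearCombinations.module_hom_smult[OF k] unit_vec_free
          intro!: smult_closed module_hom_mem[OF k])
    finally show ?thesis .
  qed
  have "h (unit_vec R p) \<in> carrier M" if "p \<in> P" for p
    using that by (intro module_hom_mem[OF assms(2)] unit_vec_free)
  then show ?thesis unfolding *[OF assms(1)] *[OF assms(2)]
    using supp free_module_mem[OF f] assms(3) by (intro M.finsum_cong') (auto intro!: smult_closed)
qed

lemma free_cover_eq:
  "free_cover R M X = restrict (free_lift R M (\<lambda>x. x)) (carrier (free_module R X))"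
  by (auto simp: free_cover_def free_lift_def intro!: restrict_ext)

lemma free_cover_hom:
  assumes "X \<subseteq> carrier M"
  shows "free_cover R M X \<in> module_hom R (free_module R X) M"
proof -
  interpret F: left_module R "free_module R X" by (rule left_module_free)
  have "free_lift R M (\<lambda>x. x) \<in> module_hom R (free_module R X) M"
    using assms by (intro free_lift_hom) auto
  then show ?thesis unfolding free_cover_eq
    by (auto simp: LinearCombinations.module_hom_def simp del: free_module_simps)
qed

lemma free_cover_unit_vec:
  assumes "X \<subseteq> carrier M" and "x \<in> X"
  shows "free_cover R M X (unit_vec R x) = x"
  using assms free_lift_unit_vec[of "\<lambda>x. x"] by (auto simp: free_cover_eq unit_vec_free)

text \<open>The composite of the cover with \<open>h\<close> vanishes on unit vectors, hence
  everywhere. This gives d d = 0 in the canonical resolution.\<close>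

lemma free_cover_kernel:
  assumes N: "left_module R N" and h: "h \<in> module_hom R M N"
    and f: "f \<in> carrier (free_module R (a_kernel M N h))"
  shows "free_cover R M (a_kernel M N h) f \<in> a_kernel M N h"
proof -
  interpret N: left_module R N by fact
  let ?Z = "a_kernel M N h"
  have Z: "h z = \<zero>\<^bsub>N\<^esub>" if "z \<in> ?Z" for z
    using that by (auto simp: a_kernel_def kernel_def)
  have sub: "?Z \<subseteq> carrier M" by (auto simp: a_kernel_def kernel_def)
  note c = free_cover_hom[OF sub]
  have "h (free_cover R M ?Z f) = \<zero>\<^bsub>N\<^esub>"
  proof (rule left_module.free_hom_eqI[OF N module_hom_comp[OF c h] _ _ f])
    show "(\<lambda>_. \<zero>\<^bsub>N\<^esub>) \<in> module_hom R (free_module R ?Z) N" by (auto simp: LinearCombinations.module_hom_def)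
  qed (simp add: free_cover_unit_vec[OF sub] Z)
  then show ?thesis using module_hom_mem[OF c f] by (auto simp: a_kernel_def kernel_def)
qed

end

section \<open>Bases of infinite-dimensional vector spaces\<close>

lemma module_hom_diff:
  assumes "abelian_group M" and "abelian_group N" and h: "h \<in> module_hom R M N"
    and "x \<in> carrier M" and "y \<in> carrier M"
  shows "h (x \<ominus>\<^bsub>M\<^esub> y) = h x \<ominus>\<^bsub>N\<^esub> h y"
proof -
  interpret M: abelian_group M by fact
  interpret N: abelian_group N by fact
  have "h (x \<ominus>\<^bsub>M\<^esub> y) \<oplus>\<^bsub>N\<^esub> h y = h ((x \<ominus>\<^bsub>M\<^esub> y) \<oplus>\<^bsub>M\<^esub> y)"
    using assms by (intro LinearCombinations.module_hom_add[OF h, symmetric]) auto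
  also have "(x \<ominus>\<^bsub>M\<^esub> y) \<oplus>\<^bsub>M\<^esub> y = x"
    using assms by (simp add: a_minus_def M.a_assoc M.l_neg)
  finally show ?thesis
    using assms module_hom_mem[OF h]
    by (metis M.minus_closed N.add.inv_solve_right a_minus_def)
qed

lemma module_hom_inv_into:
  assumes h: "h \<in> module_hom R M N" and bij: "bij_betw h (carrier M) (carrier N)"
    and "left_module R M"
  shows "inv_into (carrier M) h \<in> module_hom R N M"
proof -
  interpret M: left_module R M by fact
  let ?k = "inv_into (carrier M) h"
  have k: "?k y \<in> carrier M" "h (?k y) = y" if "y \<in> carrier N" for y
    using inv_into_into[of y h "carrier M"] f_inv_into_f[of y h "carrier M"]
      bij_betw_imp_surj_on[OF bij] that by simp_all
  have kh: "?k (h x) = x" if "x \<in> carrier M" for x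
    using bij_betw_imp_inj_on[OF bij] that by (rule inv_into_f_f)
  show ?thesis unfolding LinearCombinations.module_hom_def
  proof (safe)
    fix y y' assume "y \<in> carrier N" "y' \<in> carrier N"
    then show "?k (y \<oplus>\<^bsub>N\<^esub> y') = ?k y \<oplus>\<^bsub>M\<^esub> ?k y'"
      using kh[of "?k y \<oplus>\<^bsub>M\<^esub> ?k y'"] k LinearCombinations.module_hom_add[OF h] by simp
  next
    fix r y assume "r \<in> carrier R" "y \<in> carrier N"
    then show "?k (r \<odot>\<^bsub>N\<^esub> y) = r \<odot>\<^bsub>M\<^esub> ?k y"
      using kh[of "r \<odot>\<^bsub>M\<^esub> ?k y"] k LinearCombinations.module_hom_smult[OF h] by simp
  qed (use k in auto)
qed

text \<open>A finitely supported function is encoded by its graph over its support, which is a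
  finite set of pairs.\<close>

lemma card_of_copower_le: "|carrier (copower N P)| \<le>o |Fpow (P \<times> carrier N)|"
proof (rule card_of_ordLeqI)
  let ?g = "\<lambda>f. (\<lambda>p. (p, f p)) ` supp N f"
  show "inj_on ?g (carrier (copower N P))"
  proof (rule inj_onI, rule ext)
    fix f f' p assume "?g f = ?g f'"
    then have "(q, y) \<in> ?g f \<longleftrightarrow> (q, y) \<in> ?g f'" for q y by simp
    then have *: "q \<in> supp N f \<and> y = f q \<longleftrightarrow> q \<in> supp N f' \<and> y = f' q" for q y
      by (auto simp: image_iff)
    show "f p = f' p" using *[of p "f p"] *[of p "f' p"] by (auto simp: supp_def)
  qed
  show "?g f \<in> Fpow (P \<times> carrier N)" if "f \<in> carrier (copower N P)" for f
    using that by (auto simp: copower_carrier Fpow_def supp_def)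
qed

lemma card_of_copower_infinite_le:
  assumes "|P| \<le>o |A|" and "|carrier N| \<le>o |A|" and "infinite A"
  shows "|carrier (copower N P)| \<le>o |A|"
proof (cases "finite (P \<times> carrier N)")
  \<comment> \<open>The bound for finite subsets presupposes an infinite set, so a finite product is
    treated apart.\<close>
  case True
  then have "finite (Fpow (P \<times> carrier N))" by (auto simp: Fpow_def)
  then have "|Fpow (P \<times> carrier N)| \<le>o |A|"
    using assms(3) by (rule card_of_finite_le)
  then show ?thesis by (rule ordLeq_transitive[OF card_of_copower_le])
next
  case False
  have "|P \<times> carrier N| \<le>o |A \<times> A|"
    by (rule ordLeq_transitive[OF card_of_Times_mono1[OF assms(1)] card_of_Times_mono2[OF assms(2)]])
  also have "|A \<times> A| \<le>o |A|"
    by (rule ordIso_imp_ordLeq[OF card_of_Times_same_infinite[OF assms(3)]])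
  finally show ?thesis
    using ordLeq_transitive[OF card_of_copower_le card_of_Fpow_infinite_le[OF False]]
      ordLeq_transitive by blast
qed

context vectorspace
begin

lemma exists_basis_extending:
  assumes "S \<subseteq> carrier V" and "lin_indpt S"
  shows "\<exists>B. basis B \<and> S \<subseteq> B"
proof -
  let ?A = "{B. S \<subseteq> B \<and> B \<subseteq> carrier V \<and> lin_indpt B}"
  have "\<exists>B\<in>?A. \<forall>X\<in>?A. B \<subseteq> X \<longrightarrow> X = B"
  proof (rule subset_Zorn_nonempty)
    fix C assume C: "C \<noteq> {}" "subset.chain ?A C"
    then have mem: "C \<subseteq> ?A" unfolding subset.chain_def by blast
    \<comment> \<open>A linear dependence involves finitely many vectors, so it already lives in a
      single member of the chain.\<close>
    have "lin_indpt (\<Union>C)"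
    proof
      assume "lin_dep (\<Union>C)"
      then obtain A a v where A: "finite A" "A \<subseteq> \<Union>C" "a \<in> A \<rightarrow> carrier K"
        "lincomb a A = \<zero>\<^bsub>V\<^esub>" "v \<in> A" "a v \<noteq> \<zero>\<^bsub>K\<^esub>"
        unfolding lin_dep_def by blast
      obtain X where X: "X \<in> C" "A \<subseteq> X"
        using finite_subset_Union_chain[OF A(1,2) C] .
      then have "lin_dep X" using lin_dep_crit[OF A(1) X(2) A(3,5,6,4)] by blast
      with mem X(1) show False by blast
    qed
    moreover have "S \<subseteq> \<Union>C" "\<Union>C \<subseteq> carrier V" using C(1) mem by blast+
    ultimately show "\<Union>C \<in> ?A" by blast
  next
    show "?A \<noteq> {}" using assms by blast
  qed
  then obtain B where B: "B \<in> ?A" and max: "\<forall>X\<in>?A. B \<subseteq> X \<longrightarrow> X = B"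
    by (elim bexE)
  from B have SB: "S \<subseteq> B" and BV: "B \<subseteq> carrier V" and ind: "lin_indpt B" by simp_all
  have "v \<in> span B" if v: "v \<in> carrier V" for v
  proof (rule ccontr)
    assume n: "v \<notin> span B"
    then have "v \<notin> B" using span_mem[OF BV] by blast
    then have "lin_indpt (B \<union> {v})" using n lin_dep_iff_in_span[OF BV ind v] by blast
    then have "B \<union> {v} = B" using SB BV v max[THEN bspec, of "B \<union> {v}"] by blast
    with \<open>v \<notin> B\<close> show False by blast
  qed
  then have "span B = carrier V" using span_closed[OF BV] by (intro equalityI subsetI)
  with SB BV ind show ?thesis unfolding basis_def by blast
qed

text \<open>Identifying \<open>V\<close> with the free module on \<open>B\<close> transports both
  the universal property and the cardinality bounds of free modules to \<open>V\<close>.\<close>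

lemma basis_coordinates:
  assumes B: "basis B"
  shows "bij_betw (free_lift K V (\<lambda>x. x)) (carrier (free_module K B)) (carrier V)"
proof -
  let ?l = "free_lift K V (\<lambda>x. x)"
  interpret L: left_module K V by (rule is_left_module)
  interpret F: left_module K "free_module K B" by (rule left_module_free)
  have BV: "B \<subseteq> carrier V" "lin_indpt B" "span B = carrier V" using B by (auto simp: basis_def)
  have hom: "?l \<in> module_hom K (free_module K B) V"
    using BV by (intro L.free_lift_hom) auto
  have l: "?l f = lincomb f (supp K f)" for f by (simp add: free_lift_def lincomb_def)
  have ker: "f = \<zero>\<^bsub>free_module K B\<^esub>" if f: "f \<in> carrier (free_module K B)" and 0: "?l f = \<zero>\<^bsub>V\<^esub>" for f
  proof -
    have "f \<in> supp K f \<rightarrow> {\<zero>\<^bsub>K\<^esub>}"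
      using 0 f l free_module_supp[OF f] free_module_mem[OF f]
      by (intro not_lindepD[OF BV(2)]) auto
    then show ?thesis by (auto simp: supp_def Pi_def)
  qed
  have "inj_on ?l (carrier (free_module K B))"
  proof (rule inj_onI)
    fix f g assume fg: "f \<in> carrier (free_module K B)" "g \<in> carrier (free_module K B)" "?l f = ?l g"
    then have "?l (f \<ominus>\<^bsub>free_module K B\<^esub> g) = \<zero>\<^bsub>V\<^esub>"
      using module_hom_diff[OF F.abelian_group_axioms M.abelian_group_axioms hom, of f g]
        module_hom_mem[OF hom, of g] by (simp add: M.r_neg a_minus_def)
    then have "f \<ominus>\<^bsub>free_module K B\<^esub> g = \<zero>\<^bsub>free_module K B\<^esub>"
      using fg(1,2) by (intro ker F.M.minus_closed)
    then have "\<ominus>\<^bsub>free_module K B\<^esub> (\<ominus>\<^bsub>free_module K B\<^esub> g) = f"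
      using fg(1,2) unfolding a_minus_def by (intro F.M.minus_equality F.M.a_inv_closed)
    then show "f = g" using F.M.minus_minus[OF fg(2)] by (rule trans[OF sym])
  qed
  moreover have "v \<in> ?l ` carrier (free_module K B)" if v: "v \<in> carrier V" for v
  proof -
    from v have "v \<in> span B" by (simp add: BV(3))
    then obtain a A where A: "finite A" "A \<subseteq> B" "a \<in> A \<rightarrow> carrier K" "v = lincomb a A"
      unfolding span_def by (elim CollectE exE conjE)
    \<comment> \<open>A linear combination over \<open>A\<close> constrains \<open>a\<close> only on
      \<open>A\<close>, whereas an element of the free module has to vanish elsewhere.\<close>
    define f where "f p = (if p \<in> A then a p else \<zero>\<^bsub>K\<^esub>)" for p
    have supp: "supp K f \<subseteq> A" by (auto simp: supp_def f_def)
    have f: "f \<in> carrier (free_module K B)"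
      using A finite_subset[OF supp] by (auto simp: free_module_carrier f_def)
    have "?l f = (\<Oplus>\<^bsub>V\<^esub>p\<in>A. f p \<odot>\<^bsub>V\<^esub> p)"
      using BV A supp by (intro L.free_lift_eq[OF f]) auto
    also have "\<dots> = v" unfolding A(4) lincomb_def
      using A BV by (intro M.finsum_cong') (auto simp: f_def)
    finally show ?thesis using f by blast
  qed
  ultimately show ?thesis using module_hom_mem[OF hom] by (auto simp: bij_betw_def)
qed

text \<open>Taking coordinates with respect to \<open>B\<close> and then lifting
  \<open>\<phi>\<close> from the free module yields the functional.\<close>

lemma linear_extension:
  assumes B: "basis B" and \<phi>: "\<phi> \<in> B \<rightarrow> carrier K"
  shows "\<exists>L \<in> module_hom K V (regular_module K). \<forall>b\<in>B. L b = \<phi> b"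
proof
  let ?l = "free_lift K V (\<lambda>x. x)" and ?F = "free_module K B"
  let ?k = "inv_into (carrier ?F) ?l"
  interpret L: left_module K V by (rule is_left_module)
  interpret F: left_module K ?F by (rule left_module_free)
  interpret R: left_module K "regular_module K"
    using ring_axioms by (rule left_module_regular)
  have BV: "B \<subseteq> carrier V" using B by (auto simp: basis_def)
  have hom: "?l \<in> module_hom K ?F V"
    using BV by (intro L.free_lift_hom) auto
  note bij = basis_coordinates[OF B]
  have hom': "?k \<in> module_hom K V ?F"
    by (rule module_hom_inv_into[OF hom bij F.left_module_axioms])
  show "(\<lambda>v. free_lift K (regular_module K) \<phi> (?k v)) \<in> module_hom K V (regular_module K)"
    using \<phi> by (intro module_hom_comp[OF hom'] R.free_lift_hom) simp
  show "\<forall>b\<in>B. free_lift K (regular_module K) \<phi> (?k b) = \<phi> b"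
  proof
    fix b assume b: "b \<in> B"
    then have "?l (unit_vec K b) = b" using BV by (intro L.free_lift_unit_vec) auto
    then have "?k b = unit_vec K b"
      using inv_into_f_f[OF bij_betw_imp_inj_on[OF bij] unit_vec_free[OF b]] by simp
    then show "free_lift K (regular_module K) \<phi> (?k b) = \<phi> b"
      using R.free_lift_unit_vec[of \<phi> b] b \<phi> by auto
  qed
qed

lemma card_of_carrier_le:
  assumes "basis B" and "|B| \<le>o |A|" and "|carrier K| \<le>o |A|" and "infinite A"
  shows "|carrier V| \<le>o |A|"
proof -
  have "|carrier V| =o |carrier (free_module K B)|"
    using card_of_ordIsoI[OF basis_coordinates[OF assms(1)]] by (rule ordIso_symmetric)
  also have "|carrier (free_module K B)| \<le>o |A|"
    unfolding free_module_def using assms(2-4) by (intro card_of_copower_infinite_le) simp_all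
  finally show ?thesis .
qed

lemma card_of_basis:
  assumes B: "basis B" and less: "|carrier K| <o |carrier V|" and inf: "infinite (carrier V)"
  shows "|B| =o |carrier V|"
proof -
  have le: "|B| \<le>o |carrier V|" using B by (intro card_of_mono1) (auto simp: basis_def)
  have "\<not> |B| <o |carrier V|"
  proof
    assume B_less: "|B| <o |carrier V|"
    \<comment> \<open>The disjoint sum of \<open>carrier K\<close> and \<open>B\<close> bounds
      scalars and basis at once. If it is infinite, it bounds \<open>V\<close> and is nevertheless
      smaller than \<open>V\<close>; if it is finite, \<open>V\<close> would be finite.\<close>
    show False
    proof (cases "finite (carrier K <+> B)")
      case True
      then have "finite (Fpow (B \<times> carrier K))" by (auto simp: Fpow_def)
      moreover have "|carrier V| \<le>o |Fpow (B \<times> carrier K)|"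
        using card_of_ordIsoI[OF basis_coordinates[OF B]] card_of_copower_le[of "regular_module K" B]
        unfolding free_module_def by (simp add: ordIso_ordLeq_trans[OF ordIso_symmetric])
      ultimately show False using inf card_of_ordLeq_finite by blast
    next
      case False
      have "|carrier V| \<le>o |carrier K <+> B|"
        using B card_of_Plus2 card_of_Plus1 False by (rule card_of_carrier_le)
      moreover have "|carrier K <+> B| <o |carrier V|"
        using inf less B_less by (rule card_of_Plus_ordLess_infinite)
      ultimately show False using not_ordLess_ordLeq by blast
    qed
  qed
  with le show ?thesis using ordLeq_iff_ordLess_or_ordIso by blast
qed

lemma has_dimension_card_of_carrier:
  assumes "|carrier K| <o |carrier V|" and "infinite (carrier V)"
  shows "has_dimension K V |carrier V|"
proof -
  have "lin_indpt {}" unfolding lin_dep_def by blast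
  then obtain B where "basis B" using exists_basis_extending[of "{}"] by blast
  then show ?thesis
    using card_of_basis[OF _ assms] vectorspace_axioms unfolding has_dimension_def by blast
qed

end

section \<open>Quotients, spaces of homomorphisms and \<open>Ext\<close>\<close>

lemma vectorspace_subset:
  assumes "vectorspace K V" and "W \<subseteq> carrier V" and "\<zero>\<^bsub>V\<^esub> \<in> W"
    and "\<And>x y. \<lbrakk>x \<in> W; y \<in> W\<rbrakk> \<Longrightarrow> x \<oplus>\<^bsub>V\<^esub> y \<in> W"
    and "\<And>k x. \<lbrakk>k \<in> carrier K; x \<in> W\<rbrakk> \<Longrightarrow> k \<odot>\<^bsub>V\<^esub> x \<in> W"
  shows "vectorspace K (V\<lparr>carrier := W\<rparr>)"
proof -
  interpret vectorspace K V by fact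
  have "LinearCombinations.submodule K W V"
    by (rule LinearCombinations.submodule.intro[OF vectorspace.axioms(1)[OF assms(1)] assms(2,4,3,5)])
  then show ?thesis using assms(1) by (intro subspace_is_vs subspace.intro)
qed

lemma module_homI:
  assumes "\<And>x. x \<in> carrier M \<Longrightarrow> h x \<in> carrier N"
    and "\<And>x y. \<lbrakk>x \<in> carrier M; y \<in> carrier M\<rbrakk> \<Longrightarrow> h (x \<oplus>\<^bsub>M\<^esub> y) = h x \<oplus>\<^bsub>N\<^esub> h y"
    and "\<And>r x. \<lbrakk>r \<in> carrier R; x \<in> carrier M\<rbrakk> \<Longrightarrow> h (r \<odot>\<^bsub>M\<^esub> x) = r \<odot>\<^bsub>N\<^esub> h x"
  shows "h \<in> module_hom R M N"
  using assms by (simp add: LinearCombinations.module_hom_def)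

lemma vectorspace_quotient:
  assumes V: "vectorspace K V" and sub: "W \<subseteq> carrier V" and zero: "\<zero>\<^bsub>V\<^esub> \<in> W"
    and add: "\<And>x y. \<lbrakk>x \<in> W; y \<in> W\<rbrakk> \<Longrightarrow> x \<oplus>\<^bsub>V\<^esub> y \<in> W"
    and smult: "\<And>k x. \<lbrakk>k \<in> carrier K; x \<in> W\<rbrakk> \<Longrightarrow> k \<odot>\<^bsub>V\<^esub> x \<in> W"
  shows "vectorspace K (quotient_module V W)" (is "vectorspace K ?Q")
    and "\<And>x y. \<lbrakk>x \<in> carrier V; y \<in> carrier V; W +>\<^bsub>V\<^esub> x = W +>\<^bsub>V\<^esub> y\<rbrakk> \<Longrightarrow> \<exists>w\<in>W. x = w \<oplus>\<^bsub>V\<^esub> y"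
    and "carrier (quotient_module V W) = (\<lambda>x. W +>\<^bsub>V\<^esub> x) ` carrier V"
proof -
  interpret vectorspace K V by fact
  have "additive_subgroup W V"
  proof (intro additive_subgroupI M.add.subgroupI)
    fix x assume x: "x \<in> W"
    then have "\<ominus>\<^bsub>V\<^esub> x = (\<ominus>\<^bsub>K\<^esub> \<one>\<^bsub>K\<^esub>) \<odot>\<^bsub>V\<^esub> x"
      using smult_minus_1[of x] sub by auto
    then show "\<ominus>\<^bsub>V\<^esub> x \<in> W" using x by (simp add: smult)
  qed (use assms in auto)
  then interpret W: abelian_subgroup W V by (intro abelian_subgroupI3 M.abelian_group_axioms)
  have coset: "(\<exists>w\<in>W. x = w \<oplus>\<^bsub>V\<^esub> y) \<longleftrightarrow> x \<in> W +>\<^bsub>V\<^esub> y" for x y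
    by (auto simp: a_r_coset_def')
  have mem: "X \<in> carrier ?Q \<longleftrightarrow> (\<exists>x\<in>carrier V. X = W +>\<^bsub>V\<^esub> x)" for X
    by (auto simp: quotient_module_def A_RCOSETS_def')
  have a: "(W +>\<^bsub>V\<^esub> x) \<oplus>\<^bsub>?Q\<^esub> (W +>\<^bsub>V\<^esub> y) = W +>\<^bsub>V\<^esub> (x \<oplus>\<^bsub>V\<^esub> y)"
    if "x \<in> carrier V" "y \<in> carrier V" for x y
    using that by (simp add: quotient_module_def W.a_rcos_sum)
  \<comment> \<open>Scalar multiplication on the quotient is a union over all representatives
    \<open>y\<close>. It is a single coset because every \<open>y\<close> contributes the same
    one.\<close>
  have s: "k \<odot>\<^bsub>?Q\<^esub> (W +>\<^bsub>V\<^esub> x) = W +>\<^bsub>V\<^esub> (k \<odot>\<^bsub>V\<^esub> x)"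
    if k: "k \<in> carrier K" and x: "x \<in> carrier V" for k x
  proof -
    have "W +>\<^bsub>V\<^esub> (k \<odot>\<^bsub>V\<^esub> y) = W +>\<^bsub>V\<^esub> (k \<odot>\<^bsub>V\<^esub> x)" if "y \<in> W +>\<^bsub>V\<^esub> x" for y
    proof -
      from that obtain w where w: "w \<in> W" "y = w \<oplus>\<^bsub>V\<^esub> x" using coset by blast
      then have "k \<odot>\<^bsub>V\<^esub> y = k \<odot>\<^bsub>V\<^esub> w \<oplus>\<^bsub>V\<^esub> k \<odot>\<^bsub>V\<^esub> x"
        using k x sub by (auto simp: smult_r_distr)
      then have "k \<odot>\<^bsub>V\<^esub> y \<in> W +>\<^bsub>V\<^esub> (k \<odot>\<^bsub>V\<^esub> x)"
        using coset[THEN iffD1, OF bexI[OF _ smult[OF k w(1)]]] by simp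
      then show ?thesis using k x by (intro W.a_repr_independence'[symmetric]) auto
    qed
    moreover have "x \<in> W +>\<^bsub>V\<^esub> x" using x by (rule W.a_rcos_self)
    ultimately have "(\<Union>y\<in>W +>\<^bsub>V\<^esub> x. W +>\<^bsub>V\<^esub> (k \<odot>\<^bsub>V\<^esub> y)) = W +>\<^bsub>V\<^esub> (k \<odot>\<^bsub>V\<^esub> x)" by blast
    then show ?thesis by (simp add: quotient_module_def)
  qed
  have z: "\<zero>\<^bsub>?Q\<^esub> = W +>\<^bsub>V\<^esub> \<zero>\<^bsub>V\<^esub>" 
    using sub M.a_coset_add_zero[of W] by (simp add: quotient_module_def)
  show "vectorspace K ?Q"
  proof (rule vs_criteria)
    show "field K" by (rule field_axioms)
    show "\<zero>\<^bsub>?Q\<^esub> \<in> carrier ?Q" using mem z by blast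
    show "\<forall>X Y. X \<in> carrier ?Q \<and> Y \<in> carrier ?Q \<longrightarrow> X \<oplus>\<^bsub>?Q\<^esub> Y \<in> carrier ?Q"
      unfolding mem using a M.a_closed by metis
    show "\<forall>X\<in>carrier ?Q. \<exists>Y\<in>carrier ?Q. X \<oplus>\<^bsub>?Q\<^esub> Y = \<zero>\<^bsub>?Q\<^esub>"
    proof
      fix X assume "X \<in> carrier ?Q"
      then obtain x where x: "x \<in> carrier V" "X = W +>\<^bsub>V\<^esub> x" using mem by blast
      then have "X \<oplus>\<^bsub>?Q\<^esub> (W +>\<^bsub>V\<^esub> (\<ominus>\<^bsub>V\<^esub> x)) = \<zero>\<^bsub>?Q\<^esub>" by (simp add: a z M.r_neg)
      then show "\<exists>Y\<in>carrier ?Q. X \<oplus>\<^bsub>?Q\<^esub> Y = \<zero>\<^bsub>?Q\<^esub>" using x mem M.a_inv_closed by blast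
    qed
    show "\<forall>k X. k \<in> carrier K \<and> X \<in> carrier ?Q \<longrightarrow> k \<odot>\<^bsub>?Q\<^esub> X \<in> carrier ?Q"
      unfolding mem using s smult_closed by metis
    show "\<forall>X Y. X \<in> carrier ?Q \<and> Y \<in> carrier ?Q \<longrightarrow> X \<oplus>\<^bsub>?Q\<^esub> Y = Y \<oplus>\<^bsub>?Q\<^esub> X"
      unfolding mem using a M.a_comm by metis
    show "\<forall>X Y Z. X \<in> carrier ?Q \<and> Y \<in> carrier ?Q \<and> Z \<in> carrier ?Q \<longrightarrow>
        X \<oplus>\<^bsub>?Q\<^esub> Y \<oplus>\<^bsub>?Q\<^esub> Z = X \<oplus>\<^bsub>?Q\<^esub> (Y \<oplus>\<^bsub>?Q\<^esub> Z)"
      unfolding mem by (auto simp: a M.a_assoc)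
    show "\<forall>X\<in>carrier ?Q. X \<oplus>\<^bsub>?Q\<^esub> \<zero>\<^bsub>?Q\<^esub> = X"
      unfolding Ball_def mem by (auto simp: a z)
    show "\<forall>k l X. k \<in> carrier K \<and> l \<in> carrier K \<and> X \<in> carrier ?Q \<longrightarrow>
        (k \<otimes>\<^bsub>K\<^esub> l) \<odot>\<^bsub>?Q\<^esub> X = k \<odot>\<^bsub>?Q\<^esub> (l \<odot>\<^bsub>?Q\<^esub> X)"
      unfolding mem by (auto simp: s smult_assoc1)
    show "\<forall>X\<in>carrier ?Q. \<one>\<^bsub>K\<^esub> \<odot>\<^bsub>?Q\<^esub> X = X"
      unfolding Ball_def mem by (auto simp: s)
    show "\<forall>k l X. k \<in> carrier K \<and> l \<in> carrier K \<and> X \<in> carrier ?Q \<longrightarrow>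
        (k \<oplus>\<^bsub>K\<^esub> l) \<odot>\<^bsub>?Q\<^esub> X = k \<odot>\<^bsub>?Q\<^esub> X \<oplus>\<^bsub>?Q\<^esub> l \<odot>\<^bsub>?Q\<^esub> X"
      unfolding mem by (auto simp: s a smult_l_distr)
    show "\<forall>k X Y. k \<in> carrier K \<and> X \<in> carrier ?Q \<and> Y \<in> carrier ?Q \<longrightarrow>
        k \<odot>\<^bsub>?Q\<^esub> (X \<oplus>\<^bsub>?Q\<^esub> Y) = k \<odot>\<^bsub>?Q\<^esub> X \<oplus>\<^bsub>?Q\<^esub> k \<odot>\<^bsub>?Q\<^esub> Y"
      unfolding mem by (auto simp: s a smult_r_distr)
  qed
  show "\<exists>w\<in>W. x = w \<oplus>\<^bsub>V\<^esub> y" if "x \<in> carrier V" "y \<in> carrier V" "W +>\<^bsub>V\<^esub> x = W +>\<^bsub>V\<^esub> y" for x y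
    using W.a_rcos_self[OF that(1)] that(3) coset by blast
  show "carrier ?Q = (\<lambda>x. W +>\<^bsub>V\<^esub> x) ` carrier V" using mem by blast
qed

section \<open>Hom spaces over an algebra with central scalars\<close>

locale central_scalars = K: field K + R: ring R
  for K :: "('k, 'x) ring_scheme" and R :: "('r, 'y) ring_scheme" and \<eta> :: "'k \<Rightarrow> 'r" +
  assumes \<eta>_closed: "k \<in> carrier K \<Longrightarrow> \<eta> k \<in> carrier R"
    and \<eta>_add: "\<lbrakk>k \<in> carrier K; l \<in> carrier K\<rbrakk> \<Longrightarrow> \<eta> (k \<oplus>\<^bsub>K\<^esub> l) = \<eta> k \<oplus>\<^bsub>R\<^esub> \<eta> l"
    and \<eta>_mult: "\<lbrakk>k \<in> carrier K; l \<in> carrier K\<rbrakk> \<Longrightarrow> \<eta> (k \<otimes>\<^bsub>K\<^esub> l) = \<eta> k \<otimes>\<^bsub>R\<^esub> \<eta> l"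
    and \<eta>_one: "\<eta> \<one>\<^bsub>K\<^esub> = \<one>\<^bsub>R\<^esub>"
    and \<eta>_central: "\<lbrakk>k \<in> carrier K; r \<in> carrier R\<rbrakk> \<Longrightarrow> \<eta> k \<otimes>\<^bsub>R\<^esub> r = r \<otimes>\<^bsub>R\<^esub> \<eta> k"
begin

lemma hom_space_simps [simp]:
  "h \<in> carrier (hom_space \<eta> R L N) \<longleftrightarrow> h \<in> module_hom R L N \<and> h \<in> extensional (carrier L)"
  "\<zero>\<^bsub>hom_space \<eta> R L N\<^esub> = (\<lambda>x\<in>carrier L. \<zero>\<^bsub>N\<^esub>)"
  "f \<oplus>\<^bsub>hom_space \<eta> R L N\<^esub> g = (\<lambda>x\<in>carrier L. f x \<oplus>\<^bsub>N\<^esub> g x)"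
  "k \<odot>\<^bsub>hom_space \<eta> R L N\<^esub> f = (\<lambda>x\<in>carrier L. \<eta> k \<odot>\<^bsub>N\<^esub> f x)"
  by (auto simp: hom_space_def)

lemma vectorspace_hom_space:
  assumes "left_module R L" and "left_module R N"
  shows "vectorspace K (hom_space \<eta> R L N)"
proof -
  interpret L: left_module R L by fact
  interpret N: left_module R N by fact
  let ?H = "hom_space \<eta> R L N"
  have ext: "f = g" if "f \<in> extensional (carrier L)" "g \<in> extensional (carrier L)"
    "\<And>x. x \<in> carrier L \<Longrightarrow> f x = g x" for f g :: "_ \<Rightarrow> 'e"
    using that by (rule extensionalityI)
  have mem: "h x \<in> carrier N" if "h \<in> module_hom R L N" "x \<in> carrier L" for h x
    using that by (rule module_hom_mem)
  note hom = LinearCombinations.module_hom_add LinearCombinations.module_hom_smult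
  \<comment> \<open>Here centrality enters: a scalar multiple of an R-linear map is R-linear again
    because \<open>\<eta> k\<close> commutes with \<open>r\<close>.\<close>
  have comm: "\<eta> k \<odot>\<^bsub>N\<^esub> (r \<odot>\<^bsub>N\<^esub> y) = r \<odot>\<^bsub>N\<^esub> (\<eta> k \<odot>\<^bsub>N\<^esub> y)"
    if "k \<in> carrier K" "r \<in> carrier R" "y \<in> carrier N" for k r y
    using that by (metis N.smult_assoc \<eta>_central \<eta>_closed)
  have add: "f \<oplus>\<^bsub>?H\<^esub> g \<in> carrier ?H" if "f \<in> carrier ?H" "g \<in> carrier ?H" for f g
  proof -
    have f: "f \<in> module_hom R L N" and g: "g \<in> module_hom R L N" using that by simp_all
    have "f x \<oplus>\<^bsub>N\<^esub> f y \<oplus>\<^bsub>N\<^esub> (g x \<oplus>\<^bsub>N\<^esub> g y) = f x \<oplus>\<^bsub>N\<^esub> g x \<oplus>\<^bsub>N\<^esub> (f y \<oplus>\<^bsub>N\<^esub> g y)"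
      if "x \<in> carrier L" "y \<in> carrier L" for x y
      using that by (simp add: mem[OF f] mem[OF g] N.M.a_ac)
    then have "f \<oplus>\<^bsub>?H\<^esub> g \<in> module_hom R L N"
      by (intro module_homI)
        (simp_all add: mem[OF f] mem[OF g] hom[OF f] hom[OF g] N.smult_r_distr)
    then show ?thesis by simp
  qed
  have smult: "k \<odot>\<^bsub>?H\<^esub> f \<in> carrier ?H" if k: "k \<in> carrier K" and f': "f \<in> carrier ?H" for k f
  proof -
    have f: "f \<in> module_hom R L N" using f' by simp
    have "k \<odot>\<^bsub>?H\<^esub> f \<in> module_hom R L N"
      using k by (intro module_homI)
        (simp_all add: mem[OF f] hom[OF f] N.smult_r_distr \<eta>_closed comm)
    then show ?thesis by simp
  qed
  show ?thesis
  proof (rule vs_criteria)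
    show "field K" by (rule K.field_axioms)
    show "\<zero>\<^bsub>?H\<^esub> \<in> carrier ?H" by (auto simp: LinearCombinations.module_hom_def)
    show "\<forall>f\<in>carrier ?H. \<exists>g\<in>carrier ?H. f \<oplus>\<^bsub>?H\<^esub> g = \<zero>\<^bsub>?H\<^esub>"
    proof
      fix f assume f: "f \<in> carrier ?H"
      let ?k = "\<ominus>\<^bsub>K\<^esub> \<one>\<^bsub>K\<^esub>"
      have "\<eta> \<zero>\<^bsub>K\<^esub> \<oplus>\<^bsub>R\<^esub> \<eta> \<zero>\<^bsub>K\<^esub> = \<eta> \<zero>\<^bsub>K\<^esub>"
        using \<eta>_add[of "\<zero>\<^bsub>K\<^esub>" "\<zero>\<^bsub>K\<^esub>"] by simp
      then have "\<eta> \<zero>\<^bsub>K\<^esub> = \<zero>\<^bsub>R\<^esub>" using \<eta>_closed[of "\<zero>\<^bsub>K\<^esub>"] by simp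
      then have "\<one>\<^bsub>R\<^esub> \<oplus>\<^bsub>R\<^esub> \<eta> ?k = \<zero>\<^bsub>R\<^esub>"
        using \<eta>_add[of "\<one>\<^bsub>K\<^esub>" ?k] by (simp add: \<eta>_one K.r_neg)
      then have "y \<oplus>\<^bsub>N\<^esub> \<eta> ?k \<odot>\<^bsub>N\<^esub> y = \<zero>\<^bsub>N\<^esub>" if "y \<in> carrier N" for y
        using that N.smult_l_distr[of "\<one>\<^bsub>R\<^esub>" "\<eta> ?k" y] \<eta>_closed[of ?k] by simp
      then have "f \<oplus>\<^bsub>?H\<^esub> (?k \<odot>\<^bsub>?H\<^esub> f) = \<zero>\<^bsub>?H\<^esub>"
        using f by (intro ext) (simp_all add: mem)
      then show "\<exists>g\<in>carrier ?H. f \<oplus>\<^bsub>?H\<^esub> g = \<zero>\<^bsub>?H\<^esub>"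
        using smult[of ?k f] f by blast
    qed
    show "\<forall>f g. f \<in> carrier ?H \<and> g \<in> carrier ?H \<longrightarrow> f \<oplus>\<^bsub>?H\<^esub> g \<in> carrier ?H"
      using add by blast
    show "\<forall>k f. k \<in> carrier K \<and> f \<in> carrier ?H \<longrightarrow> k \<odot>\<^bsub>?H\<^esub> f \<in> carrier ?H"
      using smult by blast
  qed (auto intro!: ext simp: mem N.M.a_ac N.smult_r_distr N.smult_l_distr N.smult_assoc
        \<eta>_closed \<eta>_add \<eta>_mult \<eta>_one)
qed

end

section \<open>The canonical free resolution, its cocycles and the size of Ext\<close>

locale ext_modules = central_scalars K R \<eta> + M: left_module R M + N: left_module R N
  for K :: "('k, 'x) ring_scheme" and R :: "('r, 'y) ring_scheme" and \<eta>
    and M :: "('r, 'm, 'z) module_scheme" and N :: "('r, 'n, 'w) module_scheme"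
begin

abbreviation "F0 \<equiv> free_module R (carrier M)"
abbreviation "d0 \<equiv> free_cover R M (carrier M)"
abbreviation "Z0 \<equiv> a_kernel F0 M d0"
abbreviation "F1 \<equiv> free_module R Z0"
abbreviation "d1 \<equiv> free_cover R F0 Z0"
abbreviation "Z1 \<equiv> a_kernel F1 F0 d1"
abbreviation "F2 \<equiv> free_module R Z1"
abbreviation "d2 \<equiv> free_cover R F1 Z1"
abbreviation "cocycles \<equiv>
  {h \<in> carrier (hom_space \<eta> R F1 N). \<forall>x\<in>carrier F2. h (d2 x) = \<zero>\<^bsub>N\<^esub>}"
abbreviation "coboundaries \<equiv>
  (\<lambda>g. compose (carrier F1) g d1) ` carrier (hom_space \<eta> R F0 N)"

lemma Ext1_eq:
  "Ext1 \<eta> R M N = quotient_module ((hom_space \<eta> R F1 N)\<lparr>carrier := cocycles\<rparr>) coboundaries"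
  by (simp only: Ext1_def Let_def)

sublocale F0: left_module R F0 by (rule R.left_module_free)
sublocale F1: left_module R F1 by (rule R.left_module_free)
sublocale F2: left_module R F2 by (rule R.left_module_free)

lemma d0_hom: "d0 \<in> module_hom R F0 M" by (rule M.free_cover_hom) simp

lemma Z0_subset: "Z0 \<subseteq> carrier F0" by (auto simp: a_kernel_def kernel_def)

lemma Z0_iff: "z \<in> Z0 \<longleftrightarrow> z \<in> carrier F0 \<and> d0 z = \<zero>\<^bsub>M\<^esub>"
  by (auto simp: a_kernel_def kernel_def)

lemma d1_hom: "d1 \<in> module_hom R F1 F0" by (rule F0.free_cover_hom[OF Z0_subset])

lemma d1_mem: "x \<in> carrier F1 \<Longrightarrow> d1 x \<in> Z0"
  by (rule F0.free_cover_kernel[OF M.left_module_axioms d0_hom])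

lemma d1_unit_vec: "z \<in> Z0 \<Longrightarrow> d1 (unit_vec R z) = z"
  by (rule F0.free_cover_unit_vec[OF Z0_subset])

lemma Z1_subset: "Z1 \<subseteq> carrier F1" by (auto simp: a_kernel_def kernel_def)

lemma d2_hom: "d2 \<in> module_hom R F2 F1" by (rule F1.free_cover_hom[OF Z1_subset])

lemma d1_d2: "x \<in> carrier F2 \<Longrightarrow> d1 (d2 x) = \<zero>\<^bsub>F0\<^esub>"
  using F1.free_cover_kernel[OF F0.left_module_axioms d1_hom] by (auto simp: a_kernel_def kernel_def)

lemma restrict_module_hom:
  assumes "left_module R L" and "h \<in> module_hom R L P"
  shows "restrict h (carrier L) \<in> module_hom R L P"
proof -
  interpret L: left_module R L by fact
  show ?thesis using assms(2)
    by (intro module_homI)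
      (simp_all add: module_hom_mem[OF assms(2)] LinearCombinations.module_hom_add[OF assms(2)]
        LinearCombinations.module_hom_smult[OF assms(2)])
qed

text \<open>The map \<open>d1\<close> has image \<open>Z0\<close> and kills the image of
  \<open>d2\<close>, so a homomorphism given on \<open>Z0\<close> alone already yields a cocycle.
  The resulting cocycle is a coboundary exactly when that homomorphism extends to
  \<open>F0\<close>.\<close>

lemma cocycleI:
  assumes "h \<in> module_hom R (F0\<lparr>carrier := Z0\<rparr>) N"
  shows "(\<lambda>x\<in>carrier F1. h (d1 x)) \<in> cocycles"
proof -
  have h: "h x \<in> carrier N" "h (x \<oplus>\<^bsub>F0\<^esub> y) = h x \<oplus>\<^bsub>N\<^esub> h y" "h (r \<odot>\<^bsub>F0\<^esub> x) = r \<odot>\<^bsub>N\<^esub> h x"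
    if "x \<in> Z0" "y \<in> Z0" "r \<in> carrier R" for x y r
    using that module_hom_mem[OF assms] LinearCombinations.module_hom_add[OF assms]
      LinearCombinations.module_hom_smult[OF assms] by simp_all
  have hd: "(\<lambda>x. h (d1 x)) \<in> module_hom R F1 N"
  proof (rule module_homI)
    fix x y assume xy: "x \<in> carrier F1" "y \<in> carrier F1"
    show "h (d1 (x \<oplus>\<^bsub>F1\<^esub> y)) = h (d1 x) \<oplus>\<^bsub>N\<^esub> h (d1 y)"
      using h(2)[OF d1_mem[OF xy(1)] d1_mem[OF xy(2)] R.one_closed]
      by (simp only: LinearCombinations.module_hom_add[OF d1_hom xy])
  next
    fix r x assume rx: "r \<in> carrier R" "x \<in> carrier F1"
    show "h (d1 (r \<odot>\<^bsub>F1\<^esub> x)) = r \<odot>\<^bsub>N\<^esub> h (d1 x)"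
      using h(3)[OF d1_mem[OF rx(2)] d1_mem[OF rx(2)] rx(1)]
      by (simp only: LinearCombinations.module_hom_smult[OF d1_hom rx])
  qed (rule h(1)[OF d1_mem d1_mem R.one_closed])
  have zero: "\<zero>\<^bsub>F0\<^esub> \<in> Z0"
    using module_hom_zero[OF F0.abelian_group_axioms M.abelian_group_axioms d0_hom] F0.M.zero_closed
    by (simp only: Z0_iff)
  have "h \<zero>\<^bsub>F0\<^esub> = \<zero>\<^bsub>N\<^esub>"
    using h(3)[OF zero zero R.zero_closed] h(1)[OF zero zero R.zero_closed]
    by (simp del: free_module_simps)
  then show ?thesis
    using restrict_module_hom[OF F1.left_module_axioms hd] d1_d2 module_hom_mem[OF d2_hom]
    by (simp del: free_module_simps)
qed

lemma vectorspace_cocycles: "vectorspace K ((hom_space \<eta> R F1 N)\<lparr>carrier := cocycles\<rparr>)"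
proof (rule vectorspace_subset)
  show V: "vectorspace K (hom_space \<eta> R F1 N)"
    by (rule vectorspace_hom_space[OF F1.left_module_axioms N.left_module_axioms])
  then interpret V: vectorspace K "hom_space \<eta> R F1 N" .
  note d2 = module_hom_mem[OF d2_hom]
  show "\<zero>\<^bsub>hom_space \<eta> R F1 N\<^esub> \<in> cocycles"
    using V.M.zero_closed d2 by simp
  show "f \<oplus>\<^bsub>hom_space \<eta> R F1 N\<^esub> g \<in> cocycles" if f: "f \<in> cocycles" and g: "g \<in> cocycles" for f g
  proof -
    have "f \<oplus>\<^bsub>hom_space \<eta> R F1 N\<^esub> g \<in> carrier (hom_space \<eta> R F1 N)"
      using f g by (intro V.M.a_closed) simp_all
    then show ?thesis using f g d2 by (simp del: free_module_simps)
  qed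
  show "k \<odot>\<^bsub>hom_space \<eta> R F1 N\<^esub> f \<in> cocycles" if k: "k \<in> carrier K" and f: "f \<in> cocycles" for k f
  proof -
    have "k \<odot>\<^bsub>hom_space \<eta> R F1 N\<^esub> f \<in> carrier (hom_space \<eta> R F1 N)"
      using k f by (intro V.smult_closed) simp_all
    then show ?thesis using k f d2 \<eta>_closed by (simp del: free_module_simps)
  qed
qed blast

lemma coboundary_subspace:
  shows "coboundaries \<subseteq> cocycles"
    and "\<zero>\<^bsub>hom_space \<eta> R F1 N\<^esub> \<in> coboundaries"
    and "\<lbrakk>f \<in> coboundaries; g \<in> coboundaries\<rbrakk> \<Longrightarrow> f \<oplus>\<^bsub>hom_space \<eta> R F1 N\<^esub> g \<in> coboundaries"
    and "\<lbrakk>k \<in> carrier K; f \<in> coboundaries\<rbrakk> \<Longrightarrow> k \<odot>\<^bsub>hom_space \<eta> R F1 N\<^esub> f \<in> coboundaries"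
proof -
  let ?c = "\<lambda>g. compose (carrier F1) g d1"
  interpret V: vectorspace K "hom_space \<eta> R F0 N"
    by (rule vectorspace_hom_space[OF F0.left_module_axioms N.left_module_axioms])
  note d1 = module_hom_mem[OF d1_hom]
  show "coboundaries \<subseteq> cocycles"
  proof
    fix f assume "f \<in> coboundaries"
    then obtain g where g: "g \<in> module_hom R F0 N" and f: "f = ?c g" by auto
    have "g \<in> module_hom R (F0\<lparr>carrier := Z0\<rparr>) N"
      using g Z0_subset by (auto simp: LinearCombinations.module_hom_def subset_iff simp del: free_module_simps)
    from cocycleI[OF this] show "f \<in> cocycles" by (simp only: f compose_def)
  qed
  have "\<zero>\<^bsub>hom_space \<eta> R F1 N\<^esub> = ?c \<zero>\<^bsub>hom_space \<eta> R F0 N\<^esub>"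
    using d1 by (simp add: compose_def cong: restrict_cong)
  with imageI[OF V.M.zero_closed, of ?c]
  show "\<zero>\<^bsub>hom_space \<eta> R F1 N\<^esub> \<in> coboundaries" by (simp only:)
  show "f \<oplus>\<^bsub>hom_space \<eta> R F1 N\<^esub> g \<in> coboundaries"
    if f: "f \<in> coboundaries" and g: "g \<in> coboundaries"
  proof -
    obtain f' where f': "f' \<in> carrier (hom_space \<eta> R F0 N)" "f = ?c f'" using f by (rule imageE)
    obtain g' where g': "g' \<in> carrier (hom_space \<eta> R F0 N)" "g = ?c g'" using g by (rule imageE)
    have "f \<oplus>\<^bsub>hom_space \<eta> R F1 N\<^esub> g = ?c (f' \<oplus>\<^bsub>hom_space \<eta> R F0 N\<^esub> g')"
      unfolding f'(2) g'(2) using d1 by (simp add: compose_def cong: restrict_cong)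
    with imageI[OF V.M.a_closed[OF f'(1) g'(1)], of ?c] show ?thesis by (simp only:)
  qed
  show "k \<odot>\<^bsub>hom_space \<eta> R F1 N\<^esub> f \<in> coboundaries"
    if k: "k \<in> carrier K" and f: "f \<in> coboundaries"
  proof -
    obtain f' where f': "f' \<in> carrier (hom_space \<eta> R F0 N)" "f = ?c f'" using f by (rule imageE)
    have "k \<odot>\<^bsub>hom_space \<eta> R F1 N\<^esub> f = ?c (k \<odot>\<^bsub>hom_space \<eta> R F0 N\<^esub> f')"
      unfolding f'(2) using d1 by (simp add: compose_def cong: restrict_cong)
    with imageI[OF V.smult_closed[OF k f'(1)], of ?c] show ?thesis by (simp only:)
  qed
qed

lemma
  shows vectorspace_Ext1: "vectorspace K (Ext1 \<eta> R M N)"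
    and Ext1_coset_eq: "\<lbrakk>f \<in> cocycles; g \<in> cocycles;
      coboundaries +>\<^bsub>(hom_space \<eta> R F1 N)\<lparr>carrier := cocycles\<rparr>\<^esub> f =
      coboundaries +>\<^bsub>(hom_space \<eta> R F1 N)\<lparr>carrier := cocycles\<rparr>\<^esub> g\<rbrakk> \<Longrightarrow>
      \<exists>b\<in>coboundaries. f = b \<oplus>\<^bsub>hom_space \<eta> R F1 N\<^esub> g"
    and Ext1_carrier: "carrier (Ext1 \<eta> R M N) =
      (\<lambda>f. coboundaries +>\<^bsub>(hom_space \<eta> R F1 N)\<lparr>carrier := cocycles\<rparr>\<^esub> f) ` cocycles"
proof -
  let ?V = "(hom_space \<eta> R F1 N)\<lparr>carrier := cocycles\<rparr>"
  have eq: "carrier ?V = cocycles" "\<zero>\<^bsub>?V\<^esub> = \<zero>\<^bsub>hom_space \<eta> R F1 N\<^esub>"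
    "\<And>f g. f \<oplus>\<^bsub>?V\<^esub> g = f \<oplus>\<^bsub>hom_space \<eta> R F1 N\<^esub> g"
    "\<And>k f. k \<odot>\<^bsub>?V\<^esub> f = k \<odot>\<^bsub>hom_space \<eta> R F1 N\<^esub> f"
    by (simp_all del: hom_space_simps)
  note Q = vectorspace_quotient[OF vectorspace_cocycles, unfolded eq,
      OF coboundary_subspace(1) coboundary_subspace(2) coboundary_subspace(3) coboundary_subspace(4)]
  show "vectorspace K (Ext1 \<eta> R M N)" unfolding Ext1_eq by (rule Q(1))
  show "\<exists>b\<in>coboundaries. f = b \<oplus>\<^bsub>hom_space \<eta> R F1 N\<^esub> g"
    if "f \<in> cocycles" "g \<in> cocycles" "coboundaries +>\<^bsub>?V\<^esub> f = coboundaries +>\<^bsub>?V\<^esub> g"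
    by (rule Q(2); (assumption | rule that))
  show "carrier (Ext1 \<eta> R M N) = (\<lambda>f. coboundaries +>\<^bsub>?V\<^esub> f) ` cocycles"
    unfolding Ext1_eq by (rule Q(3))
qed

lemma card_of_Ext1_le: "|carrier (Ext1 \<eta> R M N)| \<le>o |Func Z0 (carrier N)|"
proof -
  have "|carrier (Ext1 \<eta> R M N)| \<le>o |cocycles|"
    unfolding Ext1_carrier by (rule card_of_image)
  also have "|cocycles| \<le>o |Func Z0 (carrier N)|"
  proof (rule card_of_ordLeqI)
    let ?v = "\<lambda>h z. if z \<in> Z0 then h (unit_vec R z) else undefined"
    show "inj_on ?v cocycles"
    proof (rule inj_onI)
      fix g h assume g: "g \<in> cocycles" and h: "h \<in> cocycles" and eq: "?v g = ?v h"
      have "g x = h x" if "x \<in> carrier F1" for x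
      proof (rule N.free_hom_eqI[OF _ _ _ that])
        show "g (unit_vec R z) = h (unit_vec R z)" if "z \<in> Z0" for z
          using fun_cong[OF eq, of z] that by simp
      qed (use g h in simp_all)
      then show "g = h" using g h by (intro extensionalityI[of g "carrier F1" h]) simp_all
    qed
    show "?v h \<in> Func Z0 (carrier N)" if "h \<in> cocycles" for h
      using that module_hom_mem[of h R F1 N, OF _ R.unit_vec_free] by (simp add: Func_def)
  qed
  finally show ?thesis .
qed

text \<open>Two homomorphisms on \<open>Z0\<close> give the same class only if their difference
  extends to \<open>F0\<close>: the identity of cosets, evaluated at the unit vector of
  \<open>z\<close>, becomes an identity at \<open>z\<close>. Thus \<open>dist\<close> does not
  mention \<open>F1\<close> or \<open>F2\<close>.\<close>

lemma card_of_Ext1_ge: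
  assumes h: "\<And>i. i \<in> I \<Longrightarrow> h i \<in> module_hom R (F0\<lparr>carrier := Z0\<rparr>) N"
    and dist: "\<And>i j g. \<lbrakk>i \<in> I; j \<in> I; g \<in> module_hom R F0 N;
      \<And>z. z \<in> Z0 \<Longrightarrow> h i z = g z \<oplus>\<^bsub>N\<^esub> h j z\<rbrakk> \<Longrightarrow> i = j"
  shows "|I| \<le>o |carrier (Ext1 \<eta> R M N)|"
proof (rule card_of_ordLeqI)
  let ?V = "(hom_space \<eta> R F1 N)\<lparr>carrier := cocycles\<rparr>"
  let ?H = "\<lambda>i. \<lambda>x\<in>carrier F1. h i (d1 x)"
  show "coboundaries +>\<^bsub>?V\<^esub> ?H i \<in> carrier (Ext1 \<eta> R M N)" if "i \<in> I" for i
    unfolding Ext1_carrier by (rule imageI, rule cocycleI[OF h[OF that]])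
  show "inj_on (\<lambda>i. coboundaries +>\<^bsub>?V\<^esub> ?H i) I"
  proof (rule inj_onI)
    fix i j assume i: "i \<in> I" and j: "j \<in> I"
      and c: "coboundaries +>\<^bsub>?V\<^esub> ?H i = coboundaries +>\<^bsub>?V\<^esub> ?H j"
    obtain b where b: "b \<in> coboundaries" and eq: "?H i = b \<oplus>\<^bsub>hom_space \<eta> R F1 N\<^esub> ?H j"
      using Ext1_coset_eq[OF cocycleI[OF h[OF i]] cocycleI[OF h[OF j]] c] by (elim bexE)
    from b obtain g where g: "g \<in> carrier (hom_space \<eta> R F0 N)" and b': "b = compose (carrier F1) g d1"
      by (rule imageE)
    have "h i z = g z \<oplus>\<^bsub>N\<^esub> h j z" if z: "z \<in> Z0" for z
      using fun_cong[OF eq, of "unit_vec R z"] R.unit_vec_free[OF z]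
      by (simp add: b' compose_def d1_unit_vec[OF z])
    then show "i = j" using g by (intro dist[OF i j]) simp_all
  qed
qed

end

section \<open>The path coalgebra of the quiver\<close>

definition path_a :: "(two_vertices, nat) qpath" where
  "path_a = (vertex_a, [], vertex_a)"

definition path_b :: "(two_vertices, nat) qpath" where
  "path_b = (vertex_b, [], vertex_b)"

definition path_x :: "nat \<Rightarrow> (two_vertices, nat) qpath" where
  "path_x n = (vertex_a, [n], vertex_b)"

definition composable :: "(two_vertices, nat) qpath \<Rightarrow> (two_vertices, nat) qpath \<Rightarrow> bool" where
  "composable p q \<longleftrightarrow> p \<in> paths quiver_ab \<and> q \<in> paths quiver_ab \<and> path_target p = path_source q"

lemmas path_defs = path_a_def path_b_def path_x_def

text \<open>Every arrow leads from a to b, so no two arrows can be composed and no path has length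
  above one.\<close>

lemma paths_quiver_ab: "paths quiver_ab = {path_a, path_b} \<union> path_x ` {1..}"
proof -
  have "pre_digraph.cas quiver_ab u es v \<longleftrightarrow>
      (es = [] \<and> u = v) \<or> (\<exists>n. es = [n] \<and> u = vertex_a \<and> v = vertex_b)" for u es v
  proof (cases es)
    case (Cons e es')
    then show ?thesis
      by (cases es') (auto simp: pre_digraph.cas.simps quiver_ab_def)
  qed (auto simp: pre_digraph.cas.simps)
  then show ?thesis
    by (auto simp: paths_def pre_digraph.awalk_def path_defs quiver_ab_def image_iff)
qed

lemma path_distinct [simp]:
  "path_a \<noteq> path_b" "path_b \<noteq> path_a" "path_a \<noteq> path_x n" "path_x n \<noteq> path_a"
  "path_b \<noteq> path_x n" "path_x n \<noteq> path_b" "path_x m = path_x n \<longleftrightarrow> m = n"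
  by (auto simp: path_defs)

lemma path_mem [simp]:
  "path_a \<in> paths quiver_ab" "path_b \<in> paths quiver_ab" "path_x n \<in> paths quiver_ab \<longleftrightarrow> 1 \<le> n"
  by (auto simp: paths_quiver_ab)

lemma path_simps [simp]:
  "path_concat path_a path_a = path_a" "path_concat path_b path_b = path_b"
  "path_concat path_a (path_x n) = path_x n" "path_concat (path_x n) path_b = path_x n"
  "path_length path_a = 0" "path_length path_b = 0" "path_length (path_x n) = 1"
  "path_source path_a = vertex_a" "path_source path_b = vertex_b" "path_source (path_x n) = vertex_a"
  "path_target path_a = vertex_a" "path_target path_b = vertex_b" "path_target (path_x n) = vertex_b"
  by (auto simp: path_defs path_concat_def path_source_def path_target_def path_length_def)

lemma paths_cases [consumes 1, case_names a b x]:
  assumes "p \<in> paths quiver_ab"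
  obtains "p = path_a" | "p = path_b" | n where "1 \<le> n" "p = path_x n"
  using assms by (auto simp: paths_quiver_ab)

lemma composable_iff:
  "composable p q \<longleftrightarrow> (p = path_a \<and> q = path_a) \<or> (p = path_b \<and> q = path_b) \<or>
    (\<exists>n\<ge>1. p = path_a \<and> q = path_x n) \<or> (\<exists>n\<ge>1. p = path_x n \<and> q = path_b)"
  unfolding composable_def paths_quiver_ab by auto

lemma composable_simps [simp]:
  "composable path_a q \<longleftrightarrow> q = path_a \<or> (\<exists>n\<ge>1. q = path_x n)"
  "composable path_b q \<longleftrightarrow> q = path_b"
  "composable (path_x n) q \<longleftrightarrow> 1 \<le> n \<and> q = path_b"
  "composable p path_a \<longleftrightarrow> p = path_a"
  "composable p path_b \<longleftrightarrow> p = path_b \<or> (\<exists>n\<ge>1. p = path_x n)"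
  "composable p (path_x n) \<longleftrightarrow> 1 \<le> n \<and> p = path_a"
  by (auto simp: composable_iff)

lemma composableE [consumes 1, case_names aa bb ax xb]:
  assumes "composable p q"
  obtains "p = path_a" "q = path_a" | "p = path_b" "q = path_b"
    | n where "1 \<le> n" "p = path_a" "q = path_x n" | n where "1 \<le> n" "p = path_x n" "q = path_b"
  using assms by (auto simp: composable_iff)

lemma factorizations_eq:
  "factorizations quiver_ab r = {(p, q). composable p q \<and> path_concat p q = r}"
  by (auto simp: factorizations_def composable_def)

text \<open>In every factorization of \<open>r\<close> one factor is a vertex, and then the other
  one is \<open>r\<close> itself.\<close>

lemma finite_factorizations: "finite (factorizations quiver_ab r)"
proof (rule finite_subset)
  show "factorizations quiver_ab r \<subseteq>
    {(path_a, path_a), (path_b, path_b), (path_a, r), (r, path_b)}"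
    by (auto simp: factorizations_eq composable_iff)
qed simp

section \<open>Comultiplication and counit in coordinates\<close>

locale path_coalgebra = field K for K :: "('k, 'x) ring_scheme" (structure)
begin

abbreviation "u \<equiv> (unit_vec K :: (two_vertices, nat) qpath \<Rightarrow> _)"
abbreviation "C \<equiv> path_space K quiver_ab"
abbreviation "\<Delta> \<equiv> comult K quiver_ab"

sublocale C: left_module K C
  unfolding path_space_def by (rule left_module_free)

sublocale C: vectorspace K C
proof (rule vectorspace.intro)
  show "Module.module K C"
    by (rule moduleI[OF is_cring C.M.abelian_group_axioms C.smult_closed C.smult_l_distr
          C.smult_r_distr C.smult_assoc C.smult_one])
qed (rule field_axioms)

lemma C_simps [simp]:
  "\<zero>\<^bsub>C\<^esub> = (\<lambda>_. \<zero>)" "c \<oplus>\<^bsub>C\<^esub> d = (\<lambda>p. c p \<oplus> d p)" "k \<odot>\<^bsub>C\<^esub> c = (\<lambda>p. k \<otimes> c p)"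
  by (simp_all add: path_space_def)

lemma C_carrier: "c \<in> carrier C \<longleftrightarrow> (\<forall>p\<in>paths quiver_ab. c p \<in> carrier K) \<and>
    (\<forall>p. p \<notin> paths quiver_ab \<longrightarrow> c p = \<zero>) \<and> finite (supp K c)"
  by (simp add: path_space_def free_module_carrier)

lemma C_mem [simp]: "c \<in> carrier C \<Longrightarrow> c p \<in> carrier K"
  by (simp add: path_space_def)

lemma C_supp: "c \<in> carrier C \<Longrightarrow> finite (supp K c)" "c \<in> carrier C \<Longrightarrow> supp K c \<subseteq> paths quiver_ab"
  by (simp_all add: path_space_def free_module_supp)

lemma u_mem [simp]: "p \<in> paths quiver_ab \<Longrightarrow> u p \<in> carrier C"
  by (simp add: path_space_def unit_vec_free)

lemma u_apply: "u p q = (if q = p then \<one> else \<zero>)" by (simp add: unit_vec_def)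

lemma u_carrier [simp]: "u p q \<in> carrier K" by (simp add: unit_vec_def)

lemma tensor_mem:
  assumes "p \<in> paths quiver_ab" and "q \<in> paths quiver_ab"
  shows "tensor C (u p) (u q) \<in> carrier (tensor_space C quiver_ab)"
proof -
  have "supp C (tensor C (u p) (u q)) \<subseteq> {q}"
    using assms by (auto simp: supp_def tensor_def u_apply)
  then show ?thesis
    using assms C.smult_closed[OF u_carrier u_mem] finite_subset[of _ "{q}"]
    by (auto simp: tensor_space_def copower_carrier tensor_def u_apply fun_eq_iff)
qed

text \<open>A composable pair is a factorization of exactly one path, so in the double sum that
  defines \<open>\<Delta> c\<close> the coefficient of p \<otimes> q collapses to the coefficient of
  \<open>c\<close> at the concatenation. The right tensor factor is the first index. All later
  computations with \<open>\<Delta>\<close> use this formula.\<close>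

lemma comult_mem: "c \<in> carrier C \<Longrightarrow> \<Delta> c \<in> carrier (tensor_space C quiver_ab)"
  and comult_apply: "c \<in> carrier C \<Longrightarrow> \<Delta> c q p =
    (if composable p q then c (path_concat p q) else \<zero>)"
proof -
  assume c: "c \<in> carrier C"
  let ?CC = "tensor_space C quiver_ab"
  interpret CC: left_module K ?CC
    unfolding tensor_space_def by (rule C.left_module_copower)
  have mem: "(\<lambda>f. tensor C (u (fst f)) (u (snd f))) \<in> factorizations quiver_ab r \<rightarrow> carrier ?CC" for r
    by (intro Pi_I tensor_mem) (auto simp: factorizations_def)
  \<comment> \<open>\<open>D r\<close> is the comultiplication of the single path
    \<open>r\<close>.\<close>
  define D where "D r = (\<Oplus>\<^bsub>?CC\<^esub>f\<in>factorizations quiver_ab r. tensor C (u (fst f)) (u (snd f)))" for r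
  have D: "D r \<in> carrier ?CC" for r
    unfolding D_def using mem by (rule CC.M.finsum_closed)
  have eval: "(\<Oplus>\<^bsub>?CC\<^esub>i\<in>A. f i) q p = (\<Oplus>i\<in>A. f i q p)"
    if "f \<in> A \<rightarrow> carrier ?CC" for f :: "'i \<Rightarrow> _" and A q p
  proof -
    have f: "f \<in> A \<rightarrow> carrier (copower C (paths quiver_ab))"
      using that by (simp only: tensor_space_def)
    then have "(\<lambda>i. f i q) \<in> A \<rightarrow> carrier (free_module K (paths quiver_ab))"
      using C.copower_mem[OF funcset_mem[OF f]] unfolding path_space_def by (intro Pi_I)
    from finsum_free_module[OF this, of p] C.finsum_copower[OF f, of q] show ?thesis
      by (simp only: tensor_space_def path_space_def)
  qed
  have Dapp: "D r q p = (if (p, q) \<in> factorizations quiver_ab r then \<one> else \<zero>)" for r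
  proof -
    have "D r q p = (\<Oplus>f\<in>factorizations quiver_ab r. if f = (p, q) then \<one> else \<zero>)"
      unfolding D_def eval[OF mem]
      by (intro add.finprod_cong') (auto simp: tensor_def u_apply)
    also have "\<dots> = (if (p, q) \<in> factorizations quiver_ab r then \<one> else \<zero>)"
    proof (cases "(p, q) \<in> factorizations quiver_ab r")
      case True
      then show ?thesis
        using finsum_single[OF abelian_monoid_axioms finite_factorizations,
            of "\<lambda>f. if f = (p, q) then \<one> else \<zero>" "(p, q)" r] by simp
    next
      case False
      then have "(\<Oplus>f\<in>factorizations quiver_ab r. if f = (p, q) then \<one> else \<zero>) =
          (\<Oplus>f\<in>factorizations quiver_ab r. \<zero>)"
        by (intro add.finprod_cong') auto
      with False show ?thesis by simp
    qed
    finally show ?thesis .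
  qed
  have eq: "\<Delta> c = (\<Oplus>\<^bsub>?CC\<^esub>r\<in>supp K c. c r \<odot>\<^bsub>?CC\<^esub> D r)"
    by (simp only: comult_def Let_def D_def)
  have mem': "(\<lambda>r. c r \<odot>\<^bsub>?CC\<^esub> D r) \<in> supp K c \<rightarrow> carrier ?CC"
    using c D by auto
  show "\<Delta> c \<in> carrier ?CC" unfolding eq using mem' by (rule CC.M.finsum_closed)
  have "\<Delta> c q p = (\<Oplus>r\<in>supp K c. c r \<otimes> D r q p)"
    unfolding eq eval[OF mem'] by (simp add: tensor_space_def)
  also have "\<dots> = (if composable p q then c (path_concat p q) else \<zero>)"
  proof (cases "composable p q")
    case True
    have "(\<Oplus>r\<in>supp K c. c r \<otimes> D r q p) = c (path_concat p q) \<otimes> D (path_concat p q) q p"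
      using c C_supp[OF c]
      by (intro finsum_single[OF abelian_monoid_axioms])
        (auto simp: Dapp factorizations_eq supp_def)
    with True c show ?thesis by (simp add: Dapp factorizations_eq)
  next
    case False
    then have "(\<Oplus>r\<in>supp K c. c r \<otimes> D r q p) = (\<Oplus>r\<in>supp K c. \<zero>)"
      using c by (intro add.finprod_cong') (auto simp: Dapp factorizations_eq)
    with False show ?thesis by simp
  qed
  finally show "\<Delta> c q p = (if composable p q then c (path_concat p q) else \<zero>)" .
qed

lemma comult_mem_C: "c \<in> carrier C \<Longrightarrow> \<Delta> c q \<in> carrier C"
  by (rule C.copower_mem[OF comult_mem[unfolded tensor_space_def]])

lemma supp_comult: "c \<in> carrier C \<Longrightarrow> finite (supp C (\<Delta> c)) \<and> supp C (\<Delta> c) \<subseteq> paths quiver_ab"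
  by (rule C.copower_supp[OF comult_mem[unfolded tensor_space_def]])

lemma counit_eq: "counit K = free_lift K (regular_module K) (\<lambda>r. if path_length r = 0 then \<one> else \<zero>)"
  by (auto simp: counit_def free_lift_def fun_eq_iff)

lemma regular: "left_module K (regular_module K)"
  by (rule left_module_regular[OF ring_axioms])

lemma counit_hom: "counit K \<in> module_hom K C (regular_module K)"
  unfolding counit_eq path_space_def by (rule left_module.free_lift_hom[OF regular]) auto

lemma counit_u: "counit K (u p) = (if path_length p = 0 then \<one> else \<zero>)"
  unfolding counit_eq by (subst left_module.free_lift_unit_vec[OF regular]) auto

text \<open>This is the span of the paths in \<open>P\<close>, expressed as a vanishing condition so
  that membership can be tested coordinate by coordinate; \<open>span_unit_vecs\<close> proves the
  agreement.\<close>

definition Csub :: "(two_vertices, nat) qpath set \<Rightarrow> ((two_vertices, nat) qpath \<Rightarrow> 'k) set" where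
  "Csub P = {c \<in> carrier C. \<forall>p. p \<notin> P \<longrightarrow> c p = \<zero>}"

lemma Csub_zero: "(\<lambda>_. \<zero>) \<in> Csub P"
  using C.M.zero_closed by (simp add: Csub_def)

lemma Csub_add: "\<lbrakk>c \<in> Csub P; d \<in> Csub P\<rbrakk> \<Longrightarrow> (\<lambda>p. c p \<oplus> d p) \<in> Csub P"
  using C.M.a_closed[of c d] by (simp add: Csub_def)

lemma Csub_smult: "\<lbrakk>k \<in> carrier K; c \<in> Csub P\<rbrakk> \<Longrightarrow> (\<lambda>p. k \<otimes> c p) \<in> Csub P"
  using C.smult_closed[of k c] by (simp add: Csub_def)

lemmas Csub_closed = Csub_zero Csub_add Csub_smult

lemma u_Csub: "p \<in> P \<Longrightarrow> P \<subseteq> paths quiver_ab \<Longrightarrow> u p \<in> Csub P"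
  by (auto simp: Csub_def u_apply)

end

section \<open>Subspaces spanned by sets of paths\<close>

lemma vectorspace_cong:
  assumes "vectorspace K W" and "carrier V = carrier W" and "\<zero>\<^bsub>V\<^esub> = \<zero>\<^bsub>W\<^esub>"
    and "add V = add W" and "smult V = smult W"
  shows "vectorspace K V"
proof -
  interpret W: vectorspace K W by fact
  show ?thesis
  proof (rule vs_criteria)
    show "\<forall>v\<in>carrier V. \<exists>w\<in>carrier V. v \<oplus>\<^bsub>V\<^esub> w = \<zero>\<^bsub>V\<^esub>"
      using W.M.r_neg W.M.a_inv_closed unfolding assms(2-) by (intro ballI bexI)
  qed (simp_all add: assms(2-) W.field_axioms W.M.a_ac W.smult_assoc1 W.smult_l_distr W.smult_r_distr)
qed

text \<open>The record \<open>V\<close> is a parameter because finite sums in a subspace depend on its carrier.\<close>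

locale path_subspace = path_coalgebra K for K :: "('k, 'x) ring_scheme" (structure) +
  fixes V :: "('k, (two_vertices, nat) qpath \<Rightarrow> 'k, 'y) module_scheme" and P
  assumes P_paths: "P \<subseteq> paths quiver_ab" and V_carrier: "carrier V = path_coalgebra.Csub K P"
    and V_zero [simp]: "\<zero>\<^bsub>V\<^esub> = (\<lambda>_. \<zero>)"
    and V_add [simp]: "\<And>c d. c \<oplus>\<^bsub>V\<^esub> d = (\<lambda>p. c p \<oplus> d p)"
    and V_smult [simp]: "\<And>k c. k \<odot>\<^bsub>V\<^esub> c = (\<lambda>p. k \<otimes> c p)"
begin

lemma V_mem: "c \<in> carrier V \<Longrightarrow> c \<in> carrier C"
  by (simp add: V_carrier Csub_def)

sublocale V: vectorspace K V
proof -
  have "vectorspace K (C\<lparr>carrier := Csub P\<rparr>)"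
    using Csub_closed by (intro vectorspace_subset C.vectorspace_axioms) (auto simp: Csub_def)
  then show "vectorspace K V"
    by (rule vectorspace_cong) (simp_all add: V_carrier fun_eq_iff)
qed

lemma finsum_V:
  assumes "f \<in> A \<rightarrow> carrier V"
  shows "(\<Oplus>\<^bsub>V\<^esub>i\<in>A. f i) p = (\<Oplus>i\<in>A. f i p)"
  by (rule finsum_hom[where h = "\<lambda>c. c p", OF V.M.abelian_monoid_axioms abelian_monoid_axioms assms])
    (simp_all add: V_mem)

lemma span_unit_vecs:
  assumes P': "P' \<subseteq> P"
  shows "V.span (u ` P') = Csub P'"
proof
  have sub: "u ` P' \<subseteq> carrier V" using P' P_paths u_Csub by (auto simp: V_carrier)
  have "LinearCombinations.submodule K (Csub P') V"
  proof (rule LinearCombinations.submodule.intro)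
    show "Module.module K V" by (rule vectorspace.axioms(1)[OF V.vectorspace_axioms])
    show "Csub P' \<subseteq> carrier V" using P' unfolding V_carrier Csub_def by blast
  qed (simp_all add: Csub_closed)
  then show "V.span (u ` P') \<subseteq> Csub P'"
    using P' P_paths by (intro V.span_is_subset) (auto intro!: u_Csub)
  show "Csub P' \<subseteq> V.span (u ` P')"
  proof
    fix c assume c: "c \<in> Csub P'"
    then have cC: "c \<in> carrier C" by (simp add: Csub_def)
    have supp: "supp K c \<subseteq> P'" using c by (auto simp: Csub_def supp_def)
    \<comment> \<open>The expansion of \<open>c\<close> is summed in the record of the span itself,
      whose closure under finite sums then yields membership.\<close>
    interpret S: vectorspace K "V\<lparr>carrier := V.span (u ` P')\<rparr>"
      by (rule V.subspace_is_vs[OF V.span_is_subspace[OF sub]])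
    let ?W = "V\<lparr>carrier := V.span (u ` P')\<rparr>"
    have m: "(\<lambda>p. c p \<odot>\<^bsub>V\<^esub> u p) \<in> supp K c \<rightarrow> carrier ?W"
    proof
      fix p assume "p \<in> supp K c"
      then have "u p \<in> V.span (u ` P')" using supp by (intro V.span_mem[OF sub]) blast
      then show "c p \<odot>\<^bsub>V\<^esub> u p \<in> carrier ?W"
        using S.smult_closed[OF C_mem[OF cC], of "u p" p] by simp
    qed
    have "c q = (\<Oplus>\<^bsub>?W\<^esub>p\<in>supp K c. c p \<odot>\<^bsub>V\<^esub> u p) q" for q
    proof -
      have "(\<Oplus>\<^bsub>?W\<^esub>p\<in>supp K c. c p \<odot>\<^bsub>V\<^esub> u p) q = (\<Oplus>p\<in>supp K c. (c p \<odot>\<^bsub>V\<^esub> u p) q)"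
      proof (rule finsum_hom[where h = "\<lambda>c. c q", OF S.M.abelian_monoid_axioms abelian_monoid_axioms m])
        fix d assume "d \<in> carrier ?W"
        then show "d q \<in> carrier K" using V.span_closed[OF sub, of d] by (simp add: V_mem)
      qed simp_all
      also have "\<dots> = (c q \<odot>\<^bsub>V\<^esub> u q) q"
        using cC C_supp[OF cC]
        by (intro finsum_single[OF abelian_monoid_axioms]) (auto simp: u_apply supp_def)
      also have "\<dots> = c q" using cC by (simp add: u_apply)
      finally show ?thesis by simp
    qed
    then have "(\<Oplus>\<^bsub>?W\<^esub>p\<in>supp K c. c p \<odot>\<^bsub>V\<^esub> u p) = c" by (rule ext[OF sym])
    with S.M.finsum_closed[OF m] have "c \<in> carrier ?W" by (simp only:)
    then show "c \<in> V.span (u ` P')" by simp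
  qed
qed

lemma basis_unit_vecs: "V.basis (u ` P)"
proof -
  have sub: "u ` P \<subseteq> carrier V" using P_paths u_Csub by (auto simp: V_carrier)
  have "V.lin_indpt (u ` P)"
  proof
    assume "V.lin_dep (u ` P)"
    then obtain A a v where A: "finite A" "A \<subseteq> u ` P" "a \<in> A \<rightarrow> carrier K"
      "V.lincomb a A = \<zero>\<^bsub>V\<^esub>" "v \<in> A" "a v \<noteq> \<zero>"
      unfolding V.lin_dep_def by (elim exE conjE)
    from A(2,5) obtain p where p: "p \<in> P" "v = u p" by blast
    have AV: "A \<subseteq> carrier V" using A(2) sub by blast
    have av: "a v \<in> carrier K" using A(3,5) by (rule funcset_mem)
    have mem: "(\<lambda>w. a w \<odot>\<^bsub>V\<^esub> w) \<in> A \<rightarrow> carrier V"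
      using AV funcset_mem[OF A(3)] by (intro Pi_I V.smult_closed) auto
    have e1: "V.lincomb a A p = (\<Oplus>w\<in>A. (a w \<odot>\<^bsub>V\<^esub> w) p)"
      unfolding V.lincomb_def by (rule finsum_V[OF mem])
    have e2: "(\<Oplus>w\<in>A. (a w \<odot>\<^bsub>V\<^esub> w) p) = (a v \<odot>\<^bsub>V\<^esub> v) p"
    proof (rule finsum_single[OF abelian_monoid_axioms A(1), of "\<lambda>w. (a w \<odot>\<^bsub>V\<^esub> w) p"])
      show "(a v \<odot>\<^bsub>V\<^esub> v) p \<in> carrier K" using av p by simp
      show "(a w \<odot>\<^bsub>V\<^esub> w) p = \<zero>" if w: "w \<in> A" "w \<noteq> v" for w
      proof -
        obtain q where "w = u q" using w A(2) by blast
        with w p have "w p = \<zero>" by (auto simp: u_apply)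
        then show ?thesis using funcset_mem[OF A(3) w(1)] by simp
      qed
    qed (use A(5) in simp)
    have e3: "(a v \<odot>\<^bsub>V\<^esub> v) p = a v" using av unfolding p(2) by (simp add: u_apply)
    have "V.lincomb a A p = \<zero>" unfolding A(4) by simp
    then have "a v = \<zero>" by (rule trans[OF sym[OF trans[OF e1 trans[OF e2 e3]]]])
    with A(6) show False by (rule notE)
  qed
  then show ?thesis using sub span_unit_vecs[of P] by (simp add: V.basis_def V_carrier)
qed

end

section \<open>Comodules and the injective hull\<close>

lemma (in vectorspace) hom_eq_on_basis:
  assumes "basis B" and N: "left_module K N"
    and g: "g \<in> module_hom K V N" and h: "h \<in> module_hom K V N"
    and eq: "\<And>b. b \<in> B \<Longrightarrow> g b = h b" and v: "v \<in> carrier V"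
  shows "g v = h v"
proof -
  let ?l = "free_lift K V (\<lambda>x. x)"
  interpret L: left_module K V by (rule is_left_module)
  have B: "B \<subseteq> carrier V" using assms(1) by (simp add: basis_def)
  have l: "?l \<in> module_hom K (free_module K B) V" using B by (intro L.free_lift_hom) auto
  have "v \<in> ?l ` carrier (free_module K B)"
    using v bij_betw_imp_surj_on[OF basis_coordinates[OF assms(1)]] by simp
  then obtain f where f: "f \<in> carrier (free_module K B)" "v = ?l f" by (elim imageE)
  have "g (?l f) = h (?l f)"
  proof (rule left_module.free_hom_eqI[OF N module_hom_comp[OF l g] module_hom_comp[OF l h] _ f(1)])
    fix b assume "b \<in> B"
    then show "g (?l (unit_vec K b)) = h (?l (unit_vec K b))"
      using B eq L.free_lift_unit_vec[of "\<lambda>x. x" b] by auto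
  qed
  then show ?thesis by (simp add: f(2))
qed

text \<open>A basis of the image of \<open>j\<close> is extended to a basis of \<open>N\<close>; on
  the image the functional is \<open>\<phi>\<close> transported along the inverse of
  \<open>j\<close>. Injectivity of E as a comodule rests on this.\<close>

lemma functional_extension:
  assumes M: "vectorspace K M" and N: "vectorspace K N" and j: "j \<in> module_hom K M N"
    and inj: "inj_on j (carrier M)" and \<phi>: "\<phi> \<in> module_hom K M (regular_module K)"
  shows "\<exists>L \<in> module_hom K N (regular_module K). \<forall>x\<in>carrier M. L (j x) = \<phi> x"
proof -
  interpret M: vectorspace K M by fact
  interpret N: vectorspace K N by fact
  let ?W = "j ` carrier M"
  let ?N = "N\<lparr>carrier := ?W\<rparr>"
  have W: "?W \<subseteq> carrier N" using module_hom_mem[OF j] by blast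
  have sub: "LinearCombinations.submodule K ?W N"
  proof (rule LinearCombinations.submodule.intro)
    show "Module.module K N" by (rule vectorspace.axioms(1)[OF N])
    show "\<zero>\<^bsub>N\<^esub> \<in> ?W"
      using module_hom_zero[OF M.M.abelian_group_axioms N.M.abelian_group_axioms j]
        imageI[OF M.M.zero_closed, of j] by simp
    show "v \<oplus>\<^bsub>N\<^esub> w \<in> ?W" if "v \<in> ?W" "w \<in> ?W" for v w
    proof -
      from that obtain x y where "x \<in> carrier M" "y \<in> carrier M" "v = j x" "w = j y" by blast
      then show ?thesis
        using imageI[OF M.M.a_closed, of x y j] LinearCombinations.module_hom_add[OF j] by simp
    qed
    show "k \<odot>\<^bsub>N\<^esub> w \<in> ?W" if "k \<in> carrier K" "w \<in> ?W" for k w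
    proof -
      from that obtain x where "x \<in> carrier M" "w = j x" by blast
      then show ?thesis
        using that imageI[OF M.smult_closed, of k x j] LinearCombinations.module_hom_smult[OF j] by simp
    qed
  qed (rule W)
  interpret W: vectorspace K ?N
    by (rule N.subspace_is_vs) (intro subspace.intro N sub)
  have "W.lin_indpt {}" unfolding W.lin_dep_def by blast
  then obtain B where B: "W.basis B" using W.exists_basis_extending[of "{}"] by blast
  then have BW: "B \<subseteq> ?W" "W.lin_indpt B" by (simp_all add: W.basis_def)
  \<comment> \<open>Independence was obtained inside the image; to be extended, the family must be
    independent in \<open>N\<close>.\<close>
  have "N.lin_indpt B" using BW(2) N.span_li_not_depend(2)[OF BW(1) sub] by simp
  then obtain B' where B': "N.basis B'" "B \<subseteq> B'"
    using N.exists_basis_extending[of B] BW(1) W by blast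
  have bij: "bij_betw j (carrier M) (carrier ?N)" using inj by (simp add: bij_betw_def)
  have j': "j \<in> module_hom K M ?N"
    using j by (simp add: LinearCombinations.module_hom_def)
  let ?k = "inv_into (carrier M) j"
  have k: "?k \<in> module_hom K ?N M"
    by (rule module_hom_inv_into[OF j' bij M.is_left_module])
  \<comment> \<open>Any values on the added basis vectors would do; zero is chosen.\<close>
  define \<psi> where "\<psi> b = (if b \<in> B then \<phi> (?k b) else \<zero>\<^bsub>K\<^esub>)" for b
  have "\<psi> \<in> B' \<rightarrow> carrier K"
    using BW(1) module_hom_mem[OF module_hom_comp[OF k \<phi>]] by (auto simp: \<psi>_def)
  then obtain L where L: "L \<in> module_hom K N (regular_module K)" "\<forall>b\<in>B'. L b = \<psi> b"
    using N.linear_extension[OF B'(1)] by blast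
  have L': "L \<in> module_hom K ?N (regular_module K)"
  proof (rule module_homI)
    fix x y assume "x \<in> carrier ?N" "y \<in> carrier ?N"
    then have "x \<in> carrier N" "y \<in> carrier N" using W by auto
    then show "L (x \<oplus>\<^bsub>?N\<^esub> y) = L x \<oplus>\<^bsub>regular_module K\<^esub> L y"
      using LinearCombinations.module_hom_add[OF L(1)] by simp
  next
    fix k x assume k: "k \<in> carrier K" and "x \<in> carrier ?N"
    then have "x \<in> carrier N" using W by auto
    then show "L (k \<odot>\<^bsub>?N\<^esub> x) = k \<odot>\<^bsub>regular_module K\<^esub> L x"
      using k LinearCombinations.module_hom_smult[OF L(1)] by simp
  next
    fix x assume "x \<in> carrier ?N"
    then have "x \<in> carrier N" using W by auto
    then show "L x \<in> carrier (regular_module K)" by (rule module_hom_mem[OF L(1)])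
  qed
  have "L w = \<phi> (?k w)" if "w \<in> ?W" for w
  proof (rule W.hom_eq_on_basis[OF B left_module_regular[OF M.ring_axioms] L' module_hom_comp[OF k \<phi>]])
    show "L b = \<phi> (?k b)" if "b \<in> B" for b using L(2) B'(2) that by (auto simp: \<psi>_def)
    show "w \<in> carrier ?N" using that by simp
  qed
  then have "L (j x) = \<phi> x" if "x \<in> carrier M" for x
    using that inv_into_f_f[OF inj that] by simp
  with L(1) show ?thesis by blast
qed

section \<open>Subcomodules spanned by prefix-closed sets of paths\<close>

lemma composable_assoc:
  "composable s p \<and> composable (path_concat s p) r \<longleftrightarrow> composable p r \<and> composable s (path_concat p r)"
proof (cases "composable p r")
  case True
  then show ?thesis by (cases rule: composableE) auto
next
  case False
  show ?thesis
  proof (cases "composable s p")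
    case True
    from True False show ?thesis by (cases rule: composableE) auto
  qed (use False in simp)
qed

lemma path_concat_assoc:
  "path_concat (path_concat s p) r = path_concat s (path_concat p r)"
  by (simp add: path_concat_def path_source_def path_target_def)

text \<open>A right coaction splits off the final factor of a path and leaves the initial factor in
  the comodule. The span of \<open>P\<close> is therefore stable as soon as \<open>P\<close>
  contains all initial factors of its members.\<close>

definition prefix_closed :: "(two_vertices, nat) qpath set \<Rightarrow> bool" where
  "prefix_closed P \<longleftrightarrow> P \<subseteq> paths quiver_ab \<and>
    (\<forall>p q. composable p q \<longrightarrow> path_concat p q \<in> P \<longrightarrow> p \<in> P)"

definition paths_from_a :: "(two_vertices, nat) qpath set" where
  "paths_from_a = {path_a} \<union> path_x ` {1..}"

lemma prefix_closed_a: "prefix_closed {path_a}"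
  and prefix_closed_b: "prefix_closed {path_b}"
  and prefix_closed_from_a: "prefix_closed paths_from_a"
  unfolding prefix_closed_def paths_from_a_def by (auto simp: composable_iff)

lemma paths_from_a_concat:
  "composable p q \<Longrightarrow> path_concat p q \<in> paths_from_a \<longleftrightarrow> p \<in> paths_from_a"
  by (auto simp: composable_iff paths_from_a_def)

definition (in path_coalgebra) comod ::
    "(two_vertices, nat) qpath set \<Rightarrow>
      ('k, (two_vertices, nat) qpath \<Rightarrow> 'k, (two_vertices, nat) qpath) comodule" where
  "comod P = (regular_comodule K quiver_ab)\<lparr>carrier := Csub P\<rparr>"

context path_coalgebra
begin

lemma comod_simps [simp]:
  "carrier (comod P) = Csub P" "\<zero>\<^bsub>comod P\<^esub> = (\<lambda>_. \<zero>)"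
  "c \<oplus>\<^bsub>comod P\<^esub> d = (\<lambda>p. c p \<oplus> d p)" "k \<odot>\<^bsub>comod P\<^esub> c = (\<lambda>p. k \<otimes> c p)"
  "coact (comod P) = \<Delta>"
  by (simp_all add: comod_def regular_comodule_def Let_def)

lemma path_subspace_comod:
  assumes "P \<subseteq> paths quiver_ab"
  shows "path_subspace K (comod P) P"
  by unfold_locales (simp_all add: assms)

text \<open>Coassociativity in coordinates: in the sum over \<open>q\<close> only the concatenation
  of \<open>p\<close> and \<open>r\<close> has a nonzero coefficient.\<close>

lemma comodule_coact_coact:
  assumes M: "right_comodule K quiver_ab M" and m: "m \<in> carrier M"
  shows "coact M (coact M m r) p = (if composable p r then coact M m (path_concat p r) else \<zero>\<^bsub>M\<^esub>)"
proof -
  note M' = M[unfolded right_comodule_def]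
  note V = M'[THEN conjunct1] and hom = M'[THEN conjunct2, THEN conjunct1]
    and coassoc = M'[THEN conjunct2, THEN conjunct2, THEN conjunct1, THEN bspec, OF m]
  interpret V: vectorspace K M by fact
  interpret V: left_module K M by (rule V.is_left_module)
  have t: "coact M m \<in> carrier (copower M (paths quiver_ab))"
    using module_hom_mem[OF hom m] by (simp add: tensor_space_def)
  note supp = V.copower_supp[OF t]
  have mem: "coact M m q \<in> carrier M" for q by (rule V.copower_mem[OF t])
  have \<Delta>: "\<Delta> (u q) r p = (if composable p r then u q (path_concat p r) else \<zero>)"
    if "q \<in> supp M (coact M m)" for q
    using that supp by (intro comult_apply u_mem) blast
  let ?i = "path_concat p r"
  have "coact M (coact M m r) p =
      (\<Oplus>\<^bsub>M\<^esub>q\<in>supp M (coact M m). \<Delta> (u q) r p \<odot>\<^bsub>M\<^esub> coact M m q)"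
    using coassoc by (elim allE)
  also have "\<dots> = (\<Oplus>\<^bsub>M\<^esub>q\<in>supp M (coact M m).
      (if composable p r then u q ?i else \<zero>) \<odot>\<^bsub>M\<^esub> coact M m q)"
    using mem by (intro V.M.finsum_cong') (auto simp: \<Delta>)
  also have "\<dots> = (if composable p r then coact M m ?i else \<zero>\<^bsub>M\<^esub>)"
  proof (cases "composable p r")
    case True
    have "(\<Oplus>\<^bsub>M\<^esub>q\<in>supp M (coact M m). u q ?i \<odot>\<^bsub>M\<^esub> coact M m q) = u ?i ?i \<odot>\<^bsub>M\<^esub> coact M m ?i"
      using supp mem
      by (intro finsum_single[OF V.M.abelian_monoid_axioms]) (auto simp: u_apply supp_def)
    with True mem show ?thesis by (simp add: u_apply)
  next
    case False
    then have "(\<Oplus>\<^bsub>M\<^esub>q\<in>supp M (coact M m). \<zero> \<odot>\<^bsub>M\<^esub> coact M m q) = (\<Oplus>\<^bsub>M\<^esub>q\<in>supp M (coact M m). \<zero>\<^bsub>M\<^esub>)"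
      using mem by (intro V.M.finsum_cong') auto
    with False show ?thesis by simp
  qed
  finally show ?thesis .
qed

end

locale path_comodule = path_coalgebra K for K :: "('k, 'x) ring_scheme" (structure) +
  fixes P assumes prefix_closed: "prefix_closed P"
begin

lemma P_paths: "P \<subseteq> paths quiver_ab"
  using prefix_closed by (simp add: prefix_closed_def)

sublocale sub: path_subspace K "comod P" P
  by (rule path_subspace_comod[OF P_paths])

sublocale left: left_module K "comod P"
  by (rule sub.V.is_left_module)

lemma Csub_C: "c \<in> Csub P \<Longrightarrow> c \<in> carrier C" by (simp add: Csub_def)

lemma comult_Csub:
  assumes c: "c \<in> Csub P"
  shows "\<Delta> c q \<in> Csub P"
proof -
  have "\<Delta> c q p = \<zero>" if "p \<notin> P" for p
  proof (cases "composable p q")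
    case True
    then have "path_concat p q \<notin> P" using that prefix_closed unfolding prefix_closed_def by blast
    then have "c (path_concat p q) = \<zero>" using c unfolding Csub_def by blast
    then show ?thesis by (simp add: comult_apply[OF Csub_C[OF c]])
  qed (simp add: comult_apply[OF Csub_C[OF c]])
  then show ?thesis using comult_mem_C[OF Csub_C[OF c]] by (simp add: Csub_def)
qed

lemma comult_tensor:
  assumes c: "c \<in> Csub P"
  shows "\<Delta> c \<in> carrier (tensor_space (comod P) quiver_ab)"
proof -
  have "supp (comod P) (\<Delta> c) = supp C (\<Delta> c)" by (simp add: supp_def)
  moreover have "\<Delta> c q = (\<lambda>_. \<zero>)" if "q \<notin> paths quiver_ab" for q
    using that by (intro ext) (simp add: comult_apply[OF Csub_C[OF c]] composable_def)
  ultimately show ?thesis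
    using supp_comult[OF Csub_C[OF c]] comult_Csub[OF c]
    by (simp add: tensor_space_def copower_carrier)
qed

lemma supp_comult_P:
  assumes "c \<in> Csub P"
  shows "finite (supp (comod P) (\<Delta> c))" and "supp (comod P) (\<Delta> c) \<subseteq> paths quiver_ab"
  using supp_comult[OF Csub_C[OF assms]] by (simp_all add: supp_def)

lemma comult_hom: "\<Delta> \<in> module_hom K (comod P) (tensor_space (comod P) quiver_ab)"
proof (rule module_homI)
  fix c d assume "c \<in> carrier (comod P)" "d \<in> carrier (comod P)"
  then have cd: "c \<in> Csub P" "d \<in> Csub P" by simp_all
  note C = Csub_C[OF cd(1)] Csub_C[OF cd(2)] Csub_C[OF Csub_add[OF cd]]
  show "\<Delta> (c \<oplus>\<^bsub>comod P\<^esub> d) = \<Delta> c \<oplus>\<^bsub>tensor_space (comod P) quiver_ab\<^esub> \<Delta> d"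
    by (simp add: tensor_space_def fun_eq_iff comult_apply C)
next
  fix k c assume "k \<in> carrier K" "c \<in> carrier (comod P)"
  then have kc: "k \<in> carrier K" "c \<in> Csub P" by simp_all
  note C = Csub_C[OF kc(2)] Csub_C[OF Csub_smult[OF kc]]
  show "\<Delta> (k \<odot>\<^bsub>comod P\<^esub> c) = k \<odot>\<^bsub>tensor_space (comod P) quiver_ab\<^esub> \<Delta> c"
    using kc(1) by (simp add: tensor_space_def fun_eq_iff comult_apply C)
qed (simp add: comult_tensor)

lemma right_comodule: "right_comodule K quiver_ab (comod P)"
proof -
  have coassoc: "\<Delta> (\<Delta> m r) p =
      (\<Oplus>\<^bsub>comod P\<^esub>q\<in>supp (comod P) (\<Delta> m). \<Delta> (u q) r p \<odot>\<^bsub>comod P\<^esub> \<Delta> m q)" (is "_ = ?sum")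
    if m: "m \<in> Csub P" for m r p
  proof
    fix s
    let ?S = "supp (comod P) (\<Delta> m)" and ?i = "path_concat p r"
    note supp = supp_comult_P[OF m]
    have \<Delta>u: "\<Delta> (u q) r p = (if composable p r then u q ?i else \<zero>)" if "q \<in> ?S" for q
      using that supp(2) by (intro comult_apply u_mem) blast
    have mem: "\<Delta> m q s \<in> carrier K" for q
      using comult_mem_C[OF Csub_C[OF m]] by simp
    have "?sum s = (\<Oplus>q\<in>?S. (\<Delta> (u q) r p \<odot>\<^bsub>comod P\<^esub> \<Delta> m q) s)"
    proof (rule sub.finsum_V, rule Pi_I)
      fix q assume q: "q \<in> ?S"
      then have "\<Delta> (u q) r p \<in> carrier K" by (simp add: \<Delta>u)
      then show "\<Delta> (u q) r p \<odot>\<^bsub>comod P\<^esub> \<Delta> m q \<in> carrier (comod P)"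
        using comult_Csub[OF m] by (intro left.smult_closed) simp_all
    qed
    also have "\<dots> = (\<Oplus>q\<in>?S. (if composable p r then u q ?i else \<zero>) \<otimes> \<Delta> m q s)"
      using mem by (intro add.finprod_cong') (auto simp: \<Delta>u)
    also have "\<dots> = (if composable p r then \<Delta> m ?i s else \<zero>)"
    proof (cases "composable p r")
      case True
      have "(\<Oplus>q\<in>?S. u q ?i \<otimes> \<Delta> m q s) = u ?i ?i \<otimes> \<Delta> m ?i s"
        using supp mem
        by (intro finsum_single[OF abelian_monoid_axioms]) (auto simp: u_apply supp_def)
      with True mem show ?thesis by (simp add: u_apply)
    next
      case False
      then have "(\<Oplus>q\<in>?S. \<zero> \<otimes> \<Delta> m q s) = (\<Oplus>q\<in>?S. \<zero>)"
        using mem by (intro add.finprod_cong') auto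
      with False show ?thesis by simp
    qed
    \<comment> \<open>Coassociativity is associativity of concatenation, together with the fact that
      both bracketings are composable under the same condition.\<close>
    also have "\<dots> = \<Delta> (\<Delta> m r) p s"
      using composable_assoc[of s p r]
      by (auto simp: comult_apply[OF Csub_C[OF m]] comult_apply[OF comult_mem_C[OF Csub_C[OF m]]]
          path_concat_assoc)
    finally show "\<Delta> (\<Delta> m r) p s = ?sum s" by (rule sym)
  qed
  have counit: "(\<Oplus>\<^bsub>comod P\<^esub>q\<in>supp (comod P) (\<Delta> m). counit K (u q) \<odot>\<^bsub>comod P\<^esub> \<Delta> m q) = m"
    (is "?sum = _") if m: "m \<in> Csub P" for m
  proof
    fix s
    \<comment> \<open>For a path \<open>s\<close>, \<open>?i\<close> is the vertex at which it ends:
      the only path of nonzero counit that can follow \<open>s\<close>. If \<open>s\<close> is not a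
      path, all the coefficients at \<open>s\<close> vanish and the choice is immaterial.\<close>
    let ?S = "supp (comod P) (\<Delta> m)" and ?i = "if s = path_a then path_a else path_b"
    have mem: "\<Delta> m q s \<in> carrier K" for q
      using comult_mem_C[OF Csub_C[OF m]] by simp
    have "?sum s = (\<Oplus>q\<in>?S. (counit K (u q) \<odot>\<^bsub>comod P\<^esub> \<Delta> m q) s)"
    proof (rule sub.finsum_V, rule Pi_I)
      fix q
      show "counit K (u q) \<odot>\<^bsub>comod P\<^esub> \<Delta> m q \<in> carrier (comod P)"
        using comult_Csub[OF m] by (intro left.smult_closed) (simp_all add: counit_u)
    qed
    also have "\<dots> = (counit K (u ?i) \<odot>\<^bsub>comod P\<^esub> \<Delta> m ?i) s"
    proof (rule finsum_single[OF abelian_monoid_axioms supp_comult_P(1)[OF m]])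
      fix q assume q: "q \<in> ?S" "q \<noteq> ?i"
      show "(counit K (u q) \<odot>\<^bsub>comod P\<^esub> \<Delta> m q) s = \<zero>"
      proof (cases "composable s q")
        case True
        then show ?thesis using q mem
          by (cases rule: composableE) (auto simp: counit_u)
      next
        case False
        then show ?thesis by (auto simp: comult_apply[OF Csub_C[OF m]] counit_u)
      qed
    next
      assume "?i \<notin> ?S"
      then have "\<Delta> m ?i = (\<lambda>_. \<zero>)" by (simp add: supp_def)
      then show "(counit K (u ?i) \<odot>\<^bsub>comod P\<^esub> \<Delta> m ?i) s = \<zero>" by (simp add: counit_u)
    qed (use mem in \<open>simp add: counit_u\<close>)
    also have "\<dots> = \<Delta> m ?i s" using mem[of path_a] mem[of path_b]
      by (cases "s = path_a") (simp_all add: counit_u)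
    also have "\<dots> = m s"
    proof (cases "s \<in> paths quiver_ab")
      case True
      then show ?thesis
        by (cases rule: paths_cases) (simp_all add: comult_apply[OF Csub_C[OF m]])
    next
      case False
      then show ?thesis
        using Csub_C[OF m]
        by (simp add: comult_apply[OF Csub_C[OF m]] composable_def C_carrier del: split_paired_All)
    qed
    finally show "?sum s = m s" .
  qed
  show ?thesis
    unfolding right_comodule_def using sub.V.vectorspace_axioms comult_hom coassoc counit by simp
qed

end

section \<open>Simple comodules and the injective hull of S\<close>

context path_coalgebra
begin

text \<open>The comodule is a line: an element \<open>c\<close> with
  \<open>c p \<noteq> \<zero>\<close> reaches every other element after rescaling by the inverse of
  \<open>c p\<close>.\<close>

lemma simple_comodule_comod:
  assumes closed: "prefix_closed {p}"
  shows "simple_comodule K quiver_ab (comod {p})"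
proof -
  interpret path_comodule K "{p}" by unfold_locales (rule closed)
  have p: "p \<in> paths quiver_ab" using P_paths by simp
  have up: "u p \<in> Csub {p}" using P_paths by (intro u_Csub) simp
  have "u p \<noteq> (\<lambda>_. \<zero>)"
  proof
    assume "u p = (\<lambda>_. \<zero>)"
    from fun_cong[OF this, of p] show False by (simp add: u_apply)
  qed
  then have nz: "carrier (comod {p}) \<noteq> {\<zero>\<^bsub>comod {p}\<^esub>}" using up by auto
  have "N = {\<zero>\<^bsub>comod {p}\<^esub>} \<or> N = carrier (comod {p})"
    if "subcomodule K quiver_ab N (comod {p})" for N
  proof (rule disjCI)
    assume N_nz: "N \<noteq> carrier (comod {p})"
    have sub: "N \<subseteq> Csub {p}" and N: "right_comodule K quiver_ab (comod {p}\<lparr>carrier := N\<rparr>)"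
      using that by (simp_all add: subcomodule_def)
    interpret N: vectorspace K "comod {p}\<lparr>carrier := N\<rparr>"
      by (rule N[unfolded right_comodule_def, THEN conjunct1])
    have zero: "(\<lambda>_. \<zero>) \<in> N" using N.M.zero_closed by simp
    have "c = (\<lambda>_. \<zero>)" if c: "c \<in> N" for c
    proof (rule ccontr)
      assume "c \<noteq> (\<lambda>_. \<zero>)"
      moreover have c0: "c q = \<zero>" if "q \<noteq> p" for q
        using c sub that unfolding Csub_def by blast
      ultimately have cp: "c p \<noteq> \<zero>" by (intro notI) (metis ext)
      have cC: "c \<in> carrier C" using c sub Csub_C by blast
      have inv: "inv (c p) \<in> carrier K" "inv (c p) \<otimes> c p = \<one>"
        using cp cC field_Units by (auto simp: Units_inv_closed Units_l_inv)
      have "d \<in> N" if d: "d \<in> Csub {p}" for d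
      proof -
        have dp: "d p \<in> carrier K" using Csub_C[OF d] by simp
        have d0: "d q = \<zero>" if "q \<noteq> p" for q
          using d that unfolding Csub_def by blast
        have "(\<lambda>q. d p \<otimes> inv (c p) \<otimes> c q) \<in> N"
          using N.smult_closed[of "d p \<otimes> inv (c p)" c] dp inv(1) c by simp
        moreover have "d p \<otimes> inv (c p) \<otimes> c q = d q" for q
          using dp inv cC by (cases "q = p") (simp_all add: m_assoc c0 d0)
        ultimately show ?thesis by simp
      qed
      with sub N_nz show False by auto
    qed
    then have "N \<subseteq> {\<lambda>_. \<zero>}" unfolding subset_singleton_iff by blast
    with zero show "N = {\<zero>\<^bsub>comod {p}\<^esub>}" unfolding comod_simps by (intro equalityI) simp_all
  qed
  then show ?thesis
    unfolding simple_comodule_def by (intro conjI right_comodule nz allI impI)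
qed

lemma injective_comodule_from_a: "injective_comodule TYPE('y) TYPE('z) K quiver_ab (comod paths_from_a)"
proof -
  interpret path_comodule K paths_from_a by unfold_locales (rule prefix_closed_from_a)
  have "\<exists>g\<in>comodule_hom K N (comod paths_from_a). \<forall>x\<in>carrier M. g (j x) = f x"
    if M: "right_comodule K quiver_ab M" and N: "right_comodule K quiver_ab N"
      and j: "j \<in> comodule_hom K M N" and inj: "inj_on j (carrier M)"
      and f: "f \<in> comodule_hom K M (comod paths_from_a)"
    for M :: "('k, 'y, (two_vertices, nat) qpath) comodule"
      and N :: "('k, 'z, (two_vertices, nat) qpath) comodule" and j f
  proof -
    note M' = M[unfolded right_comodule_def] and N' = N[unfolded right_comodule_def]
    interpret M: vectorspace K M by (rule M'[THEN conjunct1])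
    interpret N: vectorspace K N by (rule N'[THEN conjunct1])
    interpret N: left_module K N by (rule N.is_left_module)
    have j1: "j \<in> module_hom K M N" and j2: "\<And>x. x \<in> carrier M \<Longrightarrow> coact N (j x) = (\<lambda>q. j (coact M x q))"
      using j by (simp_all add: comodule_hom_def)
    have f1: "f \<in> module_hom K M (comod paths_from_a)"
      and f2: "\<And>x. x \<in> carrier M \<Longrightarrow> \<Delta> (f x) = (\<lambda>q. f (coact M x q))"
      using f by (simp_all add: comodule_hom_def)
    note coactM = N'[THEN conjunct2, THEN conjunct1]
    have cN: "coact N n \<in> carrier (copower N (paths quiver_ab))" if "n \<in> carrier N" for n
      using module_hom_mem[OF N'[THEN conjunct2, THEN conjunct1] that] by (simp add: tensor_space_def)
    have cM: "coact M x q \<in> carrier M" if "x \<in> carrier M" for x q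
      using left_module.copower_mem[OF M.is_left_module, of "coact M x" "paths quiver_ab" q]
        module_hom_mem[OF M'[THEN conjunct2, THEN conjunct1] that] by (simp add: tensor_space_def)
    \<comment> \<open>A comodule map into E is recovered from its coefficient at the vertex a: the
      coefficient of \<open>f x\<close> at a path \<open>q\<close> from a is that of
      \<open>f (coact M x q)\<close> at a, because \<open>q\<close> is a followed by
      \<open>q\<close>. So only this functional has to be extended to \<open>N\<close>, and
      \<open>g\<close> is rebuilt from the extension by the same formula.\<close>
    have \<phi>: "(\<lambda>x. f x path_a) \<in> module_hom K M (regular_module K)"
    proof (rule module_homI)
      show "f x path_a \<in> carrier (regular_module K)" if "x \<in> carrier M" for x
        using module_hom_mem[OF f1 that] Csub_C by simp
    qed (simp_all add: LinearCombinations.module_hom_add[OF f1] LinearCombinations.module_hom_smult[OF f1])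
    obtain L where L: "L \<in> module_hom K N (regular_module K)"
      and Lj: "\<forall>x\<in>carrier M. L (j x) = f x path_a"
      using functional_extension[OF M.vectorspace_axioms N.vectorspace_axioms j1 inj \<phi>] by (elim bexE)
    interpret R: left_module K "regular_module K" by (rule regular)
    have L0: "L \<zero>\<^bsub>N\<^esub> = \<zero>"
      using module_hom_zero[OF N.M.abelian_group_axioms R.M.abelian_group_axioms L] by simp
    have Lmem: "L n \<in> carrier K" if "n \<in> carrier N" for n
      using module_hom_mem[OF L that] by simp
    define g where "g n q = (if q \<in> paths_from_a then L (coact N n q) else \<zero>)" for n q
    have g_mem: "g n \<in> Csub paths_from_a" if n: "n \<in> carrier N" for n
    proof -
      note t = cN[OF n]
      have "supp K (g n) \<subseteq> supp N (coact N n)" by (auto simp: supp_def g_def L0)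
      then have "finite (supp K (g n))" using N.copower_supp[OF t] finite_subset by blast
      moreover have "g n q \<in> carrier K" for q
        using Lmem[OF N.copower_mem[OF t]] by (simp add: g_def)
      moreover have "g n q = \<zero>" if "q \<notin> paths quiver_ab" for q
        using that P_paths by (auto simp: g_def)
      ultimately show ?thesis by (simp add: Csub_def C_carrier g_def del: split_paired_All)
    qed
    have g_hom: "g \<in> module_hom K N (comod paths_from_a)"
    proof (rule module_homI)
      fix n m assume nm: "n \<in> carrier N" "m \<in> carrier N"
      have "coact N (n \<oplus>\<^bsub>N\<^esub> m) = (\<lambda>q. coact N n q \<oplus>\<^bsub>N\<^esub> coact N m q)"
        using LinearCombinations.module_hom_add[OF coactM nm] by (simp add: tensor_space_def)
      then show "g (n \<oplus>\<^bsub>N\<^esub> m) = g n \<oplus>\<^bsub>comod paths_from_a\<^esub> g m"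
        using LinearCombinations.module_hom_add[OF L N.copower_mem[OF cN[OF nm(1)]] N.copower_mem[OF cN[OF nm(2)]]]
        by (intro ext) (simp add: g_def)
    next
      fix k n assume kn: "k \<in> carrier K" "n \<in> carrier N"
      have "coact N (k \<odot>\<^bsub>N\<^esub> n) = (\<lambda>q. k \<odot>\<^bsub>N\<^esub> coact N n q)"
        using LinearCombinations.module_hom_smult[OF coactM kn] by (simp add: tensor_space_def)
      then show "g (k \<odot>\<^bsub>N\<^esub> n) = k \<odot>\<^bsub>comod paths_from_a\<^esub> g n"
        using LinearCombinations.module_hom_smult[OF L kn(1) N.copower_mem[OF cN[OF kn(2)]]] kn(1)
        by (intro ext) (simp add: g_def)
    qed (simp add: g_mem)
    \<comment> \<open>By coassociativity both sides are \<open>L\<close> applied to the component of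
      \<open>n\<close> at the concatenation of \<open>p\<close> and \<open>r\<close>, which starts
      at a exactly when \<open>p\<close> does.\<close>
    have g_coact: "\<Delta> (g n) = (\<lambda>q. g (coact N n q))" if n: "n \<in> carrier N" for n
    proof (intro ext)
      fix r p
      show "\<Delta> (g n) r p = g (coact N n r) p"
        using paths_from_a_concat[of p r]
        by (simp add: comult_apply[OF Csub_C[OF g_mem[OF n]]] g_def comodule_coact_coact[OF N n] L0)
    qed
    have gj: "g (j x) = f x" if x: "x \<in> carrier M" for x
    proof
      fix q
      have fx: "f x \<in> Csub paths_from_a" using module_hom_mem[OF f1 x] by simp
      show "g (j x) q = f x q"
      proof (cases "q \<in> paths_from_a")
        case True
        then have "L (coact N (j x) q) = \<Delta> (f x) q path_a"
          using Lj cM[OF x] by (simp add: j2[OF x] f2[OF x])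
        also have "\<dots> = f x q"
          using True by (auto simp: comult_apply[OF Csub_C[OF fx]] paths_from_a_def)
        finally show ?thesis using True by (simp add: g_def)
      next
        case False
        then show ?thesis using fx by (simp add: g_def Csub_def del: split_paired_All)
      qed
    qed
    have "g \<in> comodule_hom K N (comod paths_from_a)"
      using g_hom g_coact by (simp add: comodule_hom_def)
    then show ?thesis using gj by (intro bexI ballI)
  qed
  then show ?thesis using right_comodule unfolding injective_comodule_def by blast
qed

lemma injective_hull_from_a:
  "injective_hull TYPE('y) TYPE('z) K quiver_ab (comod {path_a}) (comod paths_from_a) (\<lambda>s. s)"
proof -
  interpret S: path_comodule K "{path_a}" by unfold_locales (rule prefix_closed_a)
  interpret E: path_comodule K paths_from_a by unfold_locales (rule prefix_closed_from_a)
  have SE: "Csub {path_a} \<subseteq> Csub paths_from_a" by (auto simp: Csub_def paths_from_a_def)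
  have hom: "(\<lambda>s. s) \<in> comodule_hom K (comod {path_a}) (comod paths_from_a)"
    unfolding comodule_hom_def using SE by (auto intro!: module_homI)
  have "N \<inter> Csub {path_a} \<noteq> {\<lambda>_. \<zero>}"
    if "subcomodule K quiver_ab N (comod paths_from_a)" and nz: "N \<noteq> {\<lambda>_. \<zero>}" for N
  proof -
    have sub: "N \<subseteq> Csub paths_from_a"
      and N: "right_comodule K quiver_ab (comod paths_from_a\<lparr>carrier := N\<rparr>)"
      using that by (simp_all add: subcomodule_def)
    note N' = N[unfolded right_comodule_def]
    interpret N: vectorspace K "comod paths_from_a\<lparr>carrier := N\<rparr>" by (rule N'[THEN conjunct1])
    have "(\<lambda>_. \<zero>) \<in> N" using N.M.zero_closed by simp
    with nz obtain n where n: "n \<in> N" "n \<noteq> (\<lambda>_. \<zero>)" by blast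
    have nE: "n \<in> Csub paths_from_a" using n(1) sub by blast
    show ?thesis
    proof (cases "n \<in> Csub {path_a}")
      case True
      with n show ?thesis by blast
    next
      case False
      then obtain q where q: "q \<noteq> path_a" "n q \<noteq> \<zero>"
        using E.Csub_C[OF nE] unfolding Csub_def by blast
      then have qP: "q \<in> paths_from_a" using nE unfolding Csub_def by blast
      then obtain k where k: "1 \<le> k" "q = path_x k" using q(1) by (auto simp: paths_from_a_def)
      \<comment> \<open>The component of \<open>\<Delta> n\<close> at an arrow is the coefficient of
        \<open>n\<close> there times a. A subcomodule contains it, so it meets S in a nonzero
        element.\<close>
      have eq: "\<Delta> n q p = (if p = path_a then n q else \<zero>)" for p
        using k by (simp add: comult_apply[OF E.Csub_C[OF nE]])
      have "n \<in> carrier (comod paths_from_a\<lparr>carrier := N\<rparr>)" using n(1) by simp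
      from module_hom_mem[OF N'[THEN conjunct2, THEN conjunct1] this]
      have "\<Delta> n \<in> carrier (copower (comod paths_from_a\<lparr>carrier := N\<rparr>) (paths quiver_ab))"
        by (simp add: tensor_space_def)
      from left_module.copower_mem[OF N.is_left_module this, of q] have "\<Delta> n q \<in> N" by simp
      moreover have "\<Delta> n q \<in> Csub {path_a}"
        using comult_mem_C[OF E.Csub_C[OF nE], of q] by (auto simp: Csub_def eq)
      moreover have "\<Delta> n q \<noteq> (\<lambda>_. \<zero>)"
      proof
        assume "\<Delta> n q = (\<lambda>_. \<zero>)"
        from fun_cong[OF this, of path_a] show False using q(2) by (simp add: eq)
      qed
      ultimately show ?thesis by blast
    qed
  qed
  then show ?thesis
    unfolding injective_hull_def
    using S.right_comodule injective_comodule_from_a hom by (simp add: image_ident)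
qed

lemma span_comodule_eq:
  assumes "P \<subseteq> paths quiver_ab"
  shows "span_comodule K (u ` P) = comod P"
proof -
  have "carrier C = Csub (paths quiver_ab)"
    unfolding Csub_def using C_carrier by blast
  then interpret C: path_subspace K C "paths quiver_ab"
    by unfold_locales simp_all
  show ?thesis
    using C.span_unit_vecs[OF assms] by (simp add: span_comodule_def comod_def)
qed

lemma comod_eqs:
  "comod_S K = comod {path_a}" "comod_T K = comod {path_b}" "comod_E K = comod paths_from_a"
  "{elem_a K} \<union> {elem_x K n |n. n \<ge> 1} = u ` paths_from_a"
proof -
  have "{elem_x K n |n. n \<ge> 1} = u ` path_x ` {1..}"
    unfolding elem_x_def path_x_def by auto
  moreover have "elem_a K = u path_a" by (simp add: elem_a_def path_a_def)
  ultimately show E: "{elem_a K} \<union> {elem_x K n |n. n \<ge> 1} = u ` paths_from_a"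
    unfolding paths_from_a_def by simp
  show "comod_E K = comod paths_from_a"
    unfolding comod_E_def E
    using prefix_closed_from_a by (intro span_comodule_eq) (simp add: prefix_closed_def)
  show "comod_S K = comod {path_a}"
    using span_comodule_eq[of "{path_a}"] by (simp add: comod_S_def elem_a_def path_a_def[symmetric])
  show "comod_T K = comod {path_b}"
    using span_comodule_eq[of "{path_b}"] by (simp add: comod_T_def elem_b_def path_b_def[symmetric])
qed

end

section \<open>The dual algebra\<close>

context path_coalgebra
begin

abbreviation "Dual \<equiv> dual_algebra K quiver_ab"

lemma dual_carrier:
  "f \<in> carrier Dual \<longleftrightarrow> f \<in> module_hom K C (regular_module K) \<and> f \<in> extensional (carrier C)"
  by (simp add: dual_algebra_def Let_def)

lemma dual_simps [simp]:
  "\<zero>\<^bsub>Dual\<^esub> = (\<lambda>c\<in>carrier C. \<zero>)"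
  "f \<oplus>\<^bsub>Dual\<^esub> g = (\<lambda>c\<in>carrier C. f c \<oplus> g c)"
  by (simp_all add: dual_algebra_def Let_def)

lemma dual_one: "\<one>\<^bsub>Dual\<^esub> = (\<lambda>c\<in>carrier C. counit K c)"
  by (simp add: dual_algebra_def Let_def)

lemma dual_one_u: "p \<in> paths quiver_ab \<Longrightarrow> \<one>\<^bsub>Dual\<^esub> (u p) = (if path_length p = 0 then \<one> else \<zero>)"
  by (simp add: dual_one counit_u)

lemma dual_mem: "f \<in> carrier Dual \<Longrightarrow> c \<in> carrier C \<Longrightarrow> f c \<in> carrier K"
  using module_hom_mem[of f K C "regular_module K" c] by (simp add: dual_carrier)

lemma dual_add: "\<lbrakk>f \<in> carrier Dual; c \<in> carrier C; d \<in> carrier C\<rbrakk> \<Longrightarrow>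
    f (\<lambda>p. c p \<oplus> d p) = f c \<oplus> f d"
  using LinearCombinations.module_hom_add[of f K C "regular_module K" c d] by (simp add: dual_carrier)

lemma dual_smult: "\<lbrakk>f \<in> carrier Dual; k \<in> carrier K; c \<in> carrier C\<rbrakk> \<Longrightarrow>
    f (\<lambda>p. k \<otimes> c p) = k \<otimes> f c"
  using LinearCombinations.module_hom_smult[of f K C "regular_module K" k c] by (simp add: dual_carrier)

lemma dualI:
  assumes "\<And>c. c \<in> carrier C \<Longrightarrow> f c \<in> carrier K"
    and "\<And>c d. \<lbrakk>c \<in> carrier C; d \<in> carrier C\<rbrakk> \<Longrightarrow> f (\<lambda>p. c p \<oplus> d p) = f c \<oplus> f d"
    and "\<And>k c. \<lbrakk>k \<in> carrier K; c \<in> carrier C\<rbrakk> \<Longrightarrow> f (\<lambda>p. k \<otimes> c p) = k \<otimes> f c"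
  shows "(\<lambda>c\<in>carrier C. f c) \<in> carrier Dual"
proof -
  have "(\<lambda>c\<in>carrier C. f c) \<in> module_hom K C (regular_module K)"
  proof (rule module_homI)
    fix c d assume cd: "c \<in> carrier C" "d \<in> carrier C"
    with C.M.a_closed[OF cd] assms(2)[OF cd]
    show "(\<lambda>c\<in>carrier C. f c) (c \<oplus>\<^bsub>C\<^esub> d) =
      (\<lambda>c\<in>carrier C. f c) c \<oplus>\<^bsub>regular_module K\<^esub> (\<lambda>c\<in>carrier C. f c) d" by simp
  next
    fix k c assume kc: "k \<in> carrier K" "c \<in> carrier C"
    with C.smult_closed[OF kc] assms(3)[OF kc]
    show "(\<lambda>c\<in>carrier C. f c) (k \<odot>\<^bsub>C\<^esub> c) = k \<odot>\<^bsub>regular_module K\<^esub> (\<lambda>c\<in>carrier C. f c) c"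
      by simp
  qed (simp add: assms(1))
  then show ?thesis unfolding dual_carrier by simp
qed

lemma C_hom_eqI:
  assumes "left_module K N" and "f \<in> module_hom K C N" and "g \<in> module_hom K C N"
    and "\<And>p. p \<in> paths quiver_ab \<Longrightarrow> f (u p) = g (u p)" and "c \<in> carrier C"
  shows "f c = g c"
  using left_module.free_hom_eqI[OF assms(1), of f "paths quiver_ab" g c] assms(2-)
  unfolding path_space_def by simp

lemma dual_eqI:
  assumes "f \<in> carrier Dual" and "g \<in> carrier Dual"
    and "\<And>p. p \<in> paths quiver_ab \<Longrightarrow> f (u p) = g (u p)"
  shows "f = g"
  using assms C_hom_eqI[OF regular, of f g] unfolding dual_carrier
  by (intro extensionalityI[of f "carrier C" g]) simp_all

text \<open>As the paths form a basis, a functional is an arbitrary function on paths. No finiteness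
  is imposed, and this is where all sequences in K come from.\<close>

definition dual_of :: "((two_vertices, nat) qpath \<Rightarrow> 'k) \<Rightarrow> ((two_vertices, nat) qpath \<Rightarrow> 'k) \<Rightarrow> 'k" where
  "dual_of \<phi> = (\<lambda>c\<in>carrier C. free_lift K (regular_module K) \<phi> c)"

lemma dual_of_mem:
  assumes "\<phi> \<in> paths quiver_ab \<rightarrow> carrier K"
  shows "dual_of \<phi> \<in> carrier Dual"
proof -
  have h: "free_lift K (regular_module K) \<phi> \<in> module_hom K C (regular_module K)"
    unfolding path_space_def using assms by (intro left_module.free_lift_hom[OF regular]) simp
  show ?thesis
    unfolding dual_of_def
    using module_hom_mem[OF h] LinearCombinations.module_hom_add[OF h]
      LinearCombinations.module_hom_smult[OF h]
    by (intro dualI) simp_all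
qed

lemma dual_of_u:
  assumes "p \<in> paths quiver_ab" and "\<phi> p \<in> carrier K"
  shows "dual_of \<phi> (u p) = \<phi> p"
  using left_module.free_lift_unit_vec[OF regular, of \<phi> p] assms by (simp add: dual_of_def)

text \<open>The left action of C^* on C, in which f evaluates the right tensor factor. The sum is
  taken in K at each coordinate because sums in a comodule record depend on its carrier; in this
  form one function describes the action on every \<open>comod P\<close> and also the convolution
  product.\<close>

definition act :: "(((two_vertices, nat) qpath \<Rightarrow> 'k) \<Rightarrow> 'k) \<Rightarrow> ((two_vertices, nat) qpath \<Rightarrow> 'k) \<Rightarrow>
    (two_vertices, nat) qpath \<Rightarrow> 'k" where
  "act f c p = (\<Oplus>q\<in>supp C (\<Delta> c). f (u q) \<otimes> \<Delta> c q p)"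

lemma coef_mem: "f \<in> carrier Dual \<Longrightarrow> p \<in> paths quiver_ab \<Longrightarrow> f (u p) \<in> carrier K"
  by (intro dual_mem u_mem)

lemma \<Delta>_mem: "c \<in> carrier C \<Longrightarrow> \<Delta> c q p \<in> carrier K"
  using comult_mem_C[of c q] by simp

lemma act_term_mem:
  assumes "f \<in> carrier Dual" and "c \<in> carrier C" and "D \<subseteq> paths quiver_ab"
  shows "(\<lambda>q. f (u q) \<otimes> \<Delta> c q p) \<in> D \<rightarrow> carrier K"
  using assms coef_mem[OF assms(1)] \<Delta>_mem[OF assms(2)] by (intro Pi_I m_closed) auto

lemma act_eq:
  assumes f: "f \<in> carrier Dual" and c: "c \<in> carrier C"
    and D: "finite D" "supp C (\<Delta> c) \<subseteq> D" "D \<subseteq> paths quiver_ab"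
  shows "act f c p = (\<Oplus>q\<in>D. f (u q) \<otimes> \<Delta> c q p)"
  unfolding act_def
proof (rule finsum_mono_neutral[OF abelian_monoid_axioms D(1,2) act_term_mem[OF f c D(3)]])
  fix q assume q: "q \<in> D - supp C (\<Delta> c)"
  then have "q \<in> paths quiver_ab" using D(3) by blast
  then have "f (u q) \<in> carrier K" by (rule coef_mem[OF f])
  moreover have "\<Delta> c q p = \<zero>" using q by (simp add: supp_def)
  ultimately show "f (u q) \<otimes> \<Delta> c q p = \<zero>" by simp
qed

lemma act_single:
  assumes f: "f \<in> carrier Dual" and c: "c \<in> carrier C" and i: "i \<in> paths quiver_ab"
    and 0: "\<And>q. q \<in> paths quiver_ab \<Longrightarrow> q \<noteq> i \<Longrightarrow> f (u q) \<otimes> \<Delta> c q p = \<zero>"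
  shows "act f c p = f (u i) \<otimes> \<Delta> c i p"
proof -
  have D: "finite (insert i (supp C (\<Delta> c)))" "supp C (\<Delta> c) \<subseteq> insert i (supp C (\<Delta> c))"
    "insert i (supp C (\<Delta> c)) \<subseteq> paths quiver_ab"
    using supp_comult[OF c] i by auto
  show ?thesis
    unfolding act_eq[OF f c D]
    using D 0 coef_mem[OF f i] \<Delta>_mem[OF c] i
    by (intro finsum_single[OF abelian_monoid_axioms D(1)]) auto
qed

text \<open>Only the vertex b can follow a path that ends at b.\<close>

lemma act_end_b:
  assumes f: "f \<in> carrier Dual" and c: "c \<in> carrier C" and p: "composable p path_b"
  shows "act f c p = f (u path_b) \<otimes> c p"
proof -
  have "act f c p = f (u path_b) \<otimes> \<Delta> c path_b p"
  proof (rule act_single[OF f c])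
    fix q assume q: "q \<in> paths quiver_ab" "q \<noteq> path_b"
    then have "\<not> composable p q" using p by (auto simp: composable_iff)
    then show "f (u q) \<otimes> \<Delta> c q p = \<zero>" using coef_mem[OF f q(1)] by (simp add: comult_apply[OF c])
  qed simp
  also have "\<Delta> c path_b p = c p"
    using p by (auto simp: comult_apply[OF c])
  finally show ?thesis .
qed

lemma act_add:
  assumes f: "f \<in> carrier Dual" and c: "c \<in> carrier C" and d: "d \<in> carrier C"
  shows "act f (\<lambda>p. c p \<oplus> d p) p = act f c p \<oplus> act f d p"
proof -
  have cd: "(\<lambda>p. c p \<oplus> d p) \<in> carrier C" using C.M.a_closed[OF c d] by simp
  let ?D = "supp C (\<Delta> c) \<union> supp C (\<Delta> d) \<union> supp C (\<Delta> (\<lambda>p. c p \<oplus> d p))"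
  have D: "finite ?D" "?D \<subseteq> paths quiver_ab"
    using supp_comult[OF c] supp_comult[OF d] supp_comult[OF cd] by auto
  have "act f (\<lambda>p. c p \<oplus> d p) p = (\<Oplus>q\<in>?D. f (u q) \<otimes> \<Delta> (\<lambda>p. c p \<oplus> d p) q p)"
    using D by (intro act_eq[OF f cd]) auto
  also have "\<dots> = (\<Oplus>q\<in>?D. f (u q) \<otimes> \<Delta> c q p \<oplus> f (u q) \<otimes> \<Delta> d q p)"
  proof (rule add.finprod_cong'[OF refl])
    show "(\<lambda>q. f (u q) \<otimes> \<Delta> c q p \<oplus> f (u q) \<otimes> \<Delta> d q p) \<in> ?D \<rightarrow> carrier K"
      using funcset_mem[OF act_term_mem[OF f c D(2)]] funcset_mem[OF act_term_mem[OF f d D(2)]]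
      by (intro Pi_I a_closed)
    fix q assume "q \<in> ?D"
    then have "f (u q) \<in> carrier K" using D(2) coef_mem[OF f] by blast
    then show "f (u q) \<otimes> \<Delta> (\<lambda>p. c p \<oplus> d p) q p = f (u q) \<otimes> \<Delta> c q p \<oplus> f (u q) \<otimes> \<Delta> d q p"
      using c d by (simp add: comult_apply[OF c] comult_apply[OF d] comult_apply[OF cd] r_distr)
  qed
  also have "\<dots> = (\<Oplus>q\<in>?D. f (u q) \<otimes> \<Delta> c q p) \<oplus> (\<Oplus>q\<in>?D. f (u q) \<otimes> \<Delta> d q p)"
    by (rule finsum_addf[OF act_term_mem[OF f c D(2)] act_term_mem[OF f d D(2)]])
  also have "(\<Oplus>q\<in>?D. f (u q) \<otimes> \<Delta> c q p) = act f c p"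
    using D by (intro act_eq[OF f c, symmetric]) auto
  also have "(\<Oplus>q\<in>?D. f (u q) \<otimes> \<Delta> d q p) = act f d p"
    using D by (intro act_eq[OF f d, symmetric]) auto
  finally show ?thesis .
qed

lemma act_smult:
  assumes f: "f \<in> carrier Dual" and k: "k \<in> carrier K" and c: "c \<in> carrier C"
  shows "act f (\<lambda>p. k \<otimes> c p) p = k \<otimes> act f c p"
proof -
  have kc: "(\<lambda>p. k \<otimes> c p) \<in> carrier C" using C.smult_closed[OF k c] by simp
  let ?D = "supp C (\<Delta> c) \<union> supp C (\<Delta> (\<lambda>p. k \<otimes> c p))"
  have D: "finite ?D" "?D \<subseteq> paths quiver_ab"
    using supp_comult[OF c] supp_comult[OF kc] by auto
  have "act f (\<lambda>p. k \<otimes> c p) p = (\<Oplus>q\<in>?D. f (u q) \<otimes> \<Delta> (\<lambda>p. k \<otimes> c p) q p)"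
    using D by (intro act_eq[OF f kc]) auto
  also have "\<dots> = (\<Oplus>q\<in>?D. k \<otimes> (f (u q) \<otimes> \<Delta> c q p))"
  proof (rule add.finprod_cong'[OF refl])
    show "(\<lambda>q. k \<otimes> (f (u q) \<otimes> \<Delta> c q p)) \<in> ?D \<rightarrow> carrier K"
      by (rule Pi_I, rule m_closed[OF k], rule funcset_mem[OF act_term_mem[OF f c D(2)]])
    fix q assume "q \<in> ?D"
    then have "f (u q) \<in> carrier K" using D(2) coef_mem[OF f] by blast
    then show "f (u q) \<otimes> \<Delta> (\<lambda>p. k \<otimes> c p) q p = k \<otimes> (f (u q) \<otimes> \<Delta> c q p)"
      using c k by (simp add: comult_apply[OF c] comult_apply[OF kc] m_lcomm)
  qed
  also have "\<dots> = k \<otimes> (\<Oplus>q\<in>?D. f (u q) \<otimes> \<Delta> c q p)"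
    by (rule finsum_rdistr[OF D(1) k act_term_mem[OF f c D(2)], symmetric])
  also have "(\<Oplus>q\<in>?D. f (u q) \<otimes> \<Delta> c q p) = act f c p"
    using D by (intro act_eq[OF f c, symmetric]) auto
  finally show ?thesis .
qed

lemma act_plus:
  assumes f: "f \<in> carrier Dual" and g: "g \<in> carrier Dual" and c: "c \<in> carrier C"
  shows "act (f \<oplus>\<^bsub>Dual\<^esub> g) c p = act f c p \<oplus> act g c p"
proof -
  let ?S = "supp C (\<Delta> c)"
  have S: "?S \<subseteq> paths quiver_ab" using supp_comult[OF c] by simp
  have "act (f \<oplus>\<^bsub>Dual\<^esub> g) c p = (\<Oplus>q\<in>?S. f (u q) \<otimes> \<Delta> c q p \<oplus> g (u q) \<otimes> \<Delta> c q p)"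
    unfolding act_def
  proof (rule add.finprod_cong'[OF refl])
    show "(\<lambda>q. f (u q) \<otimes> \<Delta> c q p \<oplus> g (u q) \<otimes> \<Delta> c q p) \<in> ?S \<rightarrow> carrier K"
      using funcset_mem[OF act_term_mem[OF f c S]] funcset_mem[OF act_term_mem[OF g c S]]
      by (intro Pi_I a_closed)
    fix q assume "q \<in> ?S"
    then have "q \<in> paths quiver_ab" using S by blast
    then show "(f \<oplus>\<^bsub>Dual\<^esub> g) (u q) \<otimes> \<Delta> c q p = f (u q) \<otimes> \<Delta> c q p \<oplus> g (u q) \<otimes> \<Delta> c q p"
      using coef_mem[OF f] coef_mem[OF g] \<Delta>_mem[OF c] by (simp add: l_distr)
  qed
  also have "\<dots> = act f c p \<oplus> act g c p"
    unfolding act_def by (rule finsum_addf[OF act_term_mem[OF f c S] act_term_mem[OF g c S]])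
  finally show ?thesis .
qed

text \<open>These formulas determine the action completely. An arrow component of f moves the arrow
  to a, and E is a nontrivial extension for this reason.\<close>

lemma act_u:
  assumes f: "f \<in> carrier Dual"
  shows "act f (u path_a) = (\<lambda>p. f (u path_a) \<otimes> u path_a p)"
    and "act f (u path_b) = (\<lambda>p. f (u path_b) \<otimes> u path_b p)"
    and "1 \<le> n \<Longrightarrow> act f (u (path_x n)) =
      (\<lambda>p. f (u (path_x n)) \<otimes> u path_a p \<oplus> f (u path_b) \<otimes> u (path_x n) p)"
proof -
  have outside: "act f c p = \<zero>" if "p \<notin> paths quiver_ab" and c: "c \<in> carrier C" for c p
  proof -
    have "act f c p = f (u path_b) \<otimes> \<Delta> c path_b p"
      using that coef_mem[OF f]
      by (intro act_single[OF f c]) (auto simp: comult_apply[OF c] composable_def)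
    then show ?thesis using that coef_mem[OF f, of path_b] by (simp add: comult_apply[OF c] composable_def)
  qed
  \<comment> \<open>The first factor a forces the second factor to be \<open>i\<close> itself, which
    is possible exactly for paths \<open>i\<close> that start at a.\<close>
  have at_a: "act f (u i) path_a = (if i \<in> paths_from_a then f (u i) else \<zero>)"
    if i: "i \<in> paths quiver_ab" for i
  proof -
    have iC: "u i \<in> carrier C" using i by simp
    have e: "act f (u i) path_a = f (u i) \<otimes> \<Delta> (u i) i path_a"
      using coef_mem[OF f] by (intro act_single[OF f iC i]) (auto simp: comult_apply[OF iC] u_apply)
    show ?thesis
      using i e coef_mem[OF f i]
      by (cases rule: paths_cases) (auto simp: comult_apply[OF u_mem] u_apply paths_from_a_def)
  qed
  show "act f (u path_a) = (\<lambda>p. f (u path_a) \<otimes> u path_a p)"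
  proof
    fix p
    show "act f (u path_a) p = f (u path_a) \<otimes> u path_a p"
    proof (cases "p \<in> paths quiver_ab")
      case True
      then show ?thesis
        using coef_mem[OF f]
        by (cases rule: paths_cases) (simp_all add: at_a act_end_b[OF f] paths_from_a_def u_apply)
    next
      case False
      then show ?thesis using coef_mem[OF f, of path_a] by (auto simp: outside u_apply)
    qed
  qed
  show "act f (u path_b) = (\<lambda>p. f (u path_b) \<otimes> u path_b p)"
  proof
    fix p
    show "act f (u path_b) p = f (u path_b) \<otimes> u path_b p"
    proof (cases "p \<in> paths quiver_ab")
      case True
      then show ?thesis
        using coef_mem[OF f, of path_b]
        by (cases rule: paths_cases) (auto simp: at_a act_end_b[OF f] paths_from_a_def u_apply)
    next
      case False
      then show ?thesis using coef_mem[OF f, of path_b] by (auto simp: outside u_apply)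
    qed
  qed
  show "act f (u (path_x n)) =
      (\<lambda>p. f (u (path_x n)) \<otimes> u path_a p \<oplus> f (u path_b) \<otimes> u (path_x n) p)" if n: "1 \<le> n"
  proof
    fix p
    show "act f (u (path_x n)) p =
      f (u (path_x n)) \<otimes> u path_a p \<oplus> f (u path_b) \<otimes> u (path_x n) p"
    proof (cases "p \<in> paths quiver_ab")
      case True
      then show ?thesis
        using n coef_mem[OF f, of path_b] coef_mem[OF f, of "path_x n"]
        by (cases rule: paths_cases) (auto simp: at_a act_end_b[OF f] paths_from_a_def u_apply)
    next
      case False
      then show ?thesis
        using n coef_mem[OF f, of path_b] coef_mem[OF f, of "path_x n"] by (auto simp: outside u_apply)
    qed
  qed
qed

end

context path_comodule
begin

lemma finsum_act:
  assumes f: "f \<in> carrier Dual" and c: "c \<in> Csub P"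
  shows "(\<Oplus>\<^bsub>comod P\<^esub>q\<in>supp (comod P) (\<Delta> c). f (u q) \<odot>\<^bsub>comod P\<^esub> \<Delta> c q) = act f c"
    and "act f c \<in> Csub P"
proof -
  let ?S = "supp (comod P) (\<Delta> c)"
  have supp: "?S = supp C (\<Delta> c)" by (simp add: supp_def)
  have mem: "(\<lambda>q. f (u q) \<odot>\<^bsub>comod P\<^esub> \<Delta> c q) \<in> ?S \<rightarrow> carrier (comod P)"
  proof
    fix q assume "q \<in> ?S"
    then have "q \<in> paths quiver_ab" using supp_comult_P(2)[OF c] by blast
    then show "f (u q) \<odot>\<^bsub>comod P\<^esub> \<Delta> c q \<in> carrier (comod P)"
      using comult_Csub[OF c] coef_mem[OF f] by (intro left.smult_closed) simp_all
  qed
  show eq: "(\<Oplus>\<^bsub>comod P\<^esub>q\<in>?S. f (u q) \<odot>\<^bsub>comod P\<^esub> \<Delta> c q) = act f c"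
    by (rule ext, subst sub.finsum_V[OF mem]) (simp only: act_def supp comod_simps)
  show "act f c \<in> Csub P"
    using sub.V.M.finsum_closed[OF mem] unfolding eq by simp
qed

end

section \<open>The ring structure of the dual algebra\<close>

context path_coalgebra
begin

lemma path_comodule_paths: "path_comodule K (paths quiver_ab)"
  by unfold_locales (auto simp: prefix_closed_def composable_def)

lemma Csub_paths: "Csub (paths quiver_ab) = carrier C"
  unfolding Csub_def using C_carrier by blast

lemma act_mem: "f \<in> carrier Dual \<Longrightarrow> c \<in> carrier C \<Longrightarrow> act f c \<in> carrier C"
  using path_comodule.finsum_act(2)[OF path_comodule_paths] by (simp add: Csub_paths)

lemma act_hom:
  assumes f: "f \<in> carrier Dual"
  shows "act f \<in> module_hom K C C"
  using act_mem[OF f] act_add[OF f] act_smult[OF f]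
  by (intro module_homI) (simp_all add: fun_eq_iff)

text \<open>Linearity of f pulls the sum of the f(c_1) g(c_2) inside as f applied to the action of g
  on c. Associativity of the product thus becomes the statement that \<open>act\<close> is an
  action.\<close>

lemma dual_mult_apply:
  assumes f: "f \<in> carrier Dual" and g: "g \<in> carrier Dual" and c: "c \<in> carrier C"
  shows "(f \<otimes>\<^bsub>Dual\<^esub> g) c = f (act g c)"
proof -
  interpret P: path_comodule K "paths quiver_ab" by (rule path_comodule_paths)
  let ?S = "supp C (\<Delta> c)"
  have f': "f \<in> module_hom K C (regular_module K)" using f by (simp add: dual_carrier)
  interpret R: left_module K "regular_module K" by (rule regular)
  have S: "\<And>q. q \<in> ?S \<Longrightarrow> q \<in> paths quiver_ab" using supp_comult[OF c] by blast
  have gS: "\<And>q. q \<in> ?S \<Longrightarrow> g (u q) \<in> carrier K" by (rule coef_mem[OF g S])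
  have mem: "(\<lambda>q. g (u q) \<odot>\<^bsub>C\<^esub> \<Delta> c q) \<in> ?S \<rightarrow> carrier C"
    by (intro Pi_I C.smult_closed gS comult_mem_C[OF c])
  have "act g c = (\<Oplus>\<^bsub>C\<^esub>q\<in>?S. g (u q) \<odot>\<^bsub>C\<^esub> \<Delta> c q)"
  proof
    fix p
    have "(\<Oplus>\<^bsub>C\<^esub>q\<in>?S. g (u q) \<odot>\<^bsub>C\<^esub> \<Delta> c q) p = (\<Oplus>q\<in>?S. (g (u q) \<odot>\<^bsub>C\<^esub> \<Delta> c q) p)"
      by (rule finsum_hom[where h = "\<lambda>c. c p", OF C.M.abelian_monoid_axioms abelian_monoid_axioms mem])
        simp_all
    then show "act g c p = (\<Oplus>\<^bsub>C\<^esub>q\<in>?S. g (u q) \<odot>\<^bsub>C\<^esub> \<Delta> c q) p"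
      by (simp add: act_def)
  qed
  then have "f (act g c) = (\<Oplus>\<^bsub>regular_module K\<^esub>q\<in>?S. f (g (u q) \<odot>\<^bsub>C\<^esub> \<Delta> c q))"
    using module_hom_finsum[OF C.M.abelian_group_axioms R.M.abelian_group_axioms f' mem] by simp
  also have "\<dots> = (\<Oplus>q\<in>?S. f (g (u q) \<odot>\<^bsub>C\<^esub> \<Delta> c q))" by simp
  also have "\<dots> = (\<Oplus>q\<in>?S. f (\<Delta> c q) \<otimes> g (u q))"
  proof (rule add.finprod_cong'[OF refl])
    show "(\<lambda>q. f (\<Delta> c q) \<otimes> g (u q)) \<in> ?S \<rightarrow> carrier K"
      by (intro Pi_I m_closed gS dual_mem[OF f comult_mem_C[OF c]])
    fix q assume "q \<in> ?S"
    then have "g (u q) \<in> carrier K" by (rule gS)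
    then show "f (g (u q) \<odot>\<^bsub>C\<^esub> \<Delta> c q) = f (\<Delta> c q) \<otimes> g (u q)"
      using dual_smult[OF f _ comult_mem_C[OF c]] dual_mem[OF f comult_mem_C[OF c]]
      by (simp add: m_comm)
  qed
  finally show ?thesis using c by (simp add: dual_algebra_def Let_def)
qed

lemma dual_mult_mem:
  assumes f: "f \<in> carrier Dual" and g: "g \<in> carrier Dual"
  shows "f \<otimes>\<^bsub>Dual\<^esub> g \<in> carrier Dual"
proof -
  have eq: "f \<otimes>\<^bsub>Dual\<^esub> g = (\<lambda>c\<in>carrier C. f (act g c))"
  proof (rule extensionalityI)
    show "f \<otimes>\<^bsub>Dual\<^esub> g \<in> extensional (carrier C)" by (simp add: dual_algebra_def Let_def)
  qed (simp_all add: dual_mult_apply[OF f g])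
  have add: "act g (\<lambda>p. c p \<oplus> d p) = (\<lambda>p. act g c p \<oplus> act g d p)"
    if "c \<in> carrier C" "d \<in> carrier C" for c d
    by (rule ext) (rule act_add[OF g that])
  have smult: "act g (\<lambda>p. k \<otimes> c p) = (\<lambda>p. k \<otimes> act g c p)"
    if "k \<in> carrier K" "c \<in> carrier C" for c k
    by (rule ext) (rule act_smult[OF g that])
  show ?thesis
    unfolding eq
    by (rule dualI) (simp_all add: add smult dual_mem[OF f act_mem[OF g]]
        dual_add[OF f act_mem[OF g] act_mem[OF g]] dual_smult[OF f _ act_mem[OF g]])
qed

text \<open>This is multiplication of triangular matrices with diagonal f(a), f(b) and the sequence
  of the f(x_n) in the upper right corner.\<close>

lemma dual_mult_u:
  assumes f: "f \<in> carrier Dual" and g: "g \<in> carrier Dual"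
  shows "(f \<otimes>\<^bsub>Dual\<^esub> g) (u path_a) = f (u path_a) \<otimes> g (u path_a)"
    and "(f \<otimes>\<^bsub>Dual\<^esub> g) (u path_b) = f (u path_b) \<otimes> g (u path_b)"
    and "1 \<le> n \<Longrightarrow> (f \<otimes>\<^bsub>Dual\<^esub> g) (u (path_x n)) =
      f (u path_a) \<otimes> g (u (path_x n)) \<oplus> f (u (path_x n)) \<otimes> g (u path_b)"
proof -
  have lin: "f (\<lambda>p. k \<otimes> u q p) = f (u q) \<otimes> k" if "k \<in> carrier K" "q \<in> paths quiver_ab" for k q
    using that dual_smult[OF f, of k "u q"] coef_mem[OF f, of q] by (simp add: m_comm)
  have mem: "(\<lambda>p. k \<otimes> u q p) \<in> carrier C" if "k \<in> carrier K" "q \<in> paths quiver_ab" for k q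
    using that C.smult_closed[of k "u q"] by simp
  show "(f \<otimes>\<^bsub>Dual\<^esub> g) (u path_a) = f (u path_a) \<otimes> g (u path_a)"
    using coef_mem[OF g, of path_a] by (simp add: dual_mult_apply[OF f g] act_u[OF g] lin)
  show "(f \<otimes>\<^bsub>Dual\<^esub> g) (u path_b) = f (u path_b) \<otimes> g (u path_b)"
    using coef_mem[OF g, of path_b] by (simp add: dual_mult_apply[OF f g] act_u[OF g] lin)
  show "(f \<otimes>\<^bsub>Dual\<^esub> g) (u (path_x n)) =
      f (u path_a) \<otimes> g (u (path_x n)) \<oplus> f (u (path_x n)) \<otimes> g (u path_b)" if "1 \<le> n"
    using that coef_mem[OF g, of path_b] coef_mem[OF g, of "path_x n"]
      dual_add[OF f mem mem, of "g (u (path_x n))" path_a "g (u path_b)" "path_x n"]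
    by (simp add: dual_mult_apply[OF f g] act_u[OF g] lin)
qed

lemma one_mem: "\<one>\<^bsub>Dual\<^esub> \<in> carrier Dual"
  unfolding dual_one using module_hom_mem[OF counit_hom] LinearCombinations.module_hom_add[OF counit_hom]
    LinearCombinations.module_hom_smult[OF counit_hom]
  by (intro dualI) simp_all

lemma act_one:
  assumes c: "c \<in> carrier C"
  shows "act \<one>\<^bsub>Dual\<^esub> c = c"
proof -
  have "act \<one>\<^bsub>Dual\<^esub> c = (\<lambda>x. x) c"
  proof (rule C_hom_eqI[OF C.left_module_axioms act_hom[OF one_mem] _ _ c])
    show "(\<lambda>x. x) \<in> module_hom K C C" by (intro module_homI) simp_all
    fix p assume "p \<in> paths quiver_ab"
    then show "act \<one>\<^bsub>Dual\<^esub> (u p) = u p"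
      by (cases rule: paths_cases) (simp_all add: act_u[OF one_mem] dual_one_u)
  qed
  then show ?thesis .
qed

lemma act_mult:
  assumes f: "f \<in> carrier Dual" and g: "g \<in> carrier Dual" and c: "c \<in> carrier C"
  shows "act (f \<otimes>\<^bsub>Dual\<^esub> g) c = act f (act g c)"
proof (rule C_hom_eqI[OF C.left_module_axioms act_hom[OF dual_mult_mem[OF f g]] _ _ c])
  show "(\<lambda>c. act f (act g c)) \<in> module_hom K C C"
    by (rule module_hom_comp[OF act_hom[OF g] act_hom[OF f]])
  have lin: "act f (\<lambda>p. k \<otimes> u q p) = (\<lambda>p. k \<otimes> act f (u q) p)"
    if "k \<in> carrier K" "q \<in> paths quiver_ab" for k q
    using that by (intro ext act_smult[OF f]) simp_all
  have mem: "(\<lambda>p. k \<otimes> u q p) \<in> carrier C" if "k \<in> carrier K" "q \<in> paths quiver_ab" for k q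
    using that C.smult_closed[of k "u q"] by simp
  note fg = dual_mult_mem[OF f g]
  note coef = coef_mem[OF f] coef_mem[OF g]
  fix p assume "p \<in> paths quiver_ab"
  then show "act (f \<otimes>\<^bsub>Dual\<^esub> g) (u p) = act f (act g (u p))"
  proof (cases rule: paths_cases)
    case a
    have "act f (act g (u path_a)) = (\<lambda>p. g (u path_a) \<otimes> act f (u path_a) p)"
      unfolding act_u(1)[OF g] by (rule lin) (simp_all add: coef)
    then show ?thesis
      unfolding a act_u(1)[OF f] act_u(1)[OF fg] dual_mult_u(1)[OF f g]
      by (simp add: coef m_ac)
  next
    case b
    have "act f (act g (u path_b)) = (\<lambda>p. g (u path_b) \<otimes> act f (u path_b) p)"
      unfolding act_u(2)[OF g] by (rule lin) (simp_all add: coef)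
    then show ?thesis
      unfolding b act_u(2)[OF f] act_u(2)[OF fg] dual_mult_u(2)[OF f g]
      by (simp add: coef m_ac)
  next
    case (x n)
    have c: "f (u path_a) \<in> carrier K" "f (u path_b) \<in> carrier K" "f (u (path_x n)) \<in> carrier K"
      "g (u path_b) \<in> carrier K" "g (u (path_x n)) \<in> carrier K"
      using x by (simp_all add: coef)
    have "act f (act g (u (path_x n))) =
        (\<lambda>p. act f (\<lambda>p. g (u (path_x n)) \<otimes> u path_a p) p \<oplus> act f (\<lambda>p. g (u path_b) \<otimes> u (path_x n) p) p)"
      unfolding act_u(3)[OF g x(1)]
      using x c by (intro ext act_add[OF f mem mem]) simp_all
    also have "act f (\<lambda>p. g (u (path_x n)) \<otimes> u path_a p) = (\<lambda>p. g (u (path_x n)) \<otimes> act f (u path_a) p)"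
      by (rule lin) (simp_all add: c)
    also have "act f (\<lambda>p. g (u path_b) \<otimes> u (path_x n) p) = (\<lambda>p. g (u path_b) \<otimes> act f (u (path_x n)) p)"
      using x by (intro lin) (simp_all add: c)
    finally have eq: "act f (act g (u (path_x n))) =
      (\<lambda>p. g (u (path_x n)) \<otimes> act f (u path_a) p \<oplus> g (u path_b) \<otimes> act f (u (path_x n)) p)" .
    show ?thesis
      unfolding x(2) eq act_u(1)[OF f] act_u(3)[OF f x(1)] act_u(3)[OF fg x(1)]
        dual_mult_u(2)[OF f g] dual_mult_u(3)[OF f g x(1)]
      by (rule ext) (simp add: c r_distr l_distr m_ac a_ac)
  qed
qed

lemma dual_extensional: "f \<in> carrier Dual \<Longrightarrow> f \<in> extensional (carrier C)"
  by (simp add: dual_carrier)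

lemma dual_zero_mem: "\<zero>\<^bsub>Dual\<^esub> \<in> carrier Dual"
  unfolding dual_simps by (rule dualI) simp_all

lemma dual_plus_mem:
  assumes f: "f \<in> carrier Dual" and g: "g \<in> carrier Dual"
  shows "f \<oplus>\<^bsub>Dual\<^esub> g \<in> carrier Dual"
  unfolding dual_simps
  by (rule dualI) (simp_all add: dual_mem[OF f] dual_mem[OF g] dual_add[OF f] dual_add[OF g]
      dual_smult[OF f] dual_smult[OF g] r_distr a_ac)

lemma ring_dual: "ring Dual"
proof (rule ringI)
  show "abelian_group Dual"
  proof (rule abelian_groupI)
    show "\<exists>g\<in>carrier Dual. g \<oplus>\<^bsub>Dual\<^esub> f = \<zero>\<^bsub>Dual\<^esub>" if f: "f \<in> carrier Dual" for f
    proof (rule bexI)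
      show "(\<lambda>c\<in>carrier C. \<ominus> f c) \<in> carrier Dual"
        by (rule dualI) (simp_all add: dual_mem[OF f] dual_add[OF f] dual_smult[OF f] minus_add r_minus)
      show "(\<lambda>c\<in>carrier C. \<ominus> f c) \<oplus>\<^bsub>Dual\<^esub> f = \<zero>\<^bsub>Dual\<^esub>"
        by (intro extensionalityI[of _ "carrier C"]) (simp_all add: dual_mem[OF f] l_neg)
    qed
    show "\<zero>\<^bsub>Dual\<^esub> \<oplus>\<^bsub>Dual\<^esub> f = f" if f: "f \<in> carrier Dual" for f
      by (rule extensionalityI[OF _ dual_extensional[OF f]]) (simp_all add: dual_mem[OF f])
    show "f \<oplus>\<^bsub>Dual\<^esub> g = g \<oplus>\<^bsub>Dual\<^esub> f" if f: "f \<in> carrier Dual" and g: "g \<in> carrier Dual" for f g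
      by (intro extensionalityI[of _ "carrier C"]) (simp_all add: dual_mem[OF f] dual_mem[OF g] a_comm)
    show "f \<oplus>\<^bsub>Dual\<^esub> g \<oplus>\<^bsub>Dual\<^esub> h = f \<oplus>\<^bsub>Dual\<^esub> (g \<oplus>\<^bsub>Dual\<^esub> h)"
      if f: "f \<in> carrier Dual" and g: "g \<in> carrier Dual" and h: "h \<in> carrier Dual" for f g h
      by (intro extensionalityI[of _ "carrier C"])
        (simp_all add: dual_mem[OF f] dual_mem[OF g] dual_mem[OF h] a_assoc)
  qed (intro dual_zero_mem dual_plus_mem; assumption)+
  note ext = dual_extensional[OF dual_mult_mem]
  show "monoid Dual"
  proof (rule monoidI)
    show "f \<otimes>\<^bsub>Dual\<^esub> g \<otimes>\<^bsub>Dual\<^esub> h = f \<otimes>\<^bsub>Dual\<^esub> (g \<otimes>\<^bsub>Dual\<^esub> h)"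
      if f: "f \<in> carrier Dual" and g: "g \<in> carrier Dual" and h: "h \<in> carrier Dual" for f g h
      by (rule extensionalityI[OF ext ext])
        (simp_all add: f g h dual_mult_mem dual_mult_apply act_mem act_mult)
    show "\<one>\<^bsub>Dual\<^esub> \<otimes>\<^bsub>Dual\<^esub> f = f" if f: "f \<in> carrier Dual" for f
    proof (rule dual_eqI[OF dual_mult_mem[OF one_mem f] f])
      fix p assume "p \<in> paths quiver_ab"
      then show "(\<one>\<^bsub>Dual\<^esub> \<otimes>\<^bsub>Dual\<^esub> f) (u p) = f (u p)"
        using coef_mem[OF f] coef_mem[OF f, of path_b]
        by (cases rule: paths_cases) (simp_all add: dual_mult_u[OF one_mem f] dual_one_u)
    qed
    show "f \<otimes>\<^bsub>Dual\<^esub> \<one>\<^bsub>Dual\<^esub> = f" if f: "f \<in> carrier Dual" for f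
      by (rule extensionalityI[OF ext[OF f one_mem] dual_extensional[OF f]])
        (simp add: dual_mult_apply[OF f one_mem] act_one)
  qed (use one_mem dual_mult_mem in blast)+
  show "(f \<oplus>\<^bsub>Dual\<^esub> g) \<otimes>\<^bsub>Dual\<^esub> h = f \<otimes>\<^bsub>Dual\<^esub> h \<oplus>\<^bsub>Dual\<^esub> g \<otimes>\<^bsub>Dual\<^esub> h"
    if f: "f \<in> carrier Dual" and g: "g \<in> carrier Dual" and h: "h \<in> carrier Dual" for f g h
  proof (rule extensionalityI[OF ext[OF dual_plus_mem[OF f g] h]])
    fix c assume c: "c \<in> carrier C"
    show "((f \<oplus>\<^bsub>Dual\<^esub> g) \<otimes>\<^bsub>Dual\<^esub> h) c = (f \<otimes>\<^bsub>Dual\<^esub> h \<oplus>\<^bsub>Dual\<^esub> g \<otimes>\<^bsub>Dual\<^esub> h) c"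
      unfolding dual_mult_apply[OF dual_plus_mem[OF f g] h c]
      using c act_mem[OF h c] by (simp add: dual_mult_apply[OF f h] dual_mult_apply[OF g h])
  qed simp
  show "h \<otimes>\<^bsub>Dual\<^esub> (f \<oplus>\<^bsub>Dual\<^esub> g) = h \<otimes>\<^bsub>Dual\<^esub> f \<oplus>\<^bsub>Dual\<^esub> h \<otimes>\<^bsub>Dual\<^esub> g"
    if f: "f \<in> carrier Dual" and g: "g \<in> carrier Dual" and h: "h \<in> carrier Dual" for f g h
  proof (rule extensionalityI[OF ext[OF h dual_plus_mem[OF f g]]])
    fix c assume c: "c \<in> carrier C"
    have "act (f \<oplus>\<^bsub>Dual\<^esub> g) c = (\<lambda>p. act f c p \<oplus> act g c p)"
      by (rule HOL.ext) (rule act_plus[OF f g c])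
    then show "(h \<otimes>\<^bsub>Dual\<^esub> (f \<oplus>\<^bsub>Dual\<^esub> g)) c = (h \<otimes>\<^bsub>Dual\<^esub> f \<oplus>\<^bsub>Dual\<^esub> h \<otimes>\<^bsub>Dual\<^esub> g) c"
      unfolding dual_mult_apply[OF h dual_plus_mem[OF f g] c]
      using c by (simp add: dual_mult_apply[OF h f] dual_mult_apply[OF h g]
          dual_add[OF h act_mem[OF f] act_mem[OF g]])
  qed simp
qed

abbreviation "\<eta> \<equiv> dual_scalar K quiver_ab"

text \<open>In matrix terms \<open>\<eta> k\<close> is the scalar matrix of k: it has the value k at
  both vertices and zero at the arrows.\<close>

lemma central_scalars_dual: "central_scalars K Dual \<eta>"
proof -
  have \<eta>: "\<eta> k = (\<lambda>c\<in>carrier C. k \<otimes> counit K c)" for k by (simp add: dual_scalar_def)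
  have cm: "counit K c \<in> carrier K" if "c \<in> carrier C" for c
    using module_hom_mem[OF counit_hom that] by simp
  have mem: "\<eta> k \<in> carrier Dual" if k: "k \<in> carrier K" for k
    unfolding \<eta>
    using k LinearCombinations.module_hom_add[OF counit_hom] LinearCombinations.module_hom_smult[OF counit_hom]
    by (intro dualI) (simp_all add: cm r_distr m_lcomm)
  have \<eta>u: "\<eta> k (u p) = (if path_length p = 0 then k else \<zero>)"
    if "k \<in> carrier K" "p \<in> paths quiver_ab" for k p
    using that by (simp add: \<eta> counit_u)
  show ?thesis
  proof (intro central_scalars.intro central_scalars_axioms.intro field_axioms ring_dual mem)
    show "\<eta> (k \<oplus> l) = \<eta> k \<oplus>\<^bsub>Dual\<^esub> \<eta> l" if "k \<in> carrier K" "l \<in> carrier K" for k l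
      using that by (intro dual_eqI mem dual_plus_mem) (simp_all add: \<eta>u)
    show "\<eta> (k \<otimes> l) = \<eta> k \<otimes>\<^bsub>Dual\<^esub> \<eta> l" if kl: "k \<in> carrier K" "l \<in> carrier K" for k l
    proof (rule dual_eqI)
      fix p assume "p \<in> paths quiver_ab"
      then show "\<eta> (k \<otimes> l) (u p) = (\<eta> k \<otimes>\<^bsub>Dual\<^esub> \<eta> l) (u p)"
        using kl by (cases rule: paths_cases) (simp_all add: dual_mult_u[OF mem mem] \<eta>u)
    qed (use kl in \<open>simp_all add: mem dual_mult_mem\<close>)
    show "\<eta> \<one> = \<one>\<^bsub>Dual\<^esub>"
      by (rule dual_eqI[OF mem one_mem]) (simp_all add: \<eta>u dual_one_u)
    show "\<eta> k \<otimes>\<^bsub>Dual\<^esub> f = f \<otimes>\<^bsub>Dual\<^esub> \<eta> k" if k: "k \<in> carrier K" and f: "f \<in> carrier Dual" for k f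
    proof (rule dual_eqI)
      fix p assume "p \<in> paths quiver_ab"
      then show "(\<eta> k \<otimes>\<^bsub>Dual\<^esub> f) (u p) = (f \<otimes>\<^bsub>Dual\<^esub> \<eta> k) (u p)"
        using k coef_mem[OF f] coef_mem[OF f, of path_b] coef_mem[OF f, of path_a]
        by (cases rule: paths_cases)
          (simp_all add: dual_mult_u[OF mem f] dual_mult_u[OF f mem] \<eta>u m_comm)
    qed (use k f in \<open>simp_all add: mem dual_mult_mem\<close>)
  qed
qed

end

section \<open>Left modules over the dual algebra that come from comodules\<close>

context path_comodule
begin

abbreviation "N \<equiv> dual_module K (comod P)"

lemma N_simps [simp]:
  "carrier N = Csub P" "\<zero>\<^bsub>N\<^esub> = (\<lambda>_. \<zero>)" "c \<oplus>\<^bsub>N\<^esub> d = (\<lambda>p. c p \<oplus> d p)"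
  "\<lbrakk>f \<in> carrier Dual; c \<in> Csub P\<rbrakk> \<Longrightarrow> f \<odot>\<^bsub>N\<^esub> c = act f c"
proof -
  show "f \<odot>\<^bsub>N\<^esub> c = act f c" if "f \<in> carrier Dual" "c \<in> Csub P"
    using finsum_act(1)[OF that] by (simp add: dual_module_def)
qed (simp_all add: dual_module_def)

lemma left_module_N: "left_module Dual N"
proof (intro left_module.intro left_module_axioms.intro ring_dual)
  note C = Csub_C
  show "abelian_group N"
  proof (rule abelian_groupI)
    show "\<exists>d\<in>carrier N. d \<oplus>\<^bsub>N\<^esub> c = \<zero>\<^bsub>N\<^esub>" if "c \<in> carrier N" for c
    proof (rule bexI)
      have c: "c \<in> Csub P" using that by simp
      show "(\<lambda>p. \<ominus> \<one> \<otimes> c p) \<in> carrier N" using Csub_smult[of "\<ominus> \<one>" c P] c by simp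
      show "(\<lambda>p. \<ominus> \<one> \<otimes> c p) \<oplus>\<^bsub>N\<^esub> c = \<zero>\<^bsub>N\<^esub>" using C[OF c] by (simp add: l_minus l_neg)
    qed
  qed (simp_all add: Csub_closed C a_ac)
  fix f g c d
  assume f: "f \<in> carrier Dual" and "c \<in> carrier N"
  then have c: "c \<in> Csub P" by simp
  show "f \<odot>\<^bsub>N\<^esub> c \<in> carrier N" using f c finsum_act(2) by simp
  show "(f \<oplus>\<^bsub>Dual\<^esub> g) \<odot>\<^bsub>N\<^esub> c = f \<odot>\<^bsub>N\<^esub> c \<oplus>\<^bsub>N\<^esub> g \<odot>\<^bsub>N\<^esub> c" if g: "g \<in> carrier Dual"
    using f g c dual_plus_mem[OF f g] act_plus[OF f g C[OF c]] by (simp add: fun_eq_iff del: dual_simps)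
  show "f \<odot>\<^bsub>N\<^esub> (c \<oplus>\<^bsub>N\<^esub> d) = f \<odot>\<^bsub>N\<^esub> c \<oplus>\<^bsub>N\<^esub> f \<odot>\<^bsub>N\<^esub> d" if "d \<in> carrier N"
    using f c that act_add[OF f C[OF c] C] by (simp add: fun_eq_iff Csub_add)
  show "(f \<otimes>\<^bsub>Dual\<^esub> g) \<odot>\<^bsub>N\<^esub> c = f \<odot>\<^bsub>N\<^esub> (g \<odot>\<^bsub>N\<^esub> c)" if g: "g \<in> carrier Dual"
    using f g c dual_mult_mem[OF f g] finsum_act(2)[OF g c] act_mult[OF f g C[OF c]] by simp
next
  show "\<one>\<^bsub>Dual\<^esub> \<odot>\<^bsub>N\<^esub> c = c" if "c \<in> carrier N" for c
    using that one_mem act_one[OF Csub_C] by simp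
qed

end

section \<open>The dimension of \<open>Ext\<close>\<close>

context path_coalgebra
begin

abbreviation "KN \<equiv> Func (UNIV :: nat set) (carrier K)"
abbreviation "KKN \<equiv> Func KN (carrier K)"

text \<open>Zero and one are distinct in K, so subsets of \<open>A\<close> embed as indicator
  functions, and the theorem of Cantor applies.\<close>

lemma card_of_less_Func: "|A| <o |Func A (carrier K)|"
proof -
  have "|A| <o |Pow A|" by (rule card_of_Pow)
  also have "|Pow A| \<le>o |Func A (carrier K)|"
  proof (rule card_of_ordLeqI)
    let ?f = "\<lambda>S a. if a \<in> A then (if a \<in> S then \<one> else \<zero>) else undefined"
    show "inj_on ?f (Pow A)"
    proof (rule inj_onI)
      fix S S' assume S: "S \<in> Pow A" "S' \<in> Pow A" and eq: "?f S = ?f S'"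
      have "a \<in> S \<longleftrightarrow> a \<in> S'" if "a \<in> A" for a
        using fun_cong[OF eq, of a] that one_not_zero by (simp split: if_splits)
      with S show "S = S'" by blast
    qed
  qed (simp add: Func_def)
  finally show ?thesis .
qed

lemma KN_not_empty: "KN \<noteq> {}"
  using one_closed by (simp add: Func_is_emp) blast

lemma infinite_KN: "infinite KN"
proof -
  have "|UNIV :: nat set| \<le>o |KN|" by (rule ordLess_imp_ordLeq[OF card_of_less_Func])
  then show ?thesis by (simp add: infinite_iff_card_of_nat)
qed

lemma card_of_K_le: "|carrier K| \<le>o |KN|"
proof (rule card_of_ordLeqI)
  show "inj_on (\<lambda>k. \<lambda>_ :: nat. k) (carrier K)" by (rule inj_onI) (drule fun_cong[of _ _ 0])
qed (simp add: Func_def)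

text \<open>Currying turns the exponent into K^N \<times> N, and the infinite set K^N absorbs the
  factor N.\<close>

lemma card_of_Func_KN_le: "|Func KN KN| \<le>o |KKN|"
proof -
  have "|Func KN KN| =o |Func (KN \<times> (UNIV :: nat set)) (carrier K)|"
    by (rule ordIso_symmetric[OF card_of_Func_Times])
  also have "|Func (KN \<times> (UNIV :: nat set)) (carrier K)| =o |KKN|"
  proof (rule card_of_Func_ordIso)
    have "|UNIV :: nat set| \<le>o |KN|" by (rule ordLess_imp_ordLeq[OF card_of_less_Func])
    then show "|KN \<times> (UNIV :: nat set)| =o |KN|"
      by (intro conjunct1[OF card_of_Times_infinite[OF infinite_KN]]) simp_all
  qed
  finally show ?thesis by (rule ordIso_imp_ordLeq)
qed

section \<open>The sequence space and a basis with many members besides the unit sequences\<close>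

abbreviation "V \<equiv> func_space (UNIV :: nat set)"

lemma V_simps [simp]:
  "v \<in> carrier V \<longleftrightarrow> (\<forall>n. v n \<in> carrier K)" "\<zero>\<^bsub>V\<^esub> = (\<lambda>_. \<zero>)"
  "v \<oplus>\<^bsub>V\<^esub> w = (\<lambda>n. v n \<oplus> w n)" "k \<odot>\<^bsub>V\<^esub> v = (\<lambda>n. k \<otimes> v n)"
  by (auto simp: func_space_def)

sublocale V: vectorspace K V
  by (rule vectorspace.intro[OF func_space_is_module field_axioms])

definition \<delta> :: "nat \<Rightarrow> nat \<Rightarrow> 'k" where
  "\<delta> n m = (if m = n then \<one> else \<zero>)"

text \<open>The ratio zero is excluded in the sequel because \<open>geo \<zero>\<close> coincides
  with \<open>\<delta> 0\<close>.\<close>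

definition geo :: "'k \<Rightarrow> nat \<Rightarrow> 'k" where
  "geo t m = t [^] m"

lemma \<delta>_V: "\<delta> n \<in> carrier V" by (simp add: \<delta>_def)

lemma inj_\<delta>: "inj \<delta>"
proof (rule injI)
  fix m n assume eq: "\<delta> m = \<delta> n"
  show "m = n" using fun_cong[OF eq, of m] one_not_zero by (simp add: \<delta>_def split: if_splits)
qed

lemma inj_geo: "inj_on geo (carrier K)"
proof (rule inj_onI)
  fix s t assume st: "s \<in> carrier K" "t \<in> carrier K" and eq: "geo s = geo t"
  show "s = t" using fun_cong[OF eq, of 1] st by (simp add: geo_def)
qed

lemma geo_neq_\<delta>:
  assumes "t \<in> carrier K" and "t \<noteq> \<zero>"
  shows "geo t \<noteq> \<delta> n"
proof
  assume eq: "geo t = \<delta> n"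
  show False
  proof (cases "n = 0")
    case True
    then show False using fun_cong[OF eq, of 1] assms by (simp add: geo_def \<delta>_def)
  next
    case False
    then show False using fun_cong[OF eq, of 0] by (simp add: geo_def \<delta>_def)
  qed
qed

text \<open>Subtracting \<open>s\<close> times the sum for \<open>m\<close> from the sum for \<open>m + 1\<close> removes the term of \<open>s\<close>
  and multiplies the other coefficients by \<open>t - s\<close>.\<close>

lemma power_sums_zero:
  assumes "finite T" and "T \<subseteq> carrier K - {\<zero>}" and "d \<in> T \<rightarrow> carrier K"
    and "\<And>m. m \<ge> M \<Longrightarrow> (\<Oplus>t\<in>T. d t \<otimes> t [^] (m :: nat)) = \<zero>" and "t \<in> T"
  shows "d t = \<zero>"
  using assms
proof (induction T arbitrary: d t rule: finite_induct)
  case (insert s T)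
  have s: "s \<in> carrier K" "s \<noteq> \<zero>" and T: "T \<subseteq> carrier K - {\<zero>}" using insert.prems(1) by auto
  have ds: "d s \<in> carrier K" and dT: "d \<in> T \<rightarrow> carrier K" using insert.prems(2) by auto
  define S where "S m = (\<Oplus>t\<in>T. d t \<otimes> t [^] (m :: nat))" for m
  have mem: "(\<lambda>t. d t \<otimes> t [^] (m :: nat)) \<in> T \<rightarrow> carrier K" for m
    using T dT by auto
  have S: "S m \<in> carrier K" for m
    unfolding S_def using mem by (rule finsum_closed)
  have zero: "d s \<otimes> s [^] m \<oplus> S m = \<zero>" if "m \<ge> M" for m
    using insert.prems(3)[OF that] insert.hyps s ds mem
    by (simp add: S_def)
  have dT0: "d t = \<zero>" if t: "t \<in> T" for t
  proof -
    have "(d t \<otimes> (t \<ominus> s)) = \<zero>"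
    proof (rule insert.IH[OF T _ _ t])
      show "(\<lambda>t. d t \<otimes> (t \<ominus> s)) \<in> T \<rightarrow> carrier K" using T dT s by auto
      fix m :: nat assume m: "m \<ge> M"
      have "(\<Oplus>t\<in>T. d t \<otimes> (t \<ominus> s) \<otimes> t [^] m) =
          (\<Oplus>t\<in>T. d t \<otimes> t [^] Suc m \<oplus> (\<ominus> s) \<otimes> (d t \<otimes> t [^] m))"
      proof (rule add.finprod_cong'[OF refl])
        show "(\<lambda>t. d t \<otimes> t [^] Suc m \<oplus> (\<ominus> s) \<otimes> (d t \<otimes> t [^] m)) \<in> T \<rightarrow> carrier K"
          using funcset_mem[OF mem] s by (intro Pi_I a_closed m_closed[OF a_inv_closed]) blast+
        fix t assume "t \<in> T"
        then have t: "t \<in> carrier K" "d t \<in> carrier K" using T dT by auto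
        have "\<ominus> s \<in> carrier K" using s by simp
        then show "d t \<otimes> (t \<ominus> s) \<otimes> t [^] m = d t \<otimes> t [^] Suc m \<oplus> (\<ominus> s) \<otimes> (d t \<otimes> t [^] m)"
          using t unfolding a_minus_def by (simp add: r_distr l_distr m_ac)
      qed
      also have "\<dots> = (\<Oplus>t\<in>T. d t \<otimes> t [^] Suc m) \<oplus> (\<Oplus>t\<in>T. (\<ominus> s) \<otimes> (d t \<otimes> t [^] m))"
        using s by (intro finsum_addf[OF mem])
          (rule Pi_I, rule m_closed[OF a_inv_closed], simp, rule funcset_mem[OF mem])
      also have "\<dots> = S (Suc m) \<oplus> (\<ominus> s) \<otimes> S m"
        using s finsum_rdistr[OF insert.hyps(1) _ mem, of "\<ominus> s" m] unfolding S_def by simp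
      also have "\<dots> = \<zero>"
      proof -
        have e: "S m = \<ominus> (d s \<otimes> s [^] m)" if "m \<ge> M" for m
          using zero[OF that] s ds S by (intro minus_equality[symmetric]) (simp_all add: a_comm)
        have "S (Suc m) \<oplus> (\<ominus> s) \<otimes> S m =
            \<ominus> (d s \<otimes> s [^] Suc m) \<oplus> (\<ominus> s) \<otimes> (\<ominus> (d s \<otimes> s [^] m))"
          using e[of m] e[of "Suc m"] m by (simp only: le_SucI)
        also have "\<dots> = \<zero>"
          using s ds by (simp add: l_minus r_minus m_ac l_neg)
        finally show ?thesis .
      qed
      finally show "(\<Oplus>t\<in>T. d t \<otimes> (t \<ominus> s) \<otimes> t [^] m) = \<zero>" .
    qed
    moreover have "t \<in> carrier K" "d t \<in> carrier K" using T dT t by auto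
    moreover have "t \<ominus> s \<noteq> \<zero>" using t insert.hyps(2) s \<open>t \<in> carrier K\<close> by auto
    ultimately show ?thesis using s by (simp add: integral_iff)
  qed
  have "S M = \<zero>"
  proof -
    have "S M = (\<Oplus>t\<in>T. \<zero>)" unfolding S_def using T dT0 by (intro add.finprod_cong') auto
    then show ?thesis by simp
  qed
  then have "d s \<otimes> s [^] M = \<zero>" using zero[of M] s ds by simp
  moreover have "s [^] M \<noteq> \<zero>" using s by (induction M) (simp_all add: integral_iff)
  ultimately have "d s = \<zero>" using s ds by (simp add: integral_iff)
  with dT0 insert.prems(4) show ?case by auto
qed simp

lemma finsum_V_apply:
  assumes "f \<in> A \<rightarrow> carrier V"
  shows "(\<Oplus>\<^bsub>V\<^esub>i\<in>A. f i) m = (\<Oplus>i\<in>A. f i m)"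
  by (rule finsum_hom[where h = "\<lambda>v. v m", OF V.M.abelian_monoid_axioms abelian_monoid_axioms assms])
    simp_all

abbreviation "geos \<equiv> geo ` (carrier K - {\<zero>})"

text \<open>A relation involves finitely many unit sequences. From some index \<open>M\<close> on
  they contribute nothing, so there the relation involves geometric sequences only and
  \<open>power_sums_zero\<close> removes their coefficients. Evaluation at n then isolates the
  coefficient of \<open>\<delta> n\<close>.\<close>

lemma lin_indpt_\<delta>_geo: "V.lin_indpt (range \<delta> \<union> geos)"
proof
  assume "V.lin_dep (range \<delta> \<union> geos)"
  then obtain A a v where A: "finite A" "A \<subseteq> range \<delta> \<union> geos" "a \<in> A \<rightarrow> carrier K"
    "V.lincomb a A = \<zero>\<^bsub>V\<^esub>" "v \<in> A" "a v \<noteq> \<zero>"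
    unfolding V.lin_dep_def by (elim exE conjE)
  have aK: "a w \<in> carrier K" if "w \<in> A" for w using A(3) that by (rule funcset_mem)
  have wV: "w m \<in> carrier K" if "w \<in> A" for w m
    using that A(2) by (auto simp: \<delta>_def geo_def)
  have mem: "(\<lambda>w. a w \<otimes> w m) \<in> A' \<rightarrow> carrier K" if "A' \<subseteq> A" for A' m
    using that aK wV by (intro Pi_I m_closed) blast+
  have sum0: "(\<Oplus>w\<in>A. a w \<otimes> w m) = \<zero>" for m
  proof -
    have "V.lincomb a A m = (\<Oplus>w\<in>A. (a w \<odot>\<^bsub>V\<^esub> w) m)"
      unfolding V.lincomb_def using aK wV by (intro finsum_V_apply Pi_I) simp
    then show ?thesis using A(4) by simp
  qed
  define T where "T = {t \<in> carrier K - {\<zero>}. geo t \<in> A}"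
  define I where "I = {n. \<delta> n \<in> A}"
  have geoT: "geo ` T \<subseteq> A" by (auto simp: T_def)
  have injT: "inj_on geo T" by (rule inj_on_subset[OF inj_geo]) (auto simp: T_def)
  have finT: "finite T" using finite_subset[OF geoT A(1)] injT by (rule finite_imageD)
  have finI: "finite I"
    unfolding I_def using finite_vimageI[OF A(1) inj_\<delta>] by (simp add: vimage_def)
  then obtain M where M: "\<And>n. n \<in> I \<Longrightarrow> n < M"
    using finite_nat_set_iff_bounded by auto
  have a_geo: "a (geo t) = \<zero>" if "t \<in> T" for t
  proof (rule power_sums_zero[OF finT _ _ _ that, of "\<lambda>t. a (geo t)" M])
    show "T \<subseteq> carrier K - {\<zero>}" by (auto simp: T_def)
    show "(\<lambda>t. a (geo t)) \<in> T \<rightarrow> carrier K" using aK geoT by (intro Pi_I) blast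
    fix m :: nat assume m: "m \<ge> M"
    have "(\<Oplus>t\<in>T. a (geo t) \<otimes> t [^] m) = (\<Oplus>w\<in>geo ` T. a w \<otimes> w m)"
      using finsum_reindex[OF mem[OF geoT] injT, of m] by (simp add: geo_def)
    also have "\<dots> = (\<Oplus>w\<in>A. a w \<otimes> w m)"
    proof (rule finsum_mono_neutral[OF abelian_monoid_axioms A(1) geoT mem[OF order_refl]])
      fix w assume w: "w \<in> A - geo ` T"
      then have "w \<notin> geos" by (auto simp: T_def)
      then obtain n where n: "w = \<delta> n" using w A(2) by blast
      then have "n < M" using w M by (simp add: I_def)
      then have "w m = \<zero>" using m n by (simp add: \<delta>_def)
      then show "a w \<otimes> w m = \<zero>" using aK w by simp
    qed
    finally show "(\<Oplus>t\<in>T. a (geo t) \<otimes> t [^] m) = \<zero>" by (simp add: sum0)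
  qed
  have a_\<delta>: "a (\<delta> n) = \<zero>" if n: "\<delta> n \<in> A" for n
  proof -
    have "(\<Oplus>w\<in>A. a w \<otimes> w n) = a (\<delta> n) \<otimes> \<delta> n n"
    proof (rule finsum_single[OF abelian_monoid_axioms A(1)])
      show "a (\<delta> n) \<otimes> \<delta> n n \<in> carrier K" using aK[OF n] wV[OF n] by simp
      fix w assume w: "w \<in> A" "w \<noteq> \<delta> n"
      show "a w \<otimes> w n = \<zero>"
      proof (cases "w \<in> geos")
        case True
        then obtain t where "t \<in> T" "w = geo t" using w by (auto simp: T_def)
        then show ?thesis using a_geo wV[OF w(1)] by simp
      next
        case False
        then obtain m where m: "w = \<delta> m" using w A(2) by blast
        then have "w n = \<zero>" using w(2) by (auto simp: \<delta>_def)
        then show ?thesis using aK[OF w(1)] by simp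
      qed
    qed (use n in simp)
    then show ?thesis using sum0[of n] aK[OF n] by (simp add: \<delta>_def)
  qed
  show False
  proof (cases "v \<in> geos")
    case True
    then obtain t where "t \<in> T" "v = geo t" using A(5) by (auto simp: T_def)
    then show False using a_geo A(6) by simp
  next
    case False
    then obtain n where "v = \<delta> n" using A(2,5) by blast
    then show False using a_\<delta> A(5,6) by simp
  qed
qed

lemma exists_sequence_basis: "\<exists>B. V.basis B \<and> range \<delta> \<subseteq> B \<and> |KN| \<le>o |B - range \<delta>|"
proof -
  have "range \<delta> \<union> geos \<subseteq> carrier V" by (auto simp: \<delta>_def geo_def)
  from V.exists_basis_extending[OF this lin_indpt_\<delta>_geo]
  obtain B where B: "V.basis B" "range \<delta> \<union> geos \<subseteq> B" by (elim exE conjE)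
  let ?B0 = "B - range \<delta>"
  have VKN: "carrier V = KN" by (auto simp: Func_def)
  have geos: "geos \<subseteq> ?B0" using B(2) geo_neq_\<delta> by auto
  \<comment> \<open>The unit sequences are countable, so removing them from \<open>B\<close> changes
    nothing in a comparison with an infinite set.\<close>
  have B_le: "|B| \<le>o |A|" if "|?B0| \<le>o |A|" "infinite A" for A :: "'c set"
  proof -
    have nat: "|UNIV :: nat set| \<le>o |A|" using that(2) by (simp add: infinite_iff_card_of_nat)
    have "|range \<delta>| \<le>o |A|" by (rule ordLeq_transitive[OF card_of_image nat])
    then have "|?B0 \<union> range \<delta>| \<le>o |A|"
      using that by (intro card_of_Un_le)
    moreover have "?B0 \<union> range \<delta> = B" using B(2) by blast
    ultimately show ?thesis by simp
  qed
  have "infinite ?B0 \<and> |carrier K| \<le>o |?B0|"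
  proof (cases "finite (carrier K)")
    case True
    \<comment> \<open>Over a finite field a finite \<open>?B0\<close> would leave a countable basis
      and hence countably many sequences, against Cantor.\<close>
    have "infinite ?B0"
    proof
      assume fin: "finite ?B0"
      have "|KN| \<le>o |UNIV :: nat set|"
        unfolding VKN[symmetric] using infinite_UNIV_nat
        by (intro V.card_of_carrier_le[OF B(1)] B_le card_of_finite_le fin True)
      moreover have "|UNIV :: nat set| <o |KN|" by (rule card_of_less_Func)
      ultimately show False using not_ordLess_ordLeq by blast
    qed
    then show ?thesis using card_of_finite_le[OF True] by blast
  next
    case False
    \<comment> \<open>For infinite K there may be no more sequences than scalars, so the number of
      sequences gives no lower bound. The members \<open>geo t\<close> with nonzero t supply |K|
      elements of \<open>?B0\<close>.\<close>
    have inf: "infinite (carrier K - {\<zero>})" using False by simp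
    have "|(carrier K - {\<zero>}) \<union> {\<zero>}| \<le>o |carrier K - {\<zero>}|"
      using card_of_mono1[OF order_refl] card_of_finite_le[of "{\<zero>}", OF _ inf] inf by (intro card_of_Un_le) simp_all
    also have "(carrier K - {\<zero>}) \<union> {\<zero>} = carrier K" by auto
    also have "|carrier K - {\<zero>}| \<le>o |?B0|"
    proof (rule card_of_ordLeqI)
      show "inj_on geo (carrier K - {\<zero>})" by (rule inj_on_subset[OF inj_geo]) blast
    qed (use geos in blast)
    finally have "|carrier K| \<le>o |?B0|" .
    then show ?thesis using False card_of_ordLeq_finite by blast
  qed
  then have "|KN| \<le>o |?B0|"
    using V.card_of_carrier_le[OF B(1) B_le[OF card_of_mono1[OF order_refl]]] VKN by simp
  with B show ?thesis by blast
qed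

end

text \<open>The choices \<open>{path_a}\<close> and \<open>paths_from_a\<close> for \<open>P\<close>
  give S and E. The argument is the same for both, since it uses only that the target contains a and
  is spanned by paths from a.\<close>

locale ext_target = path_coalgebra K for K :: "('k, 'x) ring_scheme" (structure) +
  fixes P
  assumes target_closed: "prefix_closed P" and a_target: "path_a \<in> P" and target_from_a: "P \<subseteq> paths_from_a"
begin

sublocale path_comodule K P by unfold_locales (rule target_closed)
sublocale T: path_comodule K "{path_b}" by unfold_locales (rule prefix_closed_b)
sublocale E: path_comodule K paths_from_a by unfold_locales (rule prefix_closed_from_a)

sublocale X: ext_modules K Dual \<eta> T.N N
  by (intro ext_modules.intro central_scalars_dual T.left_module_N left_module_N)

section \<open>Upper bound: the size of the resolution\<close>

definition nth_path :: "nat \<Rightarrow> (two_vertices, nat) qpath" where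
  "nth_path n = (if n = 0 then path_a else if n = 1 then path_b else path_x (n - 1))"

lemma nth_path_surj:
  assumes "p \<in> paths quiver_ab"
  shows "\<exists>n. p = nth_path n"
  using assms
proof (cases rule: paths_cases)
  case a
  then show ?thesis by (intro exI[of _ 0]) (simp add: nth_path_def)
next
  case b
  then show ?thesis by (intro exI[of _ 1]) (simp add: nth_path_def)
next
  case (x n)
  then show ?thesis by (intro exI[of _ "Suc n"]) (simp add: nth_path_def)
qed

lemma nth_path_mem: "nth_path n \<in> paths quiver_ab"
  by (auto simp: nth_path_def)

lemma card_of_C_le: "|carrier C| \<le>o |KN|"
proof (rule card_of_ordLeqI)
  show "inj_on (\<lambda>c n. c (nth_path n)) (carrier C)"
  proof (rule inj_onI)
    fix c d assume c: "c \<in> carrier C" and d: "d \<in> carrier C"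
      and eq: "(\<lambda>n. c (nth_path n)) = (\<lambda>n. d (nth_path n))"
    show "c = d"
    proof
      fix p
      show "c p = d p"
      proof (cases "p \<in> paths quiver_ab")
        case True
        then obtain n where "p = nth_path n" using nth_path_surj by blast
        then show ?thesis using fun_cong[OF eq, of n] by simp
      next
        case False
        then show ?thesis using c d by (simp add: C_carrier del: split_paired_All)
      qed
    qed
  qed
qed (simp add: Func_def)

lemma card_of_Dual_le: "|carrier Dual| \<le>o |KN|"
proof (rule card_of_ordLeqI)
  show "inj_on (\<lambda>f n. f (u (nth_path n))) (carrier Dual)"
  proof (rule inj_onI)
    fix f g assume f: "f \<in> carrier Dual" and g: "g \<in> carrier Dual"
      and eq: "(\<lambda>n. f (u (nth_path n))) = (\<lambda>n. g (u (nth_path n)))"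
    show "f = g"
    proof (rule dual_eqI[OF f g])
      fix p assume "p \<in> paths quiver_ab"
      then obtain n where "p = nth_path n" using nth_path_surj by blast
      then show "f (u p) = g (u p)" using fun_cong[OF eq, of n] by simp
    qed
  qed
qed (simp add: Func_def coef_mem nth_path_mem)

lemma card_of_Csub_le: "|Csub Q| \<le>o |KN|"
proof -
  have "Csub Q \<subseteq> carrier C" by (auto simp: Csub_def)
  then show ?thesis by (rule ordLeq_transitive[OF card_of_mono1 card_of_C_le])
qed

lemma card_of_Ext1_upper: "|carrier (Ext1 \<eta> Dual T.N N)| \<le>o |KKN|"
proof -
  have "|carrier X.F0| \<le>o |KN|"
    unfolding free_module_def
    by (rule card_of_copower_infinite_le) (simp_all add: card_of_Csub_le card_of_Dual_le infinite_KN)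
  then have Z0: "|X.Z0| \<le>o |KN|"
    by (rule ordLeq_transitive[OF card_of_mono1[OF X.Z0_subset]])
  \<comment> \<open>Monotonicity in the exponent asks for a nonempty \<open>Z0\<close>.\<close>
  have "\<zero>\<^bsub>X.F0\<^esub> \<in> X.Z0"
    unfolding X.Z0_iff
    using X.F0.M.zero_closed module_hom_zero[OF X.F0.M.abelian_group_axioms X.M.M.abelian_group_axioms X.d0_hom]
    by (rule conjI)
  then have "X.Z0 \<noteq> {}" by blast
  with Z0 have "|Func X.Z0 (carrier N)| \<le>o |Func KN KN|"
    by (intro card_of_Func_cong_le) (simp_all add: card_of_Csub_le)
  then show ?thesis
    by (rule ordLeq_transitive[OF X.card_of_Ext1_le ordLeq_transitive[OF _ card_of_Func_KN_le]])
qed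

section \<open>Lower bound: from functionals on sequences to classes in Ext\<close>

text \<open>On the kernel of \<open>F\<^sub>0 \<rightarrow> T\<close> the homomorphism \<open>\<Psi> n\<close> is \<open>z \<mapsto> (\<Sum>\<^sub>t t(b) z\<^sub>t(x\<^sub>n)) a\<close>.\<close>

definition \<Psi> where
  "\<Psi> n = free_lift Dual E.N (\<lambda>t. (\<lambda>p. t path_b \<otimes> u (path_x n) p))"

lemma mult_u_mem:
  assumes "k \<in> carrier K" and "q \<in> Q" and "Q \<subseteq> paths quiver_ab"
  shows "(\<lambda>p. k \<otimes> u q p) \<in> Csub Q"
  by (rule Csub_smult[OF assms(1) u_Csub[OF assms(2,3)]])

lemma x_from_a: "1 \<le> n \<Longrightarrow> path_x n \<in> paths_from_a"
  by (simp add: paths_from_a_def)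

lemma \<Psi>_arg:
  assumes "1 \<le> n"
  shows "(\<lambda>t. (\<lambda>p. t path_b \<otimes> u (path_x n) p)) \<in> carrier T.N \<rightarrow> carrier E.N"
proof
  fix t assume "t \<in> carrier T.N"
  then have "t \<in> carrier C" by (simp add: T.Csub_C)
  then show "(\<lambda>p. t path_b \<otimes> u (path_x n) p) \<in> carrier E.N"
    using mult_u_mem[OF _ x_from_a[OF assms] E.P_paths] by simp
qed

lemma \<Psi>_hom: "1 \<le> n \<Longrightarrow> \<Psi> n \<in> module_hom Dual X.F0 E.N"
  unfolding \<Psi>_def by (rule left_module.free_lift_hom[OF E.left_module_N \<Psi>_arg])

lemma \<Psi>_unit_vec:
  assumes "1 \<le> n" and "t \<in> Csub {path_b}"
  shows "\<Psi> n (unit_vec Dual t) = (\<lambda>p. t path_b \<otimes> u (path_x n) p)"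
  unfolding \<Psi>_def
  using funcset_mem[OF \<Psi>_arg[OF assms(1)], of t] assms(2)
  by (intro left_module.free_lift_unit_vec[OF E.left_module_N]) simp

lemma act_mult_u:
  assumes "f \<in> carrier Dual" and "k \<in> carrier K" and "q \<in> paths quiver_ab"
  shows "act f (\<lambda>p. k \<otimes> u q p) = (\<lambda>p. k \<otimes> act f (u q) p)"
  using assms by (intro ext act_smult) simp_all

text \<open>For m \<ge> 1 the coordinate at x_m is a C^*-linear map \<open>\<pi>\<close> from E to
  T, since E modulo S is a direct sum of copies of T. Composed with \<open>\<Psi> n\<close> it
  agrees with \<open>X.d0\<close> or with zero on unit vectors, hence everywhere. On
  \<open>X.Z0\<close> the arrow coordinates of \<open>\<Psi> n\<close> therefore vanish and only a
  multiple of a remains.\<close>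

lemma \<Psi>_x:
  assumes n: "1 \<le> n" and m: "1 \<le> m" and z: "z \<in> carrier X.F0"
  shows "\<Psi> n z (path_x m) = (if m = n then X.d0 z path_b else \<zero>)"
proof -
  define \<pi> where "\<pi> c = (\<lambda>p. c (path_x m) \<otimes> u path_b p)" for c :: "(two_vertices, nat) qpath \<Rightarrow> 'k"
  have \<pi>: "\<pi> \<in> module_hom Dual E.N T.N"
  proof (rule module_homI)
    fix c assume "c \<in> carrier E.N"
    then have c: "c \<in> Csub paths_from_a" by simp
    note C = E.Csub_C[OF c]
    show "\<pi> c \<in> carrier T.N" using mult_u_mem[of "c (path_x m)" path_b "{path_b}"] C by (simp add: \<pi>_def)
    show "\<pi> (c \<oplus>\<^bsub>E.N\<^esub> d) = \<pi> c \<oplus>\<^bsub>T.N\<^esub> \<pi> d" if "d \<in> carrier E.N" for d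
      using C that E.Csub_C[of d] by (simp add: \<pi>_def l_distr)
    show "\<pi> (f \<odot>\<^bsub>E.N\<^esub> c) = f \<odot>\<^bsub>T.N\<^esub> \<pi> c" if f: "f \<in> carrier Dual" for f
    proof -
      have "f \<odot>\<^bsub>T.N\<^esub> \<pi> c = act f (\<pi> c)"
        using f mult_u_mem[of "c (path_x m)" path_b "{path_b}"] C by (simp add: \<pi>_def)
      also have "\<dots> = (\<lambda>p. c (path_x m) \<otimes> (f (u path_b) \<otimes> u path_b p))"
        unfolding \<pi>_def using C by (subst act_mult_u[OF f]) (simp_all add: act_u[OF f])
      also have "\<dots> = \<pi> (f \<odot>\<^bsub>E.N\<^esub> c)"
        using f c C m coef_mem[OF f, of path_b] act_end_b[OF f C, of "path_x m"]
        by (simp add: \<pi>_def m_ac)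
      finally show ?thesis by (rule sym)
    qed
  qed
  define h where "h z = (if m = n then X.d0 z else (\<lambda>_. \<zero>))" for z
  have h: "h \<in> module_hom Dual X.F0 T.N"
  proof (cases "m = n")
    case True
    then show ?thesis using X.d0_hom by (simp add: h_def[abs_def])
  next
    case False
    have "(\<lambda>_. \<zero>\<^bsub>T.N\<^esub>) \<in> module_hom Dual X.F0 T.N"
      by (rule module_homI) (simp_all only: X.M.M.zero_closed X.M.M.l_zero X.M.smult_r_null)
    with False show ?thesis by (simp add: h_def[abs_def])
  qed
  have "\<pi> (\<Psi> n z) = h z"
  proof (rule left_module.free_hom_eqI[OF T.left_module_N module_hom_comp[OF \<Psi>_hom[OF n] \<pi>] h _ z])
    fix t assume t': "t \<in> carrier T.N"
    then have t: "t \<in> Csub {path_b}" by simp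
    have tb: "t path_b \<in> carrier K" using T.Csub_C[OF t] by simp
    have eq: "t = (\<lambda>p. t path_b \<otimes> u path_b p)"
    proof
      fix p
      show "t p = t path_b \<otimes> u path_b p"
        using t tb by (cases "p = path_b") (simp_all add: u_apply Csub_def del: split_paired_All)
    qed
    show "\<pi> (\<Psi> n (unit_vec Dual t)) = h (unit_vec Dual t)"
    proof (cases "m = n")
      case True
      have "h (unit_vec Dual t) = t"
        using True X.M.free_cover_unit_vec[OF order_refl t'] by (simp add: h_def)
      moreover have "\<pi> (\<Psi> n (unit_vec Dual t)) = (\<lambda>p. t path_b \<otimes> u path_b p)"
        using True tb by (simp add: \<pi>_def \<Psi>_unit_vec[OF n t] u_apply)
      ultimately show ?thesis using eq by simp
    next
      case False
      then show ?thesis using tb by (simp add: \<pi>_def h_def \<Psi>_unit_vec[OF n t] u_apply)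
    qed
  qed
  from fun_cong[OF this, of path_b] have "\<Psi> n z (path_x m) \<otimes> \<one> = h z path_b"
    by (simp add: \<pi>_def u_apply)
  moreover have "\<Psi> n z (path_x m) \<in> carrier K"
    using module_hom_mem[OF \<Psi>_hom[OF n] z] E.Csub_C by simp
  ultimately show ?thesis by (simp add: h_def)
qed

lemma \<Psi>_Z0:
  assumes n: "1 \<le> n" and z: "z \<in> X.Z0"
  shows "\<Psi> n z = (\<lambda>p. \<Psi> n z path_a \<otimes> u path_a p)" and "\<Psi> n z path_a \<in> carrier K"
proof -
  have z0: "z \<in> carrier X.F0" and dz: "X.d0 z = (\<lambda>_. \<zero>)" using z unfolding X.Z0_iff by simp_all
  have mem: "\<Psi> n z \<in> Csub paths_from_a" using module_hom_mem[OF \<Psi>_hom[OF n] z0] by simp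
  show K: "\<Psi> n z path_a \<in> carrier K" using E.Csub_C[OF mem] by simp
  show "\<Psi> n z = (\<lambda>p. \<Psi> n z path_a \<otimes> u path_a p)"
  proof
    fix p
    show "\<Psi> n z p = \<Psi> n z path_a \<otimes> u path_a p"
    proof (cases "p \<in> paths_from_a")
      case True
      then show ?thesis
        using K \<Psi>_x[OF n _ z0] dz by (auto simp: paths_from_a_def u_apply)
    next
      case False
      then have "\<Psi> n z p = \<zero>" using mem by (simp add: Csub_def del: split_paired_All)
      moreover have "p \<noteq> path_a" using False by (auto simp: paths_from_a_def)
      ultimately show ?thesis using K by (simp add: u_apply)
    qed
  qed
qed

text \<open>Entry n belongs to the arrow x_(n+1), since arrows are numbered from 1.
  \<open>\<sigma>\<close> is the restriction to \<open>X.Z0\<close> of the map from F_0 to C^* e_b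
  that sends the unit vector of t to t(b) e_b; its values on the kernel lie in V.\<close>

definition \<sigma> where "\<sigma> z = (\<lambda>n. \<Psi> (Suc n) z path_a)"

lemma \<sigma>_mem: "z \<in> X.Z0 \<Longrightarrow> \<sigma> z \<in> carrier V"
  by (simp add: \<sigma>_def \<Psi>_Z0(2))

lemma \<sigma>_add:
  assumes "z \<in> X.Z0" and "w \<in> X.Z0"
  shows "\<sigma> (z \<oplus>\<^bsub>X.F0\<^esub> w) = \<sigma> z \<oplus>\<^bsub>V\<^esub> \<sigma> w"
proof -
  have zw: "z \<in> carrier X.F0" "w \<in> carrier X.F0" using assms X.Z0_subset by blast+
  have "\<Psi> (Suc n) (z \<oplus>\<^bsub>X.F0\<^esub> w) = \<Psi> (Suc n) z \<oplus>\<^bsub>E.N\<^esub> \<Psi> (Suc n) w" for n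
    by (rule LinearCombinations.module_hom_add[OF \<Psi>_hom zw]) simp
  then show ?thesis by (simp add: \<sigma>_def del: free_module_simps)
qed

text \<open>On \<open>X.Z0\<close> each \<open>\<Psi> n\<close> takes values in the line of a, where
  f acts as multiplication by f(a).\<close>

lemma \<sigma>_smult:
  assumes f: "f \<in> carrier Dual" and z: "z \<in> X.Z0"
  shows "\<sigma> (f \<odot>\<^bsub>X.F0\<^esub> z) = f (u path_a) \<odot>\<^bsub>V\<^esub> \<sigma> z"
proof
  fix n
  have n: "1 \<le> Suc n" by simp
  have zF: "z \<in> carrier X.F0" using z X.Z0_subset by blast
  have "\<Psi> (Suc n) (f \<odot>\<^bsub>X.F0\<^esub> z) = f \<odot>\<^bsub>E.N\<^esub> \<Psi> (Suc n) z"
    by (rule LinearCombinations.module_hom_smult[OF \<Psi>_hom[OF n] f zF])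
  also have "\<dots> = act f (\<Psi> (Suc n) z)"
    using f module_hom_mem[OF \<Psi>_hom[OF n] zF] by simp
  also have "\<dots> = (\<lambda>p. \<Psi> (Suc n) z path_a \<otimes> act f (u path_a) p)"
    by (subst \<Psi>_Z0(1)[OF n z]) (rule act_mult_u[OF f \<Psi>_Z0(2)[OF n z]], simp)
  finally have e: "\<Psi> (Suc n) (f \<odot>\<^bsub>X.F0\<^esub> z) = (\<lambda>p. \<Psi> (Suc n) z path_a \<otimes> act f (u path_a) p)" .
  show "\<sigma> (f \<odot>\<^bsub>X.F0\<^esub> z) n = (f (u path_a) \<odot>\<^bsub>V\<^esub> \<sigma> z) n"
    unfolding \<sigma>_def e using \<Psi>_Z0(2)[OF n z] coef_mem[OF f, of path_a]
    by (simp add: act_u[OF f] u_apply m_comm)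
qed

text \<open>The functional \<open>L\<close> on V, pulled back along \<open>\<sigma>\<close> and
  followed by the inclusion of the line of a into the target.\<close>

definition H where "H L z = (\<lambda>p. L (\<sigma> z) \<otimes> u path_a p)"

text \<open>On V as on the line of a, C^* acts through its value at a, so K-linearity of
  \<open>L\<close> already makes \<open>H L\<close> linear over C^*.\<close>

lemma H_hom:
  assumes L: "L \<in> module_hom K V (regular_module K)"
  shows "H L \<in> module_hom Dual (X.F0\<lparr>carrier := X.Z0\<rparr>) N"
proof (rule module_homI)
  have L_mem: "L (\<sigma> z) \<in> carrier K" if "z \<in> X.Z0" for z
    using module_hom_mem[OF L \<sigma>_mem[OF that]] by simp
  have mem: "H L z \<in> Csub P" if "z \<in> X.Z0" for z
    unfolding H_def by (rule mult_u_mem[OF L_mem[OF that] a_target P_paths])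
  then show "H L z \<in> carrier N" if "z \<in> carrier (X.F0\<lparr>carrier := X.Z0\<rparr>)" for z
    using that by simp
  fix z assume "z \<in> carrier (X.F0\<lparr>carrier := X.Z0\<rparr>)"
  then have z: "z \<in> X.Z0" by simp
  show "H L (z \<oplus>\<^bsub>X.F0\<lparr>carrier := X.Z0\<rparr>\<^esub> w) = H L z \<oplus>\<^bsub>N\<^esub> H L w"
    if "w \<in> carrier (X.F0\<lparr>carrier := X.Z0\<rparr>)" for w
  proof -
    have w: "w \<in> X.Z0" using that by simp
    have "L (\<sigma> (z \<oplus>\<^bsub>X.F0\<^esub> w)) = L (\<sigma> z) \<oplus> L (\<sigma> w)"
      unfolding \<sigma>_add[OF z w] using LinearCombinations.module_hom_add[OF L \<sigma>_mem[OF z] \<sigma>_mem[OF w]]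
      by (simp del: V_simps)
    then show ?thesis
      using L_mem[OF z] L_mem[OF w] by (simp add: H_def l_distr del: free_module_simps)
  qed
  show "H L (f \<odot>\<^bsub>X.F0\<lparr>carrier := X.Z0\<rparr>\<^esub> z) = f \<odot>\<^bsub>N\<^esub> H L z" if f: "f \<in> carrier Dual" for f
  proof -
    have fa: "f (u path_a) \<in> carrier K" using coef_mem[OF f] by simp
    have "L (\<sigma> (f \<odot>\<^bsub>X.F0\<^esub> z)) = f (u path_a) \<otimes> L (\<sigma> z)"
      unfolding \<sigma>_smult[OF f z] using LinearCombinations.module_hom_smult[OF L fa \<sigma>_mem[OF z]]
      by (simp del: V_simps)
    moreover have "f \<odot>\<^bsub>N\<^esub> H L z = act f (H L z)" using f mem[OF z] by simp
    moreover have "act f (H L z) = (\<lambda>p. L (\<sigma> z) \<otimes> act f (u path_a) p)"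
      unfolding H_def by (rule act_mult_u[OF f L_mem[OF z]]) simp
    ultimately show ?thesis
      using L_mem[OF z] fa by (simp add: H_def act_u[OF f] m_ac del: free_module_simps)
  qed
qed

text \<open>The inclusion of V into C^* as the functionals that vanish at both vertices. The
  subtraction undoes the shift between arrows, numbered from 1, and entries, numbered from
  0.\<close>

definition seq_dual :: "(nat \<Rightarrow> 'k) \<Rightarrow> ((two_vertices, nat) qpath \<Rightarrow> 'k) \<Rightarrow> 'k" where
  "seq_dual v = dual_of (\<lambda>q. if path_length q = 1 then v (hd (fst (snd q)) - 1) else \<zero>)"

lemma seq_dual_mem: "v \<in> carrier V \<Longrightarrow> seq_dual v \<in> carrier Dual"
  unfolding seq_dual_def by (rule dual_of_mem) auto

lemma seq_dual_u:
  assumes "v \<in> carrier V"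
  shows "seq_dual v (u path_a) = \<zero>" and "seq_dual v (u path_b) = \<zero>"
    and "1 \<le> n \<Longrightarrow> seq_dual v (u (path_x n)) = v (n - 1)"
  unfolding seq_dual_def using assms
  by (subst dual_of_u; simp; simp add: path_x_def)+

text \<open>The homomorphism g is tested on multiples of the unit vector of b by functionals from V.
  There it depends only on the single value \<open>y\<close>, and contributes the finite sum of the
  v_n y(x_(n+1)). Agreement on unit sequences makes every arrow coefficient of \<open>y\<close>
  vanish, so g contributes nothing on any sequence.\<close>

lemma H_distinct:
  assumes L: "L \<in> module_hom K V (regular_module K)" and L': "L' \<in> module_hom K V (regular_module K)"
    and \<delta>: "\<And>n. L (\<delta> n) = L' (\<delta> n)"
    and g: "g \<in> module_hom Dual X.F0 N"
    and eq: "\<And>z. z \<in> X.Z0 \<Longrightarrow> H L z = g z \<oplus>\<^bsub>N\<^esub> H L' z"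
    and v: "v \<in> carrier V"
  shows "L v = L' v"
proof -
  define t0 where "t0 = u path_b"
  have t0: "t0 \<in> Csub {path_b}" unfolding t0_def by (rule u_Csub) simp_all
  have t0T: "t0 \<in> carrier T.N" using t0 by simp
  note e0 = X.R.unit_vec_free[OF t0T]
  define y where "y = g (unit_vec Dual t0)"
  have yP: "y \<in> Csub P" using module_hom_mem[OF g e0] by (simp add: y_def)
  note yC = Csub_C[OF yP]
  have LK: "L w \<in> carrier K" "L' w \<in> carrier K" if "w \<in> carrier V" for w
    using module_hom_mem[OF L that] module_hom_mem[OF L' that] by simp_all
  have key: "L w = act (seq_dual w) y path_a \<oplus> L' w" if w: "w \<in> carrier V" for w
  proof -
    note r = seq_dual_mem[OF w]
    \<comment> \<open>\<open>seq_dual w\<close> annihilates b in T, so \<open>z\<close> lies in the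
      kernel of \<open>X.d0\<close>, while \<open>\<sigma> z = w\<close>. In this way every sequence
      is attained.\<close>
    define z where "z = seq_dual w \<odot>\<^bsub>X.F0\<^esub> unit_vec Dual t0"
    have zF: "z \<in> carrier X.F0" unfolding z_def by (rule X.F0.smult_closed[OF r e0])
    have "X.d0 z = seq_dual w \<odot>\<^bsub>T.N\<^esub> t0"
      unfolding z_def LinearCombinations.module_hom_smult[OF X.d0_hom r e0]
      by (simp only: X.M.free_cover_unit_vec[OF order_refl t0T])
    also have "\<dots> = act (seq_dual w) t0" using r t0 by simp
    also have "\<dots> = (\<lambda>_. \<zero>)" by (simp add: t0_def act_u[OF r] seq_dual_u[OF w])
    finally have z: "z \<in> X.Z0" unfolding X.Z0_iff using zF by simp
    have "\<Psi> (Suc n) z path_a = w n" for n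
    proof -
      have n: "1 \<le> Suc n" by simp
      have "\<Psi> (Suc n) z = seq_dual w \<odot>\<^bsub>E.N\<^esub> \<Psi> (Suc n) (unit_vec Dual t0)"
        unfolding z_def by (rule LinearCombinations.module_hom_smult[OF \<Psi>_hom[OF n] r e0])
      also have "\<Psi> (Suc n) (unit_vec Dual t0) = u (path_x (Suc n))"
        unfolding \<Psi>_unit_vec[OF n t0] by (rule ext) (simp add: t0_def u_apply)
      also have "seq_dual w \<odot>\<^bsub>E.N\<^esub> u (path_x (Suc n)) = act (seq_dual w) (u (path_x (Suc n)))"
        using r u_Csub[OF x_from_a[OF n] E.P_paths] by simp
      also have "\<dots> = (\<lambda>p. w n \<otimes> u path_a p \<oplus> \<zero> \<otimes> u (path_x (Suc n)) p)"
        unfolding act_u(3)[OF r n] by (simp add: seq_dual_u[OF w])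
      finally show ?thesis using w by (simp add: u_apply)
    qed
    then have \<sigma>: "\<sigma> z = w" by (simp add: \<sigma>_def)
    have "g z = seq_dual w \<odot>\<^bsub>N\<^esub> y"
      unfolding z_def y_def by (rule LinearCombinations.module_hom_smult[OF g r e0])
    also have "\<dots> = act (seq_dual w) y" using r yP by simp
    finally have "H L z = (\<lambda>p. act (seq_dual w) y p \<oplus> H L' z p)" using eq[OF z] by simp
    from fun_cong[OF this, of path_a] show ?thesis
      using LK[OF w] by (simp add: H_def \<sigma> u_apply)
  qed
  \<comment> \<open>The unit sequence \<open>\<delta> n\<close> reads off the coefficient of
    \<open>y\<close> at x_(n+1), and \<open>key\<close> turns the agreement of \<open>L\<close> and
    \<open>L'\<close> there into its vanishing.\<close>
  have y0: "y (path_x (Suc n)) = \<zero>" for n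
  proof -
    have n: "1 \<le> Suc n" by simp
    note r = seq_dual_mem[OF \<delta>_V[of n]]
    have "act (seq_dual (\<delta> n)) y path_a = seq_dual (\<delta> n) (u (path_x (Suc n))) \<otimes> \<Delta> y (path_x (Suc n)) path_a"
    proof (rule act_single[OF r yC])
      fix q assume q: "q \<in> paths quiver_ab" "q \<noteq> path_x (Suc n)"
      then have "seq_dual (\<delta> n) (u q) = \<zero>"
        by (cases rule: paths_cases) (auto simp: seq_dual_u[OF \<delta>_V] \<delta>_def)
      then show "seq_dual (\<delta> n) (u q) \<otimes> \<Delta> y q path_a = \<zero>" using \<Delta>_mem[OF yC] by simp
    qed simp
    also have "\<dots> = y (path_x (Suc n))"
      using yC by (simp add: seq_dual_u[OF \<delta>_V] \<delta>_def comult_apply[OF yC])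
    finally have "L (\<delta> n) = y (path_x (Suc n)) \<oplus> L (\<delta> n)"
      using key[OF \<delta>_V[of n]] \<delta>[of n] by simp
    then show ?thesis using LK(1)[OF \<delta>_V[of n]] yC by (simp add: add.r_cancel_one')
  qed
  note r = seq_dual_mem[OF v]
  \<comment> \<open>With the arrow coefficients of \<open>y\<close> gone, only the term of the
    vertex a could survive, and \<open>seq_dual v\<close> is zero at a.\<close>
  have "act (seq_dual v) y path_a = seq_dual v (u path_a) \<otimes> \<Delta> y path_a path_a"
  proof (rule act_single[OF r yC])
    fix q assume q: "q \<in> paths quiver_ab" "q \<noteq> path_a"
    then have "\<Delta> y q path_a = \<zero>"
    proof (cases rule: paths_cases)
      case (x n)
      then show ?thesis using y0[of "n - 1"] by (simp add: comult_apply[OF yC])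
    qed (simp_all add: comult_apply[OF yC])
    then show "seq_dual v (u q) \<otimes> \<Delta> y q path_a = \<zero>" using coef_mem[OF r q(1)] by simp
  qed simp
  also have "\<dots> = \<zero>" using \<Delta>_mem[OF yC] by (simp add: seq_dual_u[OF v])
  finally show ?thesis using key[OF v] LK(2)[OF v] by simp
qed

lemma card_of_Ext1_lower: "|KKN| \<le>o |carrier (Ext1 \<eta> Dual T.N N)|"
proof -
  obtain B where B: "V.basis B" "range \<delta> \<subseteq> B" "|KN| \<le>o |B - range \<delta>|"
    using exists_sequence_basis by (elim exE conjE)
  let ?B0 = "B - range \<delta>"
  have "|KKN| \<le>o |Func ?B0 (carrier K)|"
    using B(3) card_of_mono1[OF order_refl] KN_not_empty by (rule card_of_Func_cong_le)
  also have "|Func ?B0 (carrier K)| \<le>o |carrier (Ext1 \<eta> Dual T.N N)|"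
  proof -
    \<comment> \<open>Prescribing zero on the unit sequences makes all these functionals agree
      there, as \<open>H_distinct\<close> demands, and leaves the values on \<open>?B0\<close>
      free.\<close>
    have "\<exists>L\<in>module_hom K V (regular_module K). \<forall>b\<in>B. L b = (if b \<in> ?B0 then \<phi> b else \<zero>)"
      if "\<phi> \<in> Func ?B0 (carrier K)" for \<phi>
      using that by (intro V.linear_extension[OF B(1)]) (auto simp: Func_def)
    then obtain L where L: "\<And>\<phi>. \<phi> \<in> Func ?B0 (carrier K) \<Longrightarrow> L \<phi> \<in> module_hom K V (regular_module K)"
      and Lb: "\<And>\<phi> b. \<phi> \<in> Func ?B0 (carrier K) \<Longrightarrow> b \<in> B \<Longrightarrow> L \<phi> b = (if b \<in> ?B0 then \<phi> b else \<zero>)"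
      by metis
    show ?thesis
    proof (rule X.card_of_Ext1_ge)
      show "H (L \<phi>) \<in> module_hom Dual (X.F0\<lparr>carrier := X.Z0\<rparr>) N"
        if "\<phi> \<in> Func ?B0 (carrier K)" for \<phi>
        by (rule H_hom[OF L[OF that]])
      fix \<phi> \<psi> g
      assume \<phi>: "\<phi> \<in> Func ?B0 (carrier K)" and \<psi>: "\<psi> \<in> Func ?B0 (carrier K)"
        and g: "g \<in> module_hom Dual X.F0 N"
        and eq: "\<And>z. z \<in> X.Z0 \<Longrightarrow> H (L \<phi>) z = g z \<oplus>\<^bsub>N\<^esub> H (L \<psi>) z"
      have \<delta>: "L \<phi> (\<delta> n) = L \<psi> (\<delta> n)" for n
      proof -
        have "\<delta> n \<in> B" using B(2) by blast
        then show ?thesis by (simp add: Lb[OF \<phi>] Lb[OF \<psi>])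
      qed
      show "\<phi> = \<psi>"
      proof
        fix b
        show "\<phi> b = \<psi> b"
        proof (cases "b \<in> ?B0")
          case True
          then have "b \<in> carrier V" using B(1) unfolding V.basis_def by blast
          from H_distinct[OF L[OF \<phi>] L[OF \<psi>] \<delta> g eq this] True show ?thesis
            by (simp add: Lb[OF \<phi>] Lb[OF \<psi>])
        next
          case False
          then show ?thesis using \<phi> \<psi> by (simp add: Func_def)
        qed
      qed
    qed
  qed
  finally show ?thesis .
qed

lemma Ext1_dimension:
  shows "has_dimension K (Ext1 \<eta> Dual T.N N) ( |carrier K| ^c ( |carrier K| ^c natLeq))"
    and "carrier (Ext1 \<eta> Dual T.N N) \<noteq> {\<zero>\<^bsub>Ext1 \<eta> Dual T.N N\<^esub>}"
proof -
  let ?Ext = "Ext1 \<eta> Dual T.N N"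
  interpret Ext: vectorspace K ?Ext by (rule X.vectorspace_Ext1)
  have \<kappa>: "|carrier K| ^c ( |carrier K| ^c natLeq) = |KKN|"
    by (simp add: cexp_def Field_card_of Field_natLeq)
  have card: "|carrier ?Ext| =o |KKN|"
    using card_of_Ext1_upper card_of_Ext1_lower by (simp add: ordIso_iff_ordLeq)
  \<comment> \<open>The strict inequality puts |K|, which is at most |K^N|, below the cardinality of
    Ext; for such a space the cardinality is also the dimension.\<close>
  have KN_less: "|KN| <o |carrier ?Ext|"
    by (rule ordLess_ordLeq_trans[OF card_of_less_Func card_of_Ext1_lower])
  have inf: "infinite (carrier ?Ext)"
    by (rule card_of_ordLeq_infinite[OF ordLess_imp_ordLeq[OF KN_less] infinite_KN])
  have "has_dimension K ?Ext |carrier ?Ext|"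
    by (rule Ext.has_dimension_card_of_carrier[OF ordLeq_ordLess_trans[OF card_of_K_le KN_less] inf])
  then show "has_dimension K ?Ext ( |carrier K| ^c ( |carrier K| ^c natLeq))"
    unfolding has_dimension_def \<kappa> using ordIso_transitive[OF _ card] by blast
  show "carrier ?Ext \<noteq> {\<zero>\<^bsub>?Ext\<^esub>}"
  proof
    assume "carrier ?Ext = {\<zero>\<^bsub>?Ext\<^esub>}"
    then have "finite (carrier ?Ext)" by simp
    with inf show False by (rule notE)
  qed
qed

end

theorem mainTheorem1:
  fixes K :: "('k, 'x) ring_scheme"
  assumes "field K"
  shows "simple_comodule K quiver_ab (comod_S K) \<and>
    simple_comodule K quiver_ab (comod_T K) \<and>
    injective_hull TYPE('y) TYPE('z) K quiver_ab (comod_S K) (comod_E K) (\<lambda>s. s) \<and>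
    vectorspace.basis K (comod_E K) ({elem_a K} \<union> {elem_x K n | n. n \<ge> 1}) \<and>
    has_dimension K (Ext1_dual K quiver_ab (comod_T K) (comod_S K))
      ( |carrier K| ^c ( |carrier K| ^c natLeq)) \<and>
    has_dimension K (Ext1_dual K quiver_ab (comod_T K) (comod_E K))
      ( |carrier K| ^c ( |carrier K| ^c natLeq)) \<and>
    carrier (Ext1_dual K quiver_ab (comod_T K) (comod_E K)) \<noteq>
      {\<zero>\<^bsub>Ext1_dual K quiver_ab (comod_T K) (comod_E K)\<^esub>}"
proof -
  interpret path_coalgebra K by (rule path_coalgebra.intro[OF assms])
  \<comment> \<open>Both dimensions are instances of one computation, with target spanned by a alone
    or by all paths from a.\<close>
  interpret S: ext_target K "{path_a}"
    by unfold_locales (simp_all add: prefix_closed_a paths_from_a_def)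
  interpret E: ext_target K paths_from_a
    by unfold_locales (rule prefix_closed_from_a, simp_all add: paths_from_a_def)
  have from_a: "paths_from_a \<subseteq> paths quiver_ab"
    using prefix_closed_from_a by (simp add: prefix_closed_def)
  show ?thesis
    unfolding comod_eqs Ext1_dual_def
    by (intro conjI simple_comodule_comod prefix_closed_a prefix_closed_b injective_hull_from_a
        path_subspace.basis_unit_vecs[OF path_subspace_comod] from_a S.Ext1_dimension(1) E.Ext1_dimension)
qed

end
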